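(* Let $n,m,p$ be non-negative integers with $n>0$, and let $S\in\tilde L_{n,m,p}$ be a Lomadze system. (1) For every $\chi=(\chi_0,\chi_1)\in\mathbb{Z}_{\le0}\times\mathbb{Z}_{\ge0}$ with $n\chi_0+(n-1)\chi_1<0$ and $\chi_0+\chi_1>0$: $S$ is controllable if and only if it is $\chi$-semistable, if and only if it is $\chi$-stable. (2) For every $\chi=(\chi_0,\chi_1)\in\mathbb{Z}_{\le0}\times\mathbb{Z}_{\ge0}$ with $n\chi_0+(n+1)\chi_1>0$ and $\chi_0+\chi_1<0$: $S$ is observable if and only if it is $\chi$-semistable, if and only if it is $\chi$-stable.
   Context: $k$ is an algebraically closed field of characteristic $0$. A Lomadze system of type $(n,m,p)$ is a triple $(K,L,M)$ with $K,L\in k^{(n+p)\times n}$, $M\in k^{(n+p)\times(p+m)}$; $\tilde L_{n,m,p}$ is the vector space of these. $G=\mathrm{GL}_n\times\mathrm{GL}_{n+p}$ acts by $(g_0,g_1)\cdot(K,L,M)=(g_1Kg_0^{-1},g_1Lg_0^{-1},g_1M)$. $(K,L,M)$ is controllable if $\mathrm{rk}[sK+tL]=n$ for some $(s,t)\in k^2$ and $\mathrm{rk}[sK+tL,M]=n+p$ for all $(s,t)\in k^2\setminus\{0\}$. It is observable if $\mathrm{rk}[sK+tL]=n$ for all $(s,t)\in k^2\setminus\{0\}$ and $\mathrm{rk}[sK+tL,M]=n+p$ for some $(s,t)\in k^2$. $(\chi_0,\chi_1)\in\mathbb{Z}^2$ is identified with the character $\chi(g_0,g_1)=\det(g_0)^{\chi_0}\det(g_1)^{\chi_1}$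 of $G$. $S$ is $\chi$-semistable if for some $N\ge1$ there is a regular function $f$ on $\tilde L_{n,m,p}$ with $f(gx)=\chi(g)^Nf(x)$ for all $g,x$ and $f(S)\neq0$; it is $\chi$-stable if there are such $N,f$ for which moreover all $G$-orbits in $\{f\ne0\}$ are closed in $\{f\neq 0\}$ and $\dim G\cdot S=\dim G/\Delta$, where $\Delta$ is the kernel of the action. *)

theory Defs
  imports
    "HOL-Analysis.Abstract_Topology"
    "HOL-Library.Extended_Nat"
    "HOL-Computational_Algebra.Polynomial"
    "HOL-Algebra.Group_Action"
    "Jordan_Normal_Form.DL_Rank"
begin

text \<open>The algebra of polynomial functions generated by a set \<open>C\<close> of coordinate functions. Only the
  restriction of its members to the affine space carrying these coordinates is ever used.\<close>

inductive_set regular_functions :: "('x \<Rightarrow> 'k::comm_ring_1) set \<Rightarrow> ('x \<Rightarrow> 'k) set"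
  for C where
  const: "(\<lambda>_. c) \<in> regular_functions C"
| coord: "f \<in> C \<Longrightarrow> f \<in> regular_functions C"
| add: "f \<in> regular_functions C \<Longrightarrow> g \<in> regular_functions C \<Longrightarrow>
    (\<lambda>x. f x + g x) \<in> regular_functions C"
| mult: "f \<in> regular_functions C \<Longrightarrow> g \<in> regular_functions C \<Longrightarrow>
    (\<lambda>x. f x * g x) \<in> regular_functions C"

definition zariski :: "('x \<Rightarrow> 'k::idom) set \<Rightarrow> 'x set \<Rightarrow> 'x topology" where
  "zariski C X = topology (\<lambda>U. \<exists>F \<subseteq> regular_functions C. U = {x \<in> X. \<exists>f\<in>F. f x \<noteq> 0})"

lemma istopology_zariski:
  fixes C :: "('x \<Rightarrow> 'k::idom) set"
  shows "istopology (\<lambda>U. \<exists>F \<subseteq> regular_functions C. U = {x \<in> X. \<exists>f\<in>F. f x \<noteq> 0})"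
  unfolding istopology_def
proof (intro conjI allI impI)
  fix S T
  assume "\<exists>F \<subseteq> regular_functions C. S = {x \<in> X. \<exists>f\<in>F. f x \<noteq> 0}"
    and "\<exists>F \<subseteq> regular_functions C. T = {x \<in> X. \<exists>f\<in>F. f x \<noteq> 0}"
  then obtain F G where F: "F \<subseteq> regular_functions C" "S = {x \<in> X. \<exists>f\<in>F. f x \<noteq> 0}"
    and G: "G \<subseteq> regular_functions C" "T = {x \<in> X. \<exists>f\<in>G. f x \<noteq> 0}"
    by blast
  define H where "H = (\<lambda>(f, g) x. f x * g x) ` (F \<times> G)"
  have "H \<subseteq> regular_functions C"
    using F(1) G(1) unfolding H_def by (auto intro!: regular_functions.mult)
  moreover have "(\<exists>h\<in>H. h x \<noteq> 0) \<longleftrightarrow> (\<exists>f\<in>F. f x \<noteq> 0) \<and> (\<exists>g\<in>G. g x \<noteq> 0)" for x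
    unfolding H_def by simp
  then have "S \<inter> T = {x \<in> X. \<exists>h\<in>H. h x \<noteq> 0}"
    unfolding F(2) G(2) by auto
  ultimately show "\<exists>F \<subseteq> regular_functions C. S \<inter> T = {x \<in> X. \<exists>f\<in>F. f x \<noteq> 0}"
    by (intro exI[of _ H]) simp
next
  fix \<K>
  assume "\<forall>K\<in>\<K>. \<exists>F \<subseteq> regular_functions C. K = {x \<in> X. \<exists>f\<in>F. f x \<noteq> 0}"
  then have *: "\<exists>F \<subseteq> regular_functions C. K = {x \<in> X. \<exists>f\<in>F. f x \<noteq> 0}" if "K \<in> \<K>" for K
    using that by (rule bspec)
  define H where "H = {f \<in> regular_functions C. \<forall>x\<in>X. f x \<noteq> 0 \<longrightarrow> x \<in> \<Union>\<K>}"
  have "x \<in> X \<and> (\<exists>f\<in>H. f x \<noteq> 0)" if "K \<in> \<K>" "x \<in> K" for K x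
  proof -
    obtain F where F: "F \<subseteq> regular_functions C" "K = {x \<in> X. \<exists>f\<in>F. f x \<noteq> 0}"
      using *[OF \<open>K \<in> \<K>\<close>] by (elim exE conjE)
    from \<open>x \<in> K\<close> obtain f where f: "x \<in> X" "f \<in> F" "f x \<noteq> 0"
      unfolding F(2) by auto
    have "y \<in> K" if "y \<in> X" "f y \<noteq> 0" for y
      unfolding F(2) using that f(2) by auto
    with f(2) F(1) \<open>K \<in> \<K>\<close> have "f \<in> H"
      unfolding H_def by auto
    with f(1,3) show ?thesis
      by auto
  qed
  moreover have "x \<in> \<Union>\<K>" if "x \<in> X" "f \<in> H" "f x \<noteq> 0" for x f
    using that unfolding H_def by simp
  ultimately have "\<Union>\<K> = {x \<in> X. \<exists>f\<in>H. f x \<noteq> 0}"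
    by (intro equalityI subsetI) (blast, blast)
  moreover have "H \<subseteq> regular_functions C"
    unfolding H_def by simp
  ultimately show "\<exists>F \<subseteq> regular_functions C. \<Union>\<K> = {x \<in> X. \<exists>f\<in>F. f x \<noteq> 0}"
    by (intro exI[of _ H] conjI)
qed

lemma openin_zariski:
  "openin (zariski C X) U \<longleftrightarrow> (\<exists>F \<subseteq> regular_functions C. U = {x \<in> X. \<exists>f\<in>F. f x \<noteq> 0})"
  by (simp only: zariski_def topology_inverse'[OF istopology_zariski])

lemma topspace_zariski [simp]: "topspace (zariski C X) = X"
proof -
  have "openin (zariski C X) X"
    unfolding openin_zariski
    by (intro exI[of _ "{\<lambda>_. 1}"]) (auto intro: regular_functions.const)
  moreover have "topspace (zariski C X) \<subseteq> X"
    using openin_topspace[of "zariski C X"] unfolding openin_zariski by auto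
  ultimately show ?thesis
    by (intro equalityI openin_subset)
qed

lemma closedin_zariski:
  "closedin (zariski C X) Z \<longleftrightarrow> (\<exists>F \<subseteq> regular_functions C. Z = {x \<in> X. \<forall>f\<in>F. f x = 0})"
proof -
  have *: "(Z \<subseteq> X \<and> X - Z = {x \<in> X. \<exists>f\<in>F. f x \<noteq> 0}) \<longleftrightarrow> Z = {x \<in> X. \<forall>f\<in>F. f x = 0}"
    for F :: "('a \<Rightarrow> 'b) set"
    by blast
  show ?thesis
    unfolding closedin_def openin_zariski topspace_zariski *[symmetric] by iprover
qed

definition quotient_topology :: "'x topology \<Rightarrow> ('x \<Rightarrow> 'y) \<Rightarrow> 'y topology" where
  "quotient_topology T q =
    topology (\<lambda>U. U \<subseteq> q ` topspace T \<and> openin T {x \<in> topspace T. q x \<in> U})"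

lemma openin_quotient_topology:
  "openin (quotient_topology T q) U \<longleftrightarrow>
    U \<subseteq> q ` topspace T \<and> openin T {x \<in> topspace T. q x \<in> U}"
proof -
  have "istopology (\<lambda>U. U \<subseteq> q ` topspace T \<and> openin T {x \<in> topspace T. q x \<in> U})"
    unfolding istopology_def
  proof (intro conjI allI impI)
    fix U V
    assume "U \<subseteq> q ` topspace T \<and> openin T {x \<in> topspace T. q x \<in> U}"
      and "V \<subseteq> q ` topspace T \<and> openin T {x \<in> topspace T. q x \<in> V}"
    moreover have "{x \<in> topspace T. q x \<in> U \<inter> V} =
        {x \<in> topspace T. q x \<in> U} \<inter> {x \<in> topspace T. q x \<in> V}"
      by blast
    ultimately show "U \<inter> V \<subseteq> q ` topspace T" "openin T {x \<in> topspace T. q x \<in> U \<inter> V}"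
      by auto
  next
    fix \<K>
    assume *: "\<forall>K\<in>\<K>. K \<subseteq> q ` topspace T \<and> openin T {x \<in> topspace T. q x \<in> K}"
    have "{x \<in> topspace T. q x \<in> \<Union>\<K>} = (\<Union>K\<in>\<K>. {x \<in> topspace T. q x \<in> K})"
      by blast
    with * show "\<Union>\<K> \<subseteq> q ` topspace T" "openin T {x \<in> topspace T. q x \<in> \<Union>\<K>}"
      by auto
  qed
  then show ?thesis
    unfolding quotient_topology_def by (simp add: topology_inverse')
qed

lemma quotient_map_quotient_topology: "quotient_map T (quotient_topology T q) q"
proof -
  have "openin (quotient_topology T q) (q ` topspace T)"
  proof -
    have "{x \<in> topspace T. q x \<in> q ` topspace T} = topspace T"
      by blast
    then show ?thesis
      unfolding openin_quotient_topology by simp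
  qed
  moreover have "topspace (quotient_topology T q) \<subseteq> q ` topspace T"
    using openin_topspace[of "quotient_topology T q"] unfolding openin_quotient_topology
    by (rule conjunct1)
  ultimately have "topspace (quotient_topology T q) = q ` topspace T"
    by (intro equalityI openin_subset)
  then show ?thesis
    by (simp add: quotient_map_def openin_quotient_topology)
qed

definition irreducible_closed :: "'x topology \<Rightarrow> 'x set \<Rightarrow> bool" where
  "irreducible_closed T Z \<longleftrightarrow> closedin T Z \<and> Z \<noteq> {} \<and>
    (\<forall>A B. closedin T A \<and> closedin T B \<and> Z = A \<union> B \<longrightarrow> Z = A \<or> Z = B)"

text \<open>The Krull dimension: the supremum of the lengths \<open>d\<close> of strictly increasing chains
  \<open>Z 0 \<subset> \<dots> \<subset> Z d\<close> of irreducible closed subsets (with value 0 for the empty space).\<close>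

definition krull_dim :: "'x topology \<Rightarrow> enat" where
  "krull_dim T = Sup {enat d | d. \<exists>Z :: nat \<Rightarrow> 'x set.
    (\<forall>i\<le>d. irreducible_closed T (Z i)) \<and> (\<forall>i<d. Z i \<subset> Z (Suc i))}"

type_synonym 'k lomadze = "'k mat \<times> 'k mat \<times> 'k mat"

definition lomadze_systems :: "nat \<Rightarrow> nat \<Rightarrow> nat \<Rightarrow> 'k lomadze set" where
  "lomadze_systems n m p =
    carrier_mat (n + p) n \<times> carrier_mat (n + p) n \<times> carrier_mat (n + p) (p + m)"

definition lomadze_coords :: "nat \<Rightarrow> nat \<Rightarrow> nat \<Rightarrow> ('k lomadze \<Rightarrow> 'k) set" where
  "lomadze_coords n m p =
    {\<lambda>(K, L, M). K $$ (i, j) | i j. i < n + p \<and> j < n} \<union>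
    {\<lambda>(K, L, M). L $$ (i, j) | i j. i < n + p \<and> j < n} \<union>
    {\<lambda>(K, L, M). M $$ (i, j) | i j. i < n + p \<and> j < p + m}"

definition lomadze_top :: "nat \<Rightarrow> nat \<Rightarrow> nat \<Rightarrow> 'k::idom lomadze topology" where
  "lomadze_top n m p = zariski (lomadze_coords n m p) (lomadze_systems n m p)"

abbreviation rk :: "'k::field mat \<Rightarrow> nat" where
  "rk A \<equiv> vec_space.rank (dim_row A) A"

definition hconcat :: "'k mat \<Rightarrow> 'k mat \<Rightarrow> 'k mat" where
  "hconcat A B = mat_of_cols (dim_row A) (cols A @ cols B)"

fun controllable :: "nat \<Rightarrow> nat \<Rightarrow> 'k::field lomadze \<Rightarrow> bool" where
  "controllable n p (K, L, M) \<longleftrightarrow>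
    (\<exists>s t. rk (s \<cdot>\<^sub>m K + t \<cdot>\<^sub>m L) = n) \<and>
    (\<forall>s t. (s, t) \<noteq> (0, 0) \<longrightarrow> rk (hconcat (s \<cdot>\<^sub>m K + t \<cdot>\<^sub>m L) M) = n + p)"

fun observable :: "nat \<Rightarrow> nat \<Rightarrow> 'k::field lomadze \<Rightarrow> bool" where
  "observable n p (K, L, M) \<longleftrightarrow>
    (\<forall>s t. (s, t) \<noteq> (0, 0) \<longrightarrow> rk (s \<cdot>\<^sub>m K + t \<cdot>\<^sub>m L) = n) \<and>
    (\<exists>s t. rk (hconcat (s \<cdot>\<^sub>m K + t \<cdot>\<^sub>m L) M) = n + p)"

definition GL :: "nat \<Rightarrow> 'k::field mat monoid" where
  "GL n = units_of (ring_mat TYPE('k) n ())"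

lemma group_GL: "group (GL n)"
  unfolding GL_def by (intro monoid.units_group semiring.axioms(2) semiring_mat)

lemma carrier_GL: "carrier (GL n) = {A \<in> carrier_mat n n. det A \<noteq> 0}"
proof (intro Set.set_eqI iffI)
  fix A :: "'a mat"
  assume "A \<in> carrier (GL n)"
  then have A: "A \<in> Units (ring_mat TYPE('a) n ())"
    by (simp add: GL_def units_of_def)
  then have "A \<in> carrier_mat n n"
    by (simp add: Units_def ring_mat_simps)
  with unit_imp_det_non_zero[OF A] show "A \<in> {A \<in> carrier_mat n n. det A \<noteq> 0}"
    by simp
next
  fix A :: "'a mat"
  assume "A \<in> {A \<in> carrier_mat n n. det A \<noteq> 0}"
  then have "A \<in> Units (ring_mat TYPE('a) n ())"
    by (intro det_non_zero_imp_unit) simp_all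
  then show "A \<in> carrier (GL n)"
    by (simp add: GL_def units_of_def)
qed

definition lomadze_group :: "nat \<Rightarrow> nat \<Rightarrow> ('k::field mat \<times> 'k mat) monoid" where
  "lomadze_group n p = GL n \<times>\<times> GL (n + p)"

fun lomadze_act ::
    "nat \<Rightarrow> nat \<Rightarrow> 'k::field mat \<times> 'k mat \<Rightarrow> 'k lomadze \<Rightarrow> 'k lomadze" where
  "lomadze_act n p (g0, g1) (K, L, M) =
    (g1 * K * inv\<^bsub>GL n\<^esub> g0, g1 * L * inv\<^bsub>GL n\<^esub> g0, g1 * M)"

abbreviation lomadze_orbit :: "nat \<Rightarrow> nat \<Rightarrow> 'k::field lomadze \<Rightarrow> 'k lomadze set" where
  "lomadze_orbit n p \<equiv> orbit (lomadze_group n p) (lomadze_act n p)"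

definition lomadze_kernel :: "nat \<Rightarrow> nat \<Rightarrow> nat \<Rightarrow> ('k::field mat \<times> 'k mat) set" where
  "lomadze_kernel n m p =
    {g \<in> carrier (lomadze_group n p). \<forall>x \<in> lomadze_systems n m p. lomadze_act n p g x = x}"

text \<open>The group is a principal open subset of the affine space of pairs of square matrices, so
  its Zariski topology is cut out by the polynomial functions in the matrix entries; the inverses
  of the determinants do not change the closed sets.\<close>

definition lomadze_group_top :: "nat \<Rightarrow> nat \<Rightarrow> ('k::field mat \<times> 'k mat) topology" where
  "lomadze_group_top n p = zariski
    ({\<lambda>(g0, g1). g0 $$ (i, j) | i j. i < n \<and> j < n} \<union>
     {\<lambda>(g0, g1). g1 $$ (i, j) | i j. i < n + p \<and> j < n + p})
    (carrier (lomadze_group n p))"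

text \<open>The underlying space of the algebraic group \<open>G/\<Delta>\<close>: the set of cosets with the quotient
  topology.\<close>

definition lomadze_quotient_top :: "nat \<Rightarrow> nat \<Rightarrow> nat \<Rightarrow> ('k::field mat \<times> 'k mat) set topology"
  where "lomadze_quotient_top n m p = quotient_topology (lomadze_group_top n p)
    (\<lambda>g. lomadze_kernel n m p #>\<^bsub>lomadze_group n p\<^esub> g)"

fun character :: "int \<times> int \<Rightarrow> 'k::field mat \<times> 'k mat \<Rightarrow> 'k" where
  "character (\<chi>0, \<chi>1) (g0, g1) = det g0 powi \<chi>0 * det g1 powi \<chi>1"

definition semi_invariant ::
    "nat \<Rightarrow> nat \<Rightarrow> nat \<Rightarrow> int \<times> int \<Rightarrow> nat \<Rightarrow> ('k::field lomadze \<Rightarrow> 'k) \<Rightarrow> bool" where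
  "semi_invariant n m p \<chi> N f \<longleftrightarrow> f \<in> regular_functions (lomadze_coords n m p) \<and>
    (\<forall>g \<in> carrier (lomadze_group n p). \<forall>x \<in> lomadze_systems n m p.
      f (lomadze_act n p g x) = character \<chi> g ^ N * f x)"

definition chi_semistable ::
    "nat \<Rightarrow> nat \<Rightarrow> nat \<Rightarrow> int \<times> int \<Rightarrow> 'k::field lomadze \<Rightarrow> bool" where
  "chi_semistable n m p \<chi> S \<longleftrightarrow> (\<exists>N\<ge>1. \<exists>f. semi_invariant n m p \<chi> N f \<and> f S \<noteq> 0)"

definition chi_stable ::
    "nat \<Rightarrow> nat \<Rightarrow> nat \<Rightarrow> int \<times> int \<Rightarrow> 'k::field lomadze \<Rightarrow> bool" where
  "chi_stable n m p \<chi> S \<longleftrightarrow> (\<exists>N\<ge>1. \<exists>f. semi_invariant n m p \<chi> N f \<and> f S \<noteq> 0 \<and>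
    (\<forall>x \<in> lomadze_systems n m p. f x \<noteq> 0 \<longrightarrow>
      closedin (subtopology (lomadze_top n m p) {y \<in> lomadze_systems n m p. f y \<noteq> 0})
        (lomadze_orbit n p x)) \<and>
    krull_dim (subtopology (lomadze_top n m p) (lomadze_orbit n p S)) =
      krull_dim (lomadze_quotient_top n m p :: ('k mat \<times> 'k mat) set topology))"

end

theory Submission
  imports Defs "Jordan_Normal_Form.Char_Poly"
begin

text \<open>
  Put \<open>a = -\<chi>0\<close> and \<open>b = \<chi>1\<close>: a semi-invariant of weight \<open>\<chi>\<close> scales by a power of
  \<open>det g0 ^ (-a) * det g1 ^ b\<close>. In the first chamber \<open>a/b\<close> lies strictly between \<open>(n - 1)/n\<close> and \<open>1\<close>, in
  the second one strictly between \<open>1\<close> and \<open>(n + 1)/n\<close>. Both chambers are treated by the same three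
  arguments.

  \<^bold>\<open>Semistable systems are controllable or observable.\<close> Two kinds of one-parameter subgroups force a
  semi-invariant to vanish: subspaces \<open>U\<close> of the domain, of dimension \<open>d\<close>, and \<open>W\<close> of the target, of
  dimension \<open>c\<close>, with \<open>K U + L U \<subseteq> W\<close> and \<open>b c < a d\<close> (\<open>destabilizing_subsystem\<close>), and quotients of
  dimensions \<open>(c0, c1)\<close> that kill \<open>M\<close> and have \<open>a c0 < b c1\<close> (\<open>destabilizing_quotient\<close>). A rank condition that
  fails at one point \<open>(s, t)\<close> produces such data of dimension at most one. If instead all members of a
  pencil are degenerate, take kernel vectors of \<open>K + j L\<close> for sufficiently many natural numbers \<open>j\<close>; the first of
  them that depends on its predecessors gives a subspace whose image under \<open>K\<close> and \<open>L\<close> has smaller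
  dimension (\<open>singular_pencil_subspace\<close>). The bounds on \<open>a/b\<close> are exactly what makes these data
  destabilizing.

  \<^bold>\<open>Controllable or observable systems are semistable.\<close> For matrices \<open>P, Q\<close> of format \<open>b \<times> a\<close> and a suitable
  \<open>R\<close> the determinant of \<open>[P \<otimes> K + Q \<otimes> L | (1 \<otimes> M) R]\<close> is a semi-invariant of weight \<open>(-a, b)\<close>, and \<open>R\<close>
  can be chosen with a nonzero value as soon as \<open>P \<otimes> K + Q \<otimes> L\<close> is injective and becomes surjective together
  with \<open>1 \<otimes> M\<close> (\<open>det_form_nonvanishing\<close>). Products of two such determinants reach every weight in
  a chamber: one of weight \<open>(-1, 1)\<close>, coming from a regular point of the pencil, and one of weight
  \<open>(-(n - 1), n)\<close> or \<open>(-(n + 1), n)\<close>, in which \<open>P\<close> and \<open>Q\<close> are shift matrices. For the latter, kernel elements are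
  sequences with \<open>A v_i + B v_(i+1) = 0\<close>; reading a linear relation between their members as a polynomial and
  dividing by a root shows that they vanish (\<open>shift_sequence_vanishes\<close>).

  \<^bold>\<open>They are even stable.\<close> A homomorphism between two controllable, or two observable, systems that
  kills the framing \<open>M\<close> is zero: on its image the pencil is generically injective and everywhere
  surjective, or conversely, and a square pencil over an algebraically closed field has a singular
  member (\<open>controllable_rigid_pair\<close>, \<open>observable_rigid_pair\<close>). Hence, where the semi-invariant does not
  vanish, two systems lie in one orbit if and only if there are homomorphisms that respect the framing up to a
  scalar and do not vanish, in both directions; this is a rank condition on linear systems with regular
  coefficients, so orbits are closed (\<open>closedin_orbit\<close>). The same rigidity makes the group element that
  transports \<open>S\<close> to a point of its orbit unique, and Cramer's rule expresses it locally by fractions of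
  regular functions. So the orbit map is a homeomorphism and \<open>\<Delta>\<close> is trivial, which gives the equality
  of Krull dimensions without any dimension theory (\<open>krull_dim_orbit\<close>).
\<close>

section \<open>Injective and surjective matrices\<close>

text \<open>
  One-sided inverses make these notions compose; the descriptions by kernels are derived below.
\<close>

definition injective_mat :: "'a::field mat \<Rightarrow> bool" where
  "injective_mat A \<longleftrightarrow> (\<exists>B \<in> carrier_mat (dim_col A) (dim_row A). B * A = 1\<^sub>m (dim_col A))"

definition surjective_mat :: "'a::field mat \<Rightarrow> bool" where
  "surjective_mat A \<longleftrightarrow> (\<exists>B \<in> carrier_mat (dim_col A) (dim_row A). A * B = 1\<^sub>m (dim_row A))"

lemma mult_mat_entry:
  "A \<in> carrier_mat r k \<Longrightarrow> B \<in> carrier_mat k c \<Longrightarrow> i < r \<Longrightarrow> j < c \<Longrightarrow>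
    (A * B) $$ (i, j) = (\<Sum>l<k. A $$ (i, l) * B $$ (l, j))"
  by (simp add: scalar_prod_def atLeast0LessThan)

lemma dim_hconcat [simp]:
  "dim_row (hconcat A B) = dim_row A"
  "dim_col (hconcat A B) = dim_col A + dim_col B"
  unfolding hconcat_def by auto

lemma hconcat_carrier:
  assumes "A \<in> carrier_mat r c" "B \<in> carrier_mat r q"
  shows "hconcat A B \<in> carrier_mat r (c + q)"
  using assms by (intro carrier_matI) auto

lemma hconcat_index:
  assumes "A \<in> carrier_mat r c" "B \<in> carrier_mat r q" "i < r" "j < c + q"
  shows "hconcat A B $$ (i, j) = (if j < c then A $$ (i, j) else B $$ (i, j - c))"
  using assms unfolding hconcat_def by (auto simp: mat_of_cols_index nth_append)

lemma mult_hconcat: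
  fixes G :: "'a::comm_ring_1 mat"
  assumes "G \<in> carrier_mat k r" "A \<in> carrier_mat r c" "B \<in> carrier_mat r q"
  shows "G * hconcat A B = hconcat (G * A) (G * B)"
proof (rule eq_matI)
  have GA: "G * A \<in> carrier_mat k c" "G * B \<in> carrier_mat k q"
    using assms by auto
  show "dim_row (G * hconcat A B) = dim_row (hconcat (G * A) (G * B))"
    "dim_col (G * hconcat A B) = dim_col (hconcat (G * A) (G * B))"
    using hconcat_carrier[OF assms(2,3)] hconcat_carrier[OF GA] assms by auto
  fix i j
  assume "i < dim_row (hconcat (G * A) (G * B))" "j < dim_col (hconcat (G * A) (G * B))"
  then have ij: "i < k" "j < c + q"
    using hconcat_carrier[OF GA] by auto
  have "col (hconcat A B) j = (if j < c then col A j else col B (j - c))"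
    using assms ij hconcat_carrier[OF assms(2,3)]
    by (intro eq_vecI) (auto simp: hconcat_index[OF assms(2,3)])
  then show "(G * hconcat A B) $$ (i, j) = hconcat (G * A) (G * B) $$ (i, j)"
    using ij assms hconcat_carrier[OF assms(2,3)] by (auto simp: hconcat_index[OF GA])
qed

lemma hconcat_mult_vec:
  fixes A :: "'a::comm_ring_1 mat"
  assumes A: "A \<in> carrier_mat r c" and B: "B \<in> carrier_mat r q"
    and v: "v \<in> carrier_vec c" and w: "w \<in> carrier_vec q"
  shows "hconcat A B *\<^sub>v (v @\<^sub>v w) = A *\<^sub>v v + B *\<^sub>v w"
proof (rule eq_vecI)
  note AB = hconcat_carrier[OF A B]
  show "dim_vec (hconcat A B *\<^sub>v (v @\<^sub>v w)) = dim_vec (A *\<^sub>v v + B *\<^sub>v w)"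
    using AB A B by auto
  fix i assume "i < dim_vec (A *\<^sub>v v + B *\<^sub>v w)"
  then have i: "i < r" using B by auto
  have "row (hconcat A B) i = row A i @\<^sub>v row B i"
    using i A B AB by (intro eq_vecI) (auto simp: hconcat_index[OF A B])
  then show "(hconcat A B *\<^sub>v (v @\<^sub>v w)) $ i = (A *\<^sub>v v + B *\<^sub>v w) $ i"
    using i A B AB v w by (simp add: scalar_prod_append[of _ c _ q])
qed

lemma transpose_hconcat_mult_vec:
  fixes A :: "'a::comm_ring_1 mat"
  assumes A: "A \<in> carrier_mat r c" and B: "B \<in> carrier_mat r q" and v: "v \<in> carrier_vec r"
  shows "(hconcat A B)\<^sup>T *\<^sub>v v = (A\<^sup>T *\<^sub>v v) @\<^sub>v (B\<^sup>T *\<^sub>v v)"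
proof (rule eq_vecI)
  note AB = hconcat_carrier[OF A B]
  show "dim_vec ((hconcat A B)\<^sup>T *\<^sub>v v) = dim_vec ((A\<^sup>T *\<^sub>v v) @\<^sub>v (B\<^sup>T *\<^sub>v v))"
    using AB A B by auto
  fix i assume "i < dim_vec ((A\<^sup>T *\<^sub>v v) @\<^sub>v (B\<^sup>T *\<^sub>v v))"
  then have i: "i < c + q" using A B by auto
  have "col (hconcat A B) i = (if i < c then col A i else col B (i - c))"
    using i A B AB by (intro eq_vecI) (auto simp: hconcat_index[OF A B])
  then show "((hconcat A B)\<^sup>T *\<^sub>v v) $ i = ((A\<^sup>T *\<^sub>v v) @\<^sub>v (B\<^sup>T *\<^sub>v v)) $ i"
    using i A B AB v by auto
qed

lemma append_vec_eq_0:
  assumes "v \<in> carrier_vec n" "w \<in> carrier_vec m"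
  shows "v @\<^sub>v w = 0\<^sub>v (n + m) \<longleftrightarrow> v = 0\<^sub>v n \<and> w = (0\<^sub>v m :: 'a::zero vec)"
proof -
  have "0\<^sub>v (n + m) = 0\<^sub>v n @\<^sub>v (0\<^sub>v m :: 'a vec)" by auto
  then show ?thesis using assms append_vec_eq[of v n "0\<^sub>v n" w "0\<^sub>v m"] by simp
qed

lemma wide_mat_kernel:
  fixes A :: "'a::field mat"
  assumes A: "A \<in> carrier_mat r c" and "r < c"
  shows "\<exists>v \<in> carrier_vec c. v \<noteq> 0\<^sub>v c \<and> A *\<^sub>v v = 0\<^sub>v r"
proof -
  \<comment> \<open>Padding with zero rows makes the matrix square; the last rows witness that it is singular.\<close>
  define A' where "A' = mat c c (\<lambda>(i, j). if i < r then A $$ (i, j) else 0)"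
  have A': "A' \<in> carrier_mat c c" unfolding A'_def by simp
  have "A'\<^sup>T *\<^sub>v unit_vec c r = 0\<^sub>v c"
    using \<open>r < c\<close> by (intro eq_vecI) (auto simp: A'_def)
  then have "det A'\<^sup>T = 0"
    using det_0_iff_vec_prod_zero_field[of "A'\<^sup>T" c] A' \<open>r < c\<close> by force
  then have "det A' = 0" using det_transpose[OF A'] by simp
  then obtain v where v: "v \<in> carrier_vec c" "v \<noteq> 0\<^sub>v c" "A' *\<^sub>v v = 0\<^sub>v c"
    using det_0_iff_vec_prod_zero_field[OF A'] by blast
  have "A *\<^sub>v v = 0\<^sub>v r"
  proof (rule eq_vecI)
    fix i assume "i < dim_vec (0\<^sub>v r :: 'a vec)"
    then have i: "i < r" by simp
    have "row A i = row A' i"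
      using i A \<open>r < c\<close> by (intro eq_vecI) (auto simp: A'_def)
    moreover have "(A' *\<^sub>v v) $ i = 0" using v(3) i \<open>r < c\<close> by simp
    ultimately show "(A *\<^sub>v v) $ i = 0\<^sub>v r $ i"
      using i A A' \<open>r < c\<close> by simp
  qed (use A in auto)
  with v show ?thesis by blast
qed

lemma mult_mat_vec_0 [simp]: "A \<in> carrier_mat r c \<Longrightarrow> A *\<^sub>v 0\<^sub>v c = (0\<^sub>v r :: 'a::comm_ring_1 vec)"
  by (intro eq_vecI) auto

lemma injective_matD:
  assumes "injective_mat A" "A \<in> carrier_mat r c" "v \<in> carrier_vec c" "A *\<^sub>v v = 0\<^sub>v r"
  shows "v = 0\<^sub>v c"
proof -
  obtain B where B: "B \<in> carrier_mat c r" "B * A = 1\<^sub>m c"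
    using assms unfolding injective_mat_def by auto
  have "v = (B * A) *\<^sub>v v" using B assms by simp
  also have "\<dots> = B *\<^sub>v (A *\<^sub>v v)" using B assms by (intro assoc_mult_mat_vec) auto
  finally show ?thesis using assms B by simp
qed

lemma surjective_mat_transpose:
  "A \<in> carrier_mat r c \<Longrightarrow> surjective_mat A \<longleftrightarrow> injective_mat A\<^sup>T"
proof
  assume A: "A \<in> carrier_mat r c" and "surjective_mat A"
  then obtain B where B: "B \<in> carrier_mat c r" "A * B = 1\<^sub>m r"
    unfolding surjective_mat_def by auto
  then have "B\<^sup>T * A\<^sup>T = 1\<^sub>m r" using transpose_mult[OF A B(1)] by simp
  with A B show "injective_mat A\<^sup>T"
    unfolding injective_mat_def by (intro bexI[of _ "B\<^sup>T"]) auto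
next
  assume A: "A \<in> carrier_mat r c" and "injective_mat A\<^sup>T"
  then obtain B where B: "B \<in> carrier_mat r c" "B * A\<^sup>T = 1\<^sub>m r"
    unfolding injective_mat_def by auto
  then have "A * B\<^sup>T = 1\<^sub>m r" using transpose_mult[OF B(1), of "A\<^sup>T" r] A by simp
  with A B show "surjective_mat A"
    unfolding surjective_mat_def by (intro bexI[of _ "B\<^sup>T"]) auto
qed

lemma surjective_matD:
  assumes "surjective_mat A" "A \<in> carrier_mat r c" "v \<in> carrier_vec r" "A\<^sup>T *\<^sub>v v = 0\<^sub>v c"
  shows "v = 0\<^sub>v r"
  using assms surjective_mat_transpose[OF assms(2)] injective_matD[of "A\<^sup>T" c r v] by auto

text \<open>
  This lemma produces all nonvanishing determinants. While \<open>A\<close> has fewer columns than rows, some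
  functional kills its columns; it does not kill \<open>B\<close>, and a column of \<open>B\<close> on which it is nonzero can be appended to
  \<open>A\<close> without destroying injectivity.
\<close>

lemma extend_columns:
  fixes A B :: "'a::field mat"
  assumes "A \<in> carrier_mat r c" "B \<in> carrier_mat r q"
    and "\<And>v. v \<in> carrier_vec c \<Longrightarrow> A *\<^sub>v v = 0\<^sub>v r \<Longrightarrow> v = 0\<^sub>v c"
    and "\<And>\<phi>. \<phi> \<in> carrier_vec r \<Longrightarrow> A\<^sup>T *\<^sub>v \<phi> = 0\<^sub>v c \<Longrightarrow> B\<^sup>T *\<^sub>v \<phi> = 0\<^sub>v q \<Longrightarrow> \<phi> = 0\<^sub>v r"
  shows "c \<le> r \<and> (\<exists>R \<in> carrier_mat q (r - c). det (hconcat A (B * R)) \<noteq> 0)"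
  using assms
proof (induction "r - c" arbitrary: A c)
  case 0
  note A = 0(2) and B = 0(3) and inj = 0(4)
  have "\<not> r < c" using wide_mat_kernel[OF A] inj by blast
  then have rc: "c = r" using 0(1) by simp
  have "hconcat A (B * 0\<^sub>m q 0) = A"
  proof (rule eq_matI)
    have B0: "B * 0\<^sub>m q 0 \<in> carrier_mat r 0" using B by auto
    show "dim_row (hconcat A (B * 0\<^sub>m q 0)) = dim_row A"
      "dim_col (hconcat A (B * 0\<^sub>m q 0)) = dim_col A"
      using hconcat_carrier[OF A B0] A by auto
    show "hconcat A (B * 0\<^sub>m q 0) $$ (i, j) = A $$ (i, j)"
      if "i < dim_row A" "j < dim_col A" for i j
      using that A by (subst hconcat_index[OF A B0]) auto
  qed
  moreover have "det A \<noteq> 0"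
    using det_0_iff_vec_prod_zero_field[of A r] A inj rc by blast
  ultimately show ?case using rc by (intro conjI bexI[of _ "0\<^sub>m q 0"]) auto
next
  case (Suc k)
  note A = Suc(3) and B = Suc(4) and inj = Suc(5) and surj = Suc(6)
  have "c < r" using Suc(2) by simp
  obtain \<phi> where \<phi>: "\<phi> \<in> carrier_vec r" "\<phi> \<noteq> 0\<^sub>v r" "A\<^sup>T *\<^sub>v \<phi> = 0\<^sub>v c"
    using wide_mat_kernel[of "A\<^sup>T" c r] A \<open>c < r\<close> by auto
  then have "B\<^sup>T *\<^sub>v \<phi> \<noteq> 0\<^sub>v q" using surj by blast
  then obtain j where j: "j < q" "(B\<^sup>T *\<^sub>v \<phi>) $ j \<noteq> 0"
    using B by (auto simp: vec_eq_iff)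
  define E where "E = mat q 1 (\<lambda>(i, _). if i = j then 1 else (0::'a))"
  have E: "E \<in> carrier_mat q 1" unfolding E_def by simp
  have BE: "B * E \<in> carrier_mat r 1" using B E by simp
  define A' where "A' = hconcat A (B * E)"
  have A': "A' \<in> carrier_mat r (c + 1)" using hconcat_carrier[OF A BE] unfolding A'_def .
  have BEcol: "\<phi> \<bullet> col (B * E) 0 \<noteq> 0"
  proof -
    have "col (B * E) 0 = col B j"
    proof (rule eq_vecI)
      fix i assume "i < dim_vec (col B j)"
      then have i: "i < r" using B by simp
      have "col E 0 = unit_vec q j" unfolding E_def using j by (intro eq_vecI) auto
      then show "col (B * E) 0 $ i = col B j $ i"
        using i B E j by simp
    qed (use B in auto)
    moreover have "col B j \<bullet> \<phi> \<noteq> 0" using j B by simp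
    ultimately show ?thesis
      using \<phi>(1) B by (subst comm_scalar_prod[of _ r]) auto
  qed
  have inj': "v = 0\<^sub>v (c + 1)" if v: "v \<in> carrier_vec (c + 1)" and Av: "A' *\<^sub>v v = 0\<^sub>v r" for v
  proof -
    define v1 v2 where "v1 = vec_first v c" and "v2 = vec_last v 1"
    have v12: "v = v1 @\<^sub>v v2" "v1 \<in> carrier_vec c" "v2 \<in> carrier_vec 1"
      using v vec_first_last_append[of v c 1] unfolding v1_def v2_def by auto
    have eq: "A *\<^sub>v v1 + (B * E) *\<^sub>v v2 = 0\<^sub>v r"
      using Av hconcat_mult_vec[OF A BE v12(2,3)] v12(1) unfolding A'_def by simp
    have "\<phi> \<bullet> (A *\<^sub>v v1) = (A\<^sup>T *\<^sub>v \<phi>) \<bullet> v1"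
      using transpose_vec_mult_scalar[OF A v12(2) \<phi>(1)] by simp
    then have z1: "\<phi> \<bullet> (A *\<^sub>v v1) = 0" using \<phi>(3) v12 by simp
    have BEv: "(B * E) *\<^sub>v v2 = (v2 $ 0) \<cdot>\<^sub>v col (B * E) 0"
      using v12 BE by (intro eq_vecI) (auto simp: scalar_prod_def)
    have cBE: "col (B * E) 0 \<in> carrier_vec r" using BE by (intro carrier_vecI) auto
    have "0 = \<phi> \<bullet> (A *\<^sub>v v1 + (B * E) *\<^sub>v v2)" using eq \<phi>(1) by simp
    also have "\<dots> = \<phi> \<bullet> (A *\<^sub>v v1) + \<phi> \<bullet> ((B * E) *\<^sub>v v2)"
      using A BE \<phi>(1) v12 by (intro scalar_prod_add_distrib[of _ r]) auto
    also have "\<dots> = v2 $ 0 * (\<phi> \<bullet> col (B * E) 0)"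
      unfolding BEv using z1 scalar_prod_smult_distrib[OF \<phi>(1) cBE, of "v2 $ 0"] by simp
    finally have "v2 $ 0 = 0" using BEcol by simp
    then have v2: "v2 = 0\<^sub>v 1" using v12 by (intro eq_vecI) auto
    then have "(B * E) *\<^sub>v v2 = 0\<^sub>v r" using BE by simp
    then have "A *\<^sub>v v1 = 0\<^sub>v r" using eq A v12 by simp
    then have "v1 = 0\<^sub>v c" using inj v12 by blast
    then show ?thesis using v12 v2 by auto
  qed
  have surj': "\<psi> = 0\<^sub>v r" if "\<psi> \<in> carrier_vec r" "A'\<^sup>T *\<^sub>v \<psi> = 0\<^sub>v (c + 1)" "B\<^sup>T *\<^sub>v \<psi> = 0\<^sub>v q" for \<psi>
  proof -
    have "A\<^sup>T *\<^sub>v \<psi> \<in> carrier_vec c" "(B * E)\<^sup>T *\<^sub>v \<psi> \<in> carrier_vec 1"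
      using A BE that(1) by (metis mult_mat_vec_carrier transpose_carrier_mat)+
    then have "A\<^sup>T *\<^sub>v \<psi> = 0\<^sub>v c"
      using that(2) transpose_hconcat_mult_vec[OF A BE that(1)] append_vec_eq_0
      unfolding A'_def by metis
    with surj that show ?thesis by blast
  qed
  have "k = r - (c + 1)" using Suc(2) by simp
  from Suc(1)[OF this A' B inj' surj'] obtain R where
    R: "c + 1 \<le> r" "R \<in> carrier_mat q (r - (c + 1))" "det (hconcat A' (B * R)) \<noteq> 0" by blast
  have ER: "hconcat E R \<in> carrier_mat q (r - c)"
  proof -
    have "1 + (r - (c + 1)) = r - c" using R(1) by simp
    then show ?thesis using hconcat_carrier[OF E R(2)] by metis
  qed
  have BR: "B * R \<in> carrier_mat r (r - (c + 1))" using B R by simp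
  have "hconcat A (B * hconcat E R) = hconcat A' (B * R)"
  proof -
    have BER: "B * hconcat E R = hconcat (B * E) (B * R)" by (rule mult_hconcat[OF B E R(2)])
    note c1 = hconcat_carrier[OF BE BR]
    show ?thesis unfolding BER A'_def
    proof (rule eq_matI)
      show "dim_row (hconcat A (hconcat (B * E) (B * R))) = dim_row (hconcat (hconcat A (B * E)) (B * R))"
       "dim_col (hconcat A (hconcat (B * E) (B * R))) = dim_col (hconcat (hconcat A (B * E)) (B * R))"
        using hconcat_carrier[OF A c1] hconcat_carrier[OF hconcat_carrier[OF A BE] BR] by auto
      fix i j
      assume "i < dim_row (hconcat (hconcat A (B * E)) (B * R))"
        "j < dim_col (hconcat (hconcat A (B * E)) (B * R))"
      then have ij: "i < r" "j < c + 1 + (r - (c + 1))"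
        using hconcat_carrier[OF hconcat_carrier[OF A BE] BR] by auto
      show "hconcat A (hconcat (B * E) (B * R)) $$ (i, j) =
          hconcat (hconcat A (B * E)) (B * R) $$ (i, j)"
        using ij hconcat_index[OF A c1, of i j] hconcat_index[OF BE BR, of i "j - c"]
          hconcat_index[OF hconcat_carrier[OF A BE] BR, of i j] hconcat_index[OF A BE, of i j]
        by (auto simp del: index_mult_mat)
    qed
  qed
  with R ER show ?case by (intro conjI bexI[of _ "hconcat E R"]) auto
qed

lemma invertible_mat_inverse:
  fixes G :: "'a::field mat"
  assumes "G \<in> carrier_mat n n" "det G \<noteq> 0"
  obtains H where "H \<in> carrier_mat n n" "H * G = 1\<^sub>m n" "G * H = 1\<^sub>m n" "det H \<noteq> 0"
proof -
  have "G \<in> Units (ring_mat TYPE('a) n ())" by (rule det_non_zero_imp_unit[OF assms])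
  then obtain H where "H \<in> carrier_mat n n" "H * G = 1\<^sub>m n" "G * H = 1\<^sub>m n"
    unfolding Units_def by (auto simp: ring_mat_def)
  moreover from this have "det H * det G = 1" using assms det_mult[of H n G] by simp
  ultimately show ?thesis using that by force
qed

lemma complete_columns:
  fixes A :: "'a::field mat"
  assumes A: "A \<in> carrier_mat r c"
    and inj: "\<And>v. v \<in> carrier_vec c \<Longrightarrow> A *\<^sub>v v = 0\<^sub>v r \<Longrightarrow> v = 0\<^sub>v c"
  obtains R where "c \<le> r" "R \<in> carrier_mat r (r - c)" "det (hconcat A R) \<noteq> 0"
proof -
  have "c \<le> r \<and> (\<exists>R \<in> carrier_mat r (r - c). det (hconcat A (1\<^sub>m r * R)) \<noteq> 0)"
    by (intro extend_columns) (use assms in auto)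
  then show ?thesis using that by auto
qed

lemma injective_mat_iff_kernel:
  assumes A: "A \<in> carrier_mat r c"
  shows "injective_mat A \<longleftrightarrow> (\<forall>v \<in> carrier_vec c. A *\<^sub>v v = 0\<^sub>v r \<longrightarrow> v = 0\<^sub>v c)"
proof
  assume "\<forall>v \<in> carrier_vec c. A *\<^sub>v v = 0\<^sub>v r \<longrightarrow> v = 0\<^sub>v c"
  then obtain R where R: "c \<le> r" "R \<in> carrier_mat r (r - c)" "det (hconcat A R) \<noteq> 0"
    using complete_columns[OF A] by blast
  note AR = hconcat_carrier[OF A R(2)]
  obtain H where H: "H \<in> carrier_mat r r" "H * hconcat A R = 1\<^sub>m r"
    using invertible_mat_inverse[of "hconcat A R" r] R AR by auto
  define B where "B = mat c r (\<lambda>(i, j). H $$ (i, j))"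
  have B: "B \<in> carrier_mat c r" unfolding B_def by simp
  have "B * A = 1\<^sub>m c"
  proof (rule eq_matI)
    fix i j assume "i < dim_row (1\<^sub>m c :: 'a mat)" "j < dim_col (1\<^sub>m c :: 'a mat)"
    then have ij: "i < c" "j < c" by auto
    have "row B i = row H i" using ij H R(1) by (intro eq_vecI) (auto simp: B_def)
    moreover have "col A j = col (hconcat A R) j"
      using ij A AR by (intro eq_vecI) (auto simp: hconcat_index[OF A R(2)])
    moreover have "(H * hconcat A R) $$ (i, j) = 1\<^sub>m c $$ (i, j)"
      using H(2) ij R(1) by auto
    ultimately show "(B * A) $$ (i, j) = 1\<^sub>m c $$ (i, j)"
      using ij A B H(1) AR R(1) by (auto simp del: index_one_mat)
  qed (use A B in auto)
  with A B show "injective_mat A" unfolding injective_mat_def by auto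
qed (use injective_matD[OF _ A] in blast)

lemma injective_mat_dim:
  "injective_mat A \<Longrightarrow> A \<in> carrier_mat r c \<Longrightarrow> c \<le> r"
  using complete_columns[of A r c] injective_matD[of A r c] by blast

lemma surjective_mat_iff_cokernel:
  assumes A: "A \<in> carrier_mat r c"
  shows "surjective_mat A \<longleftrightarrow> (\<forall>v \<in> carrier_vec r. A\<^sup>T *\<^sub>v v = 0\<^sub>v c \<longrightarrow> v = 0\<^sub>v r)"
  using surjective_mat_transpose[OF A] injective_mat_iff_kernel[of "A\<^sup>T" c r] A by simp

lemma rank_eq_cols_iff_injective:
  fixes A :: "'a::field mat"
  assumes A: "A \<in> carrier_mat r c"
  shows "vec_space.rank r A = c \<longleftrightarrow> injective_mat A"
proof -
  interpret vec_space "TYPE('a)" r .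
  show ?thesis
  proof
    assume rk: "rank A = c"
    have dist: "distinct (cols A)"
    proof (rule ccontr)
      assume nd: "\<not> distinct (cols A)"
      obtain S where S: "maximal S (\<lambda>T. T \<subseteq> set (cols A) \<and> lin_indpt T)"
        using maximal_exists_superset[of "set (cols A)" "\<lambda>T. T \<subseteq> set (cols A) \<and> lin_indpt T" "{}"]
        by (auto simp: lin_dep_def)
      then have "S \<subseteq> set (cols A)" by (simp add: maximal_def)
      then have "card S \<le> card (set (cols A))" by (simp add: card_mono)
      moreover have "card (set (cols A)) < length (cols A)"
        using nd card_distinct card_length le_neq_implies_less by blast
      ultimately show False using rank_card_indpt[OF A S] rk A by simp
    qed
    have "lin_indpt (set (cols A))" by (rule full_rank_lin_indpt[OF A rk dist])
    then show "injective_mat A"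
      using lin_depI[OF A _ _ _ dist] injective_mat_iff_kernel[OF A] by blast
  next
    assume inj: "injective_mat A"
    have "distinct (cols A)"
      unfolding distinct_conv_nth
    proof (intro allI impI notI)
      fix i j assume ij: "i < length (cols A)" "j < length (cols A)" "i \<noteq> j" "cols A ! i = cols A ! j"
      define v where "v = unit_vec c i - (unit_vec c j :: 'a vec)"
      have "A *\<^sub>v v = A *\<^sub>v unit_vec c i - A *\<^sub>v unit_vec c j"
        unfolding v_def using A by (intro mult_minus_distrib_mat_vec) auto
      also have "\<dots> = col A i - col A j"
      proof -
        have "A *\<^sub>v unit_vec c k = col A k" if "k < c" for k
          using that A by (intro eq_vecI) auto
        then show ?thesis using ij A by simp
      qed
      also have "\<dots> = 0\<^sub>v r"
        using ij A by (metis carrier_matD(1) carrier_matD(2) cols_length cols_nth col_dim minus_cancel_vec)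
      finally have "v = 0\<^sub>v c" using injective_matD[OF inj A] unfolding v_def by auto
      then have "v $ i = 0" using ij A by simp
      then show False using ij A unfolding v_def by simp
    qed
    then show "rank A = c"
      using lin_indpt_full_rank[OF A] lin_depE[OF A] injective_mat_iff_kernel[OF A] inj by metis
  qed
qed

text \<open>
  Full rank gives an invertible submatrix, so no functional kills all columns; conversely, a right
  inverse shows that the columns span the whole space.
\<close>

lemma rank_eq_rows_iff_surjective:
  fixes A :: "'a::field mat"
  assumes A: "A \<in> carrier_mat r c"
  shows "vec_space.rank r A = r \<longleftrightarrow> surjective_mat A"
proof -
  interpret vec_space "TYPE('a)" r .
  have colsA: "set (cols A) \<subseteq> carrier_vec r" using A cols_dim by blast
  obtain S where "finite S" and S: "maximal S (\<lambda>T. T \<subseteq> set (cols A) \<and> lin_indpt T)"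
    using maximal_exists_superset[of "set (cols A)" "\<lambda>T. T \<subseteq> set (cols A) \<and> lin_indpt T" "{}"]
    by (auto simp: lin_dep_def)
  from S have S2: "S \<subseteq> set (cols A)" "lin_indpt S" by (auto simp: maximal_def)
  have rkS: "rank A = card S" by (rule rank_card_indpt[OF A S])
  show ?thesis
  proof
    assume rk: "rank A = r"
    obtain ws where ws: "set ws = S" "distinct ws" "length ws = r"
      using finite_distinct_list[OF \<open>finite S\<close>] rkS rk distinct_card by metis
    define B where "B = mat_of_cols r ws"
    have B: "B \<in> carrier_mat r r" using ws unfolding B_def by auto
    have colsB: "cols B = ws" unfolding B_def using ws S2 colsA by auto
    have "\<And>v. v \<in> carrier_vec r \<Longrightarrow> v \<noteq> 0\<^sub>v r \<Longrightarrow> B *\<^sub>v v \<noteq> 0\<^sub>v r"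
      using lin_depI[OF B] colsB ws S2(2) by auto
    then have "det B \<noteq> 0" using det_0_iff_vec_prod_zero_field[OF B] by auto
    then have detBT: "det B\<^sup>T \<noteq> 0" using det_transpose[OF B] by simp
    have "\<phi> = 0\<^sub>v r" if \<phi>: "\<phi> \<in> carrier_vec r" "A\<^sup>T *\<^sub>v \<phi> = 0\<^sub>v c" for \<phi>
    proof -
      have "B\<^sup>T *\<^sub>v \<phi> = 0\<^sub>v r"
      proof (rule eq_vecI)
        fix i assume "i < dim_vec (0\<^sub>v r :: 'a vec)"
        then have i: "i < r" by simp
        then have "col B i \<in> set (cols A)" using ws S2 colsB B
          by (metis carrier_matD(2) cols_length cols_nth nth_mem subsetD)
        then obtain k where k: "k < c" "col B i = col A k"
          using A by (metis carrier_matD(2) cols_length cols_nth in_set_conv_nth)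
        have "(A\<^sup>T *\<^sub>v \<phi>) $ k = 0" using \<phi>(2) k by simp
        then show "(B\<^sup>T *\<^sub>v \<phi>) $ i = 0\<^sub>v r $ i" using k i A B by simp
      qed (use B in auto)
      then show ?thesis
        using det_0_iff_vec_prod_zero_field[of "B\<^sup>T" r] detBT B \<phi> by auto
    qed
    then show "surjective_mat A" using surjective_mat_iff_cokernel[OF A] by blast
  next
    assume surj: "surjective_mat A"
    have "carrier_vec r \<subseteq> span (set (cols A))"
    proof
      fix v :: "'a vec" assume v: "v \<in> carrier_vec r"
      obtain B where B: "B \<in> carrier_mat c r" "A * B = 1\<^sub>m r"
        using surj A unfolding surjective_mat_def by auto
      have "A *\<^sub>v (B *\<^sub>v v) = v" using assoc_mult_mat_vec[OF A B(1) v] B(2) v by simp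
      moreover have "B *\<^sub>v v \<in> carrier_vec c" using B v by auto
      ultimately show "v \<in> span (set (cols A))"
        using col_space_eq[OF A] A v unfolding col_space_def by auto
    qed
    then have "span (set (cols A)) = carrier V"
      using span_closed[OF colsA] by auto
    then have "span_vs (set (cols A)) = V" by simp
    then show "rank A = r" unfolding rank_def using dim_is_n by simp
  qed
qed

lemma surjective_mat_dim:
  "surjective_mat A \<Longrightarrow> A \<in> carrier_mat r c \<Longrightarrow> r \<le> c"
  using injective_mat_dim[of "A\<^sup>T" c r] surjective_mat_transpose[of A r c] by simp

lemma injective_mat_cancel:
  assumes "injective_mat A" "A \<in> carrier_mat r c" "X \<in> carrier_mat c k" "Y \<in> carrier_mat c k"
    and eq: "A * X = A * Y"
  shows "X = Y"
proof -
  obtain B where B: "B \<in> carrier_mat c r" "B * A = 1\<^sub>m c"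
    using assms unfolding injective_mat_def by auto
  have "X = (B * A) * X" using B assms by simp
  also have "\<dots> = B * (A * X)" by (rule assoc_mult_mat[OF B(1) assms(2,3)])
  also have "\<dots> = (B * A) * Y" unfolding eq by (rule assoc_mult_mat[OF B(1) assms(2,4), symmetric])
  finally show ?thesis unfolding B(2) using assms(4) by simp
qed

text \<open>
  Factorization through the image. As long as \<open>A\<close> has a kernel vector, completing it to a basis and
  dropping it from that basis removes one column.
\<close>

lemma rank_factorization:
  fixes A :: "'a::field mat"
  assumes "A \<in> carrier_mat r d"
  obtains c C Y where "C \<in> carrier_mat r c" "injective_mat C" "Y \<in> carrier_mat c d"
    "surjective_mat Y" "A = C * Y" "c < d \<or> injective_mat A"
proof -
  have "\<exists>c C Y. C \<in> carrier_mat r c \<and> injective_mat C \<and> Y \<in> carrier_mat c d \<and>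
      surjective_mat Y \<and> A = C * Y \<and> (c < d \<or> injective_mat A)"
    using assms
  proof (induction d arbitrary: A)
    case 0
    then have "injective_mat A" using injective_mat_iff_kernel[of A r 0] by auto
    moreover have "surjective_mat (1\<^sub>m 0 :: 'a mat)"
      unfolding surjective_mat_def by auto
    ultimately show ?case using 0 by (intro exI[of _ 0] exI[of _ A] exI[of _ "1\<^sub>m 0"]) auto
  next
    case (Suc d)
    note A = Suc.prems
    show ?case
    proof (cases "injective_mat A")
      case True
      moreover have "surjective_mat (1\<^sub>m (Suc d) :: 'a mat)"
        unfolding surjective_mat_def by (intro bexI[of _ "1\<^sub>m (Suc d)"]) auto
      ultimately show ?thesis using A
        by (intro exI[of _ "Suc d"] exI[of _ A] exI[of _ "1\<^sub>m (Suc d)"]) auto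
    next
      case False
      then obtain w where w: "w \<in> carrier_vec (Suc d)" "w \<noteq> 0\<^sub>v (Suc d)" "A *\<^sub>v w = 0\<^sub>v r"
        using injective_mat_iff_kernel[OF A] by blast
      define W where "W = mat (Suc d) 1 (\<lambda>(i, _). w $ i)"
      have W: "W \<in> carrier_mat (Suc d) 1" unfolding W_def by simp
      have Winj: "v = 0\<^sub>v 1" if v: "v \<in> carrier_vec 1" "W *\<^sub>v v = 0\<^sub>v (Suc d)" for v
      proof -
        obtain i where i: "i < Suc d" "w $ i \<noteq> 0" using w by (auto simp: vec_eq_iff)
        have "(W *\<^sub>v v) $ i = 0" unfolding v(2) using i by simp
        then have "w $ i * v $ 0 = 0"
          using i v W by (simp add: scalar_prod_def W_def)
        then have "v $ 0 = 0" using i by simp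
        then show ?thesis using v by (intro eq_vecI) auto
      qed
      obtain R where R: "R \<in> carrier_mat (Suc d) d" "det (hconcat W R) \<noteq> 0"
        using complete_columns[OF W Winj] by auto
      define G where "G = hconcat W R"
      have G: "G \<in> carrier_mat (Suc d) (Suc d)" using hconcat_carrier[OF W R(1)] G_def by simp
      obtain H where H: "H \<in> carrier_mat (Suc d) (Suc d)" "H * G = 1\<^sub>m (Suc d)" "G * H = 1\<^sub>m (Suc d)"
        using invertible_mat_inverse[OF G] R(2) G_def by metis
      \<comment> \<open>\<open>X\<close> expresses vectors in the basis \<open>w, R\<close> and forgets the coordinate of \<open>w\<close>.\<close>
      define X where "X = mat d (Suc d) (\<lambda>(k, l). H $$ (Suc k, l))"
      have X: "X \<in> carrier_mat d (Suc d)" unfolding X_def by simp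
      have XR: "X * R = 1\<^sub>m d"
      proof (rule eq_matI)
        fix i j assume "i < dim_row (1\<^sub>m d :: 'a mat)" "j < dim_col (1\<^sub>m d :: 'a mat)"
        then have ij: "i < d" "j < d" by auto
        have "row X i = row H (Suc i)" using ij H by (intro eq_vecI) (auto simp: X_def)
        moreover have "col R j = col G (Suc j)"
          using ij R W unfolding G_def by (intro eq_vecI) (auto simp: hconcat_index[OF W R(1)])
        moreover have "(H * G) $$ (Suc i, Suc j) = 1\<^sub>m (Suc d) $$ (Suc i, Suc j)" using H by simp
        ultimately show "(X * R) $$ (i, j) = 1\<^sub>m d $$ (i, j)"
          using ij X R H(1) G by simp
      qed (use X R in auto)
      have ARX: "(A * R) * X = A"
      proof (rule eq_matI)
        fix i l assume "i < dim_row A" "l < dim_col A"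
        then have il: "i < r" "l < Suc d" using A X by auto
        have "col (R * X) l = unit_vec (Suc d) l - H $$ (0, l) \<cdot>\<^sub>v w"
        proof (rule eq_vecI)
          fix k assume "k < dim_vec (unit_vec (Suc d) l - H $$ (0, l) \<cdot>\<^sub>v w)"
          then have k: "k < Suc d" using w by simp
          have W0: "W $$ (k, 0) = w $ k" if "k < Suc d" for k using that unfolding W_def by simp
          have "(G * H) $$ (k, l) = (\<Sum>j<Suc d. G $$ (k, j) * H $$ (j, l))"
            using G H(1) k il by (simp add: scalar_prod_def atLeast0LessThan)
          also have "\<dots> = w $ k * H $$ (0, l) + (\<Sum>j<d. R $$ (k, j) * X $$ (j, l))"
            unfolding sum.lessThan_Suc_shift using k il W0[OF k]
            by (auto simp: G_def hconcat_index[OF W R(1)] X_def intro!: sum.cong)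
          also have "(\<Sum>j<d. R $$ (k, j) * X $$ (j, l)) = (R * X) $$ (k, l)"
            using R X k il by (simp add: scalar_prod_def atLeast0LessThan)
          finally have "(R * X) $$ (k, l) = 1\<^sub>m (Suc d) $$ (k, l) - w $ k * H $$ (0, l)"
            unfolding H(3) by simp
          then show "col (R * X) l $ k = (unit_vec (Suc d) l - H $$ (0, l) \<cdot>\<^sub>v w) $ k"
            using k il w R X by (simp add: mult.commute[of "w $ k"])
        qed (use w R in auto)
        then have "col (A * (R * X)) l = A *\<^sub>v (unit_vec (Suc d) l - H $$ (0, l) \<cdot>\<^sub>v w)"
          using A R X il by (subst col_mult2[of A r "Suc d" _ "Suc d"]) auto
        also have "\<dots> = A *\<^sub>v unit_vec (Suc d) l - A *\<^sub>v (H $$ (0, l) \<cdot>\<^sub>v w)"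
          using A w by (intro mult_minus_distrib_mat_vec) auto
        also have "A *\<^sub>v (H $$ (0, l) \<cdot>\<^sub>v w) = 0\<^sub>v r"
          using A w by (intro eq_vecI) (simp_all add: mult_mat_vec)
        also have "A *\<^sub>v unit_vec (Suc d) l - 0\<^sub>v r = col A l"
          using A il by (intro eq_vecI) auto
        finally have "col (A * (R * X)) l $ i = col A l $ i" by simp
        moreover have "col B l $ i = B $$ (i, l)" if "B \<in> carrier_mat r (Suc d)" for B :: "'a mat"
          using that il by simp
        moreover have "A * (R * X) \<in> carrier_mat r (Suc d)" using A R X by simp
        ultimately have "(A * (R * X)) $$ (i, l) = A $$ (i, l)" using A by metis
        then show "(A * R * X) $$ (i, l) = A $$ (i, l)"
          unfolding assoc_mult_mat[OF A R(1) X] .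
      qed (use A X in auto)
      have AR: "A * R \<in> carrier_mat r d" using A R by simp
      obtain c C Y where CY: "C \<in> carrier_mat r c" "injective_mat C" "Y \<in> carrier_mat c d"
        "surjective_mat Y" "A * R = C * Y" "c < d \<or> injective_mat (A * R)"
        using Suc.IH[OF AR] by blast
      have "c \<le> d" using surjective_mat_dim[OF CY(4,3)] .
      obtain Y' where Y': "Y' \<in> carrier_mat d c" "Y * Y' = 1\<^sub>m c"
        using CY unfolding surjective_mat_def by auto
      have "(Y * X) * (R * Y') = 1\<^sub>m c"
      proof -
        have "(Y * X) * (R * Y') = Y * (X * (R * Y'))"
          using CY X R Y' by (intro assoc_mult_mat) auto
        also have "X * (R * Y') = (X * R) * Y'"
          using X R Y' by (intro assoc_mult_mat[symmetric]) auto
        finally show ?thesis using XR Y' CY by simp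
      qed
      then have "surjective_mat (Y * X)"
        unfolding surjective_mat_def using CY X R Y' by (intro bexI[of _ "R * Y'"]) auto
      moreover have "A = C * (Y * X)"
        using ARX[symmetric] unfolding CY(5) assoc_mult_mat[OF CY(1,3) X] .
      moreover have "Y * X \<in> carrier_mat c (Suc d)" "c < Suc d" using CY X \<open>c \<le> d\<close> by auto
      ultimately show ?thesis using CY(1,2) by blast
    qed
  qed
  then show ?thesis using that by blast
qed

section \<open>Pencils of matrices\<close>

abbreviation pencil :: "'a::semiring_1 mat \<Rightarrow> 'a mat \<Rightarrow> 'a \<Rightarrow> 'a \<Rightarrow> 'a mat" where
  "pencil K L s t \<equiv> s \<cdot>\<^sub>m K + t \<cdot>\<^sub>m L"

lemma pencil_carrier:
  "K \<in> carrier_mat r c \<Longrightarrow> L \<in> carrier_mat r c \<Longrightarrow> pencil K L s t \<in> carrier_mat r c"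
  by auto

lemma pencil_mult_vec:
  fixes K :: "'a::comm_ring_1 mat"
  assumes "K \<in> carrier_mat r c" "L \<in> carrier_mat r c" "v \<in> carrier_vec c"
  shows "pencil K L s t *\<^sub>v v = s \<cdot>\<^sub>v (K *\<^sub>v v) + t \<cdot>\<^sub>v (L *\<^sub>v v)"
proof -
  have "(a \<cdot>\<^sub>m A) *\<^sub>v v = a \<cdot>\<^sub>v (A *\<^sub>v v)" if "A \<in> carrier_mat r c" for a A
    using that assms(3) by (intro eq_vecI) (auto simp: scalar_prod_def sum_distrib_left mult.assoc)
  with assms show ?thesis by (subst add_mult_distrib_mat_vec[of _ r c]) auto
qed

lemma pencil_transpose:
  assumes "K \<in> carrier_mat r c" "L \<in> carrier_mat r c"
  shows "(pencil K L s t)\<^sup>T = pencil K\<^sup>T L\<^sup>T s t"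
  using assms by (intro eq_matI) auto

text \<open>
  The only place, besides the polynomial argument for shift sequences, where algebraic closedness
  enters: if \<open>L\<close> is invertible, an eigenvalue of \<open>L\<^sup>-\<^sup>1 K\<close> gives the singular member.
\<close>

lemma square_pencil_singular:
  fixes K L :: "'a::alg_closed_field mat"
  assumes K: "K \<in> carrier_mat r r" and L: "L \<in> carrier_mat r r" and "r > 0"
  obtains s t v where "(s, t) \<noteq> (0, 0)" "v \<in> carrier_vec r" "v \<noteq> 0\<^sub>v r" "pencil K L s t *\<^sub>v v = 0\<^sub>v r"
proof (cases "det L = 0")
  case True
  then obtain v where v: "v \<in> carrier_vec r" "v \<noteq> 0\<^sub>v r" "L *\<^sub>v v = 0\<^sub>v r"
    using det_0_iff_vec_prod_zero_field[OF L] by blast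
  then have "pencil K L 0 1 *\<^sub>v v = 0\<^sub>v r"
    using K L by (subst pencil_mult_vec[of _ r r]) auto
  then show ?thesis using that[of 0 1 v] v by simp
next
  case False
  obtain G where G: "G \<in> carrier_mat r r" "G * L = 1\<^sub>m r" "L * G = 1\<^sub>m r"
    using invertible_mat_inverse[OF L False] by metis
  have GK: "G * K \<in> carrier_mat r r" using G K by simp
  have "degree (char_poly (G * K)) > 0"
    using degree_monic_char_poly[OF GK] \<open>r > 0\<close> by simp
  then obtain z where "poly (char_poly (G * K)) z = 0"
    using alg_closed_imp_poly_has_root by blast
  then have "eigenvalue (G * K) z" using eigenvalue_root_char_poly[OF GK] by simp
  then obtain v where v: "v \<in> carrier_vec r" "v \<noteq> 0\<^sub>v r" "(G * K) *\<^sub>v v = z \<cdot>\<^sub>v v"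
    unfolding eigenvalue_def eigenvector_def using GK by auto
  have "K *\<^sub>v v = (L * G) *\<^sub>v (K *\<^sub>v v)" using G K v by simp
  also have "\<dots> = L *\<^sub>v (G *\<^sub>v (K *\<^sub>v v))"
    using G K L v by (intro assoc_mult_mat_vec) auto
  also have "G *\<^sub>v (K *\<^sub>v v) = z \<cdot>\<^sub>v v" using assoc_mult_mat_vec[OF G(1) K v(1)] v(3) by simp
  finally have Kv: "K *\<^sub>v v = z \<cdot>\<^sub>v (L *\<^sub>v v)" using L v by (simp add: mult_mat_vec)
  have "pencil K L 1 (-z) *\<^sub>v v = 0\<^sub>v r"
    unfolding pencil_mult_vec[OF K L v(1)] Kv using L by (intro eq_vecI) auto
  then show ?thesis using that[of 1 "-z" v] v by simp
qed

lemma square_surjective_imp_injective: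
  assumes "A \<in> carrier_mat r r" "surjective_mat A"
  shows "injective_mat A"
proof -
  obtain B where "B \<in> carrier_mat r r" "A * B = 1\<^sub>m r"
    using assms unfolding surjective_mat_def by auto
  with mat_mult_left_right_inverse[OF assms(1)] assms(1) show ?thesis
    unfolding injective_mat_def by (intro bexI[of _ B]) auto
qed

text \<open>
  A pencil that is injective somewhere and surjective everywhere is square, and then it has a singular
  member unless it is empty.
\<close>

lemma everywhere_surjective_pencil_trivial:
  fixes K L :: "'a::alg_closed_field mat"
  assumes K: "K \<in> carrier_mat r c" and L: "L \<in> carrier_mat r c"
    and inj: "injective_mat (pencil K L s0 t0)"
    and surj: "\<And>s t. (s, t) \<noteq> (0, 0) \<Longrightarrow> surjective_mat (pencil K L s t)"
  shows "r = 0 \<and> c = 0"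
proof -
  have "c \<le> r" using injective_mat_dim[OF inj pencil_carrier[OF K L]] .
  moreover have "r \<le> c" using surjective_mat_dim[OF surj pencil_carrier[OF K L], of 1 0] by simp
  ultimately have rc: "r = c" by simp
  have "\<not> r > 0"
  proof
    assume "r > 0"
    with square_pencil_singular[of K r L] K L rc obtain s t v where st: "(s, t) \<noteq> (0, 0)"
      and v: "v \<in> carrier_vec r" "v \<noteq> 0\<^sub>v r" "pencil K L s t *\<^sub>v v = 0\<^sub>v r" by metis
    have P: "pencil K L s t \<in> carrier_mat r r" using pencil_carrier[OF K L] rc by simp
    from square_surjective_imp_injective[OF this surj[OF st]] injective_matD[OF _ P v(1,3)] v(2)
    show False by blast
  qed
  with rc show ?thesis by simp
qed

lemma everywhere_injective_pencil_trivial: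
  fixes K L :: "'a::alg_closed_field mat"
  assumes K: "K \<in> carrier_mat r c" and L: "L \<in> carrier_mat r c"
    and surj: "surjective_mat (pencil K L s0 t0)"
    and inj: "\<And>s t. (s, t) \<noteq> (0, 0) \<Longrightarrow> injective_mat (pencil K L s t)"
  shows "r = 0 \<and> c = 0"
proof -
  have "c = 0 \<and> r = 0"
  proof (rule everywhere_surjective_pencil_trivial[of "K\<^sup>T" c r "L\<^sup>T" s0 t0])
    show "injective_mat (pencil K\<^sup>T L\<^sup>T s0 t0)"
      using surj surjective_mat_transpose[OF pencil_carrier[OF K L]] pencil_transpose[OF K L] by metis
    show "surjective_mat (pencil K\<^sup>T L\<^sup>T s t)" if "(s, t) \<noteq> (0, 0)" for s t
    proof -
      have "(pencil K L s t)\<^sup>T \<in> carrier_mat c r" using pencil_carrier[OF K L] by simp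
      from surjective_mat_transpose[OF this] inj[OF that] show ?thesis
        unfolding pencil_transpose[OF K L, symmetric] by simp
    qed
  qed (use K L in auto)
  then show ?thesis by simp
qed

section \<open>Regular functions\<close>

text \<open>
  Formulas such as determinants of block matrices are regular only where the matrices have the right
  format, so regularity is stated relative to a set of points.
\<close>

definition regular_on :: "('x \<Rightarrow> 'k::comm_ring_1) set \<Rightarrow> 'x set \<Rightarrow> ('x \<Rightarrow> 'k) \<Rightarrow> bool" where
  "regular_on C X f \<longleftrightarrow> (\<exists>g \<in> regular_functions C. \<forall>x\<in>X. f x = g x)"

lemma regular_on_const: "regular_on C X (\<lambda>_. c)"
  unfolding regular_on_def by (rule bexI[of _ "\<lambda>_. c"]) (auto intro: regular_functions.const)

lemma regular_on_coord: "f \<in> C \<Longrightarrow> regular_on C X f"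
  unfolding regular_on_def using regular_functions.coord by blast

lemma regular_on_cong: "(\<And>x. x \<in> X \<Longrightarrow> f x = g x) \<Longrightarrow> regular_on C X f \<longleftrightarrow> regular_on C X g"
  unfolding regular_on_def by simp

lemma regular_on_add:
  assumes "regular_on C X f" "regular_on C X g"
  shows "regular_on C X (\<lambda>x. f x + g x)"
proof -
  obtain f' g' where "f' \<in> regular_functions C" "g' \<in> regular_functions C"
    "\<forall>x\<in>X. f x = f' x" "\<forall>x\<in>X. g x = g' x"
    using assms unfolding regular_on_def by blast
  then show ?thesis unfolding regular_on_def
    by (intro bexI[of _ "\<lambda>x. f' x + g' x"]) (auto intro: regular_functions.add)
qed

lemma regular_on_mult:
  assumes "regular_on C X f" "regular_on C X g"
  shows "regular_on C X (\<lambda>x. f x * g x)"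
proof -
  obtain f' g' where "f' \<in> regular_functions C" "g' \<in> regular_functions C"
    "\<forall>x\<in>X. f x = f' x" "\<forall>x\<in>X. g x = g' x"
    using assms unfolding regular_on_def by blast
  then show ?thesis unfolding regular_on_def
    by (intro bexI[of _ "\<lambda>x. f' x * g' x"]) (auto intro: regular_functions.mult)
qed

lemma regular_on_uminus: "regular_on C X f \<Longrightarrow> regular_on C X (\<lambda>x. - f x)"
  using regular_on_mult[OF regular_on_const, of C X f "-1"] by simp

lemma regular_on_power: "regular_on C X f \<Longrightarrow> regular_on C X (\<lambda>x. f x ^ k)"
  by (induction k) (auto intro: regular_on_const regular_on_mult)

lemma regular_on_sum:
  "(\<And>i. i \<in> I \<Longrightarrow> regular_on C X (f i)) \<Longrightarrow> regular_on C X (\<lambda>x. \<Sum>i\<in>I. f i x)"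
  by (induction I rule: infinite_finite_induct) (auto intro: regular_on_const regular_on_add)

lemma regular_on_prod:
  "(\<And>i. i \<in> I \<Longrightarrow> regular_on C X (f i)) \<Longrightarrow> regular_on C X (\<lambda>x. \<Prod>i\<in>I. f i x)"
  by (induction I rule: infinite_finite_induct) (auto intro: regular_on_const regular_on_mult)

definition regular_mat ::
    "('x \<Rightarrow> 'k::comm_ring_1) set \<Rightarrow> 'x set \<Rightarrow> nat \<Rightarrow> nat \<Rightarrow> ('x \<Rightarrow> 'k mat) \<Rightarrow> bool" where
  "regular_mat C X r c A \<longleftrightarrow> (\<forall>x\<in>X. A x \<in> carrier_mat r c) \<and>
    (\<forall>i<r. \<forall>j<c. regular_on C X (\<lambda>x. A x $$ (i, j)))"

lemma regular_mat_const: "B \<in> carrier_mat r c \<Longrightarrow> regular_mat C X r c (\<lambda>_. B)"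
  unfolding regular_mat_def by (auto intro: regular_on_const)

lemma regular_mat_mult:
  assumes A: "regular_mat C X r k A" and B: "regular_mat C X k c B"
  shows "regular_mat C X r c (\<lambda>x. A x * B x)"
  unfolding regular_mat_def
proof (intro conjI allI impI ballI)
  show "A x * B x \<in> carrier_mat r c" if "x \<in> X" for x
    using that A B unfolding regular_mat_def by auto
  fix i j assume ij: "i < r" "j < c"
  have "(A x * B x) $$ (i, j) = (\<Sum>l<k. A x $$ (i, l) * B x $$ (l, j))" if "x \<in> X" for x
    using that A B ij unfolding regular_mat_def by (intro mult_mat_entry) auto
  moreover have "regular_on C X (\<lambda>x. \<Sum>l<k. A x $$ (i, l) * B x $$ (l, j))"
    using A B ij unfolding regular_mat_def by (intro regular_on_sum regular_on_mult) auto
  ultimately show "regular_on C X (\<lambda>x. (A x * B x) $$ (i, j))"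
    by (simp cong: regular_on_cong)
qed

lemma regular_mat_add:
  assumes A: "regular_mat C X r c A" and B: "regular_mat C X r c B"
  shows "regular_mat C X r c (\<lambda>x. A x + B x)"
  unfolding regular_mat_def
proof (intro conjI allI impI ballI)
  show "A x + B x \<in> carrier_mat r c" if "x \<in> X" for x
    using that A B unfolding regular_mat_def by auto
  fix i j assume ij: "i < r" "j < c"
  have "(A x + B x) $$ (i, j) = A x $$ (i, j) + B x $$ (i, j)" if "x \<in> X" for x
  proof -
    have "A x \<in> carrier_mat r c" "B x \<in> carrier_mat r c"
      using that A B unfolding regular_mat_def by auto
    then show ?thesis using ij by simp
  qed
  moreover have "regular_on C X (\<lambda>x. A x $$ (i, j) + B x $$ (i, j))"
    using A B ij unfolding regular_mat_def by (auto intro: regular_on_add)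
  ultimately show "regular_on C X (\<lambda>x. (A x + B x) $$ (i, j))"
    by (simp cong: regular_on_cong)
qed

lemma regular_mat_hconcat:
  assumes A: "regular_mat C X r c A" and B: "regular_mat C X r d B"
  shows "regular_mat C X r (c + d) (\<lambda>x. hconcat (A x) (B x))"
  unfolding regular_mat_def
proof (intro conjI allI impI ballI)
  have c: "A x \<in> carrier_mat r c" "B x \<in> carrier_mat r d" if "x \<in> X" for x
    using that A B unfolding regular_mat_def by auto
  show "hconcat (A x) (B x) \<in> carrier_mat r (c + d)" if "x \<in> X" for x
    using c[OF that] by (rule hconcat_carrier)
  fix i j assume ij: "i < r" "j < c + d"
  have "hconcat (A x) (B x) $$ (i, j) = (if j < c then A x $$ (i, j) else B x $$ (i, j - c))"
    if "x \<in> X" for x using hconcat_index[OF c[OF that] ij] .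
  moreover have "regular_on C X (\<lambda>x. if j < c then A x $$ (i, j) else B x $$ (i, j - c))"
    using A B ij unfolding regular_mat_def by (cases "j < c") auto
  ultimately show "regular_on C X (\<lambda>x. hconcat (A x) (B x) $$ (i, j))"
    by (simp cong: regular_on_cong)
qed

lemma regular_on_det:
  assumes A: "regular_mat C X r r A"
  shows "regular_on C X (\<lambda>x. det (A x))"
proof -
  have "det (A x) = (\<Sum>p\<in>{p. p permutes {0..<r}}. signof p * (\<Prod>i = 0..<r. A x $$ (i, p i)))"
    if "x \<in> X" for x
    using that A unfolding regular_mat_def by (intro det_def') auto
  moreover have "regular_on C X
      (\<lambda>x. \<Sum>p\<in>{p. p permutes {0..<r}}. signof p * (\<Prod>i = 0..<r. A x $$ (i, p i)))"
  proof (intro regular_on_sum regular_on_mult regular_on_prod regular_on_const)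
    fix p i assume "p \<in> {p. p permutes {0..<r}}" "i \<in> {0..<r}"
    then have "i < r" "p i < r" using permutes_in_image[of p "{0..<r}" i] by auto
    then show "regular_on C X (\<lambda>x. A x $$ (i, p i))" using A unfolding regular_mat_def by blast
  qed
  ultimately show ?thesis by (simp cong: regular_on_cong)
qed

lemma regular_function_along_curve:
  fixes \<gamma> :: "'k::comm_ring_1 \<Rightarrow> 'x"
  assumes "f \<in> regular_functions C"
    and "\<And>g. g \<in> C \<Longrightarrow> \<exists>P. \<forall>t\<in>T. g (\<gamma> t) = poly P t"
  shows "\<exists>P. \<forall>t\<in>T. f (\<gamma> t) = poly P t"
  using assms(1)
proof induction
  case (const c)
  show ?case by (intro exI[of _ "[:c:]"]) simp
next
  case (coord f)
  then show ?case using assms(2) by blast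
next
  case (add f g)
  then obtain P Q where "\<forall>t\<in>T. f (\<gamma> t) = poly P t" "\<forall>t\<in>T. g (\<gamma> t) = poly Q t" by blast
  then show ?case by (intro exI[of _ "P + Q"]) simp
next
  case (mult f g)
  then obtain P Q where "\<forall>t\<in>T. f (\<gamma> t) = poly P t" "\<forall>t\<in>T. g (\<gamma> t) = poly Q t" by blast
  then show ?case by (intro exI[of _ "P * Q"]) simp
qed

text \<open>
  The polynomial \<open>X ^ e * P - c\<close> has infinitely many zeros, so it is zero, and its value at \<open>0\<close> is \<open>-c\<close>.
\<close>

lemma constant_divisible_by_power:
  fixes c :: "'k::field_char_0"
  assumes "\<And>t. t \<noteq> 0 \<Longrightarrow> t ^ e * poly P t = c" and "e > 0"
  shows "c = 0"
proof -
  define Q where "Q = monom 1 e * P - [:c:]"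
  have "poly Q t = 0" if "t \<noteq> 0" for t
    using assms(1)[OF that] unfolding Q_def by (simp add: poly_monom)
  then have "UNIV - {0} \<subseteq> {t. poly Q t = 0}" by blast
  moreover have "infinite (UNIV - {0 :: 'k})" using infinite_UNIV_char_0 by simp
  ultimately have "infinite {t. poly Q t = 0}" using finite_subset by blast
  then have "Q = 0" using poly_roots_finite by blast
  then have "poly Q 0 = 0" by simp
  then show ?thesis using \<open>e > 0\<close> unfolding Q_def by (simp add: poly_monom power_0_left)
qed

section \<open>Kronecker products\<close>

text \<open>
  A matrix with blocks \<open>A $$ (i, j) \<cdot> B\<close>; quotient and remainder of an index give the block and the
  position inside it.
\<close>

definition kron :: "'a::semiring_1 mat \<Rightarrow> 'a mat \<Rightarrow> 'a mat" where
  "kron A B = mat (dim_row A * dim_row B) (dim_col A * dim_col B)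
    (\<lambda>(i, j). A $$ (i div dim_row B, j div dim_col B) * B $$ (i mod dim_row B, j mod dim_col B))"

lemma kron_carrier:
  "A \<in> carrier_mat r c \<Longrightarrow> B \<in> carrier_mat r' c' \<Longrightarrow> kron A B \<in> carrier_mat (r * r') (c * c')"
  unfolding kron_def by auto

lemma kron_index:
  "A \<in> carrier_mat r c \<Longrightarrow> B \<in> carrier_mat r' c' \<Longrightarrow> i < r * r' \<Longrightarrow> j < c * c' \<Longrightarrow>
    kron A B $$ (i, j) = A $$ (i div r', j div c') * B $$ (i mod r', j mod c')"
  unfolding kron_def by auto

lemma div_mod_less: "i < a * (b::nat) \<Longrightarrow> i div b < a \<and> i mod b < b"
  by (metis less_mult_imp_div_less mod_less_divisor mult_is_0 not_gr_zero not_less0)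

lemma sum_div_mod:
  fixes a b :: nat
  shows "(\<Sum>k<a * b. h (k div b) (k mod b)) = (\<Sum>i<a. \<Sum>j<b. h i j)"
proof -
  have "(\<Sum>k<a * b. h (k div b) (k mod b)) =
      (\<Sum>i<a. \<Sum>k\<in>{i * b..<i * b + b}. h (k div b) (k mod b))"
    by (rule sum.nat_group[symmetric])
  also have "\<dots> = (\<Sum>i<a. \<Sum>j<b. h i j)"
  proof (rule sum.cong[OF refl])
    fix i
    have "(\<Sum>k\<in>{i * b..<i * b + b}. h (k div b) (k mod b)) =
        (\<Sum>j\<in>{0..<b}. h ((j + i * b) div b) ((j + i * b) mod b))"
      using sum.shift_bounds_nat_ivl[of "\<lambda>k. h (k div b) (k mod b)" 0 "i * b" b]
      by (simp add: add.commute)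
    also have "\<dots> = (\<Sum>j<b. h i j)"
      by (auto simp: atLeast0LessThan intro!: sum.cong)
    finally show "(\<Sum>k\<in>{i * b..<i * b + b}. h (k div b) (k mod b)) = (\<Sum>j<b. h i j)" .
  qed
  finally show ?thesis .
qed

lemma kron_mult:
  fixes A :: "'a::comm_ring_1 mat"
  assumes A: "A \<in> carrier_mat r k" and B: "B \<in> carrier_mat r' k'"
    and C: "C \<in> carrier_mat k c" and D: "D \<in> carrier_mat k' c'"
  shows "kron A B * kron C D = kron (A * C) (B * D)"
proof (rule eq_matI)
  note AB = kron_carrier[OF A B] and CD = kron_carrier[OF C D]
  have AC: "A * C \<in> carrier_mat r c" and BD: "B * D \<in> carrier_mat r' c'" using A B C D by auto
  note ACBD = kron_carrier[OF AC BD]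
  show "dim_row (kron A B * kron C D) = dim_row (kron (A * C) (B * D))"
    "dim_col (kron A B * kron C D) = dim_col (kron (A * C) (B * D))"
    using AB CD ACBD by auto
  fix i j assume "i < dim_row (kron (A * C) (B * D))" "j < dim_col (kron (A * C) (B * D))"
  then have ij: "i < r * r'" "j < c * c'" using ACBD by auto
  note i' = div_mod_less[OF ij(1)] and j' = div_mod_less[OF ij(2)]
  have "(kron A B * kron C D) $$ (i, j) = (\<Sum>l<k * k'. kron A B $$ (i, l) * kron C D $$ (l, j))"
    using AB CD ij by (simp add: scalar_prod_def atLeast0LessThan)
  also have "\<dots> = (\<Sum>l<k * k'. (\<lambda>x y. A $$ (i div r', x) * B $$ (i mod r', y) *
      (C $$ (x, j div c') * D $$ (y, j mod c'))) (l div k') (l mod k'))"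
    using ij by (intro sum.cong) (auto simp: kron_index[OF A B] kron_index[OF C D])
  also have "\<dots> = (\<Sum>x<k. \<Sum>y<k'. A $$ (i div r', x) * B $$ (i mod r', y) *
      (C $$ (x, j div c') * D $$ (y, j mod c')))"
    by (rule sum_div_mod)
  also have "\<dots> = (\<Sum>x<k. A $$ (i div r', x) * C $$ (x, j div c')) *
      (\<Sum>y<k'. B $$ (i mod r', y) * D $$ (y, j mod c'))"
    by (simp add: sum_product mult_ac)
  also have "\<dots> = (A * C) $$ (i div r', j div c') * (B * D) $$ (i mod r', j mod c')"
    using A B C D i' j' by (simp add: scalar_prod_def atLeast0LessThan)
  finally show "(kron A B * kron C D) $$ (i, j) = kron (A * C) (B * D) $$ (i, j)"
    using kron_index[OF AC BD ij] by simp
qed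

lemma det_kron_one:
  fixes g :: "'a::idom mat"
  assumes g: "g \<in> carrier_mat n n"
  shows "det (kron (1\<^sub>m a) g) = det g ^ a"
proof (induction a)
  case 0
  have "kron (1\<^sub>m 0) g \<in> carrier_mat 0 0" using kron_carrier[of "1\<^sub>m 0" 0 0 g n n] g by simp
  then show ?case by simp
next
  case (Suc a)
  note kg = kron_carrier[OF one_carrier_mat[of a] g]
  have "kron (1\<^sub>m (Suc a)) g = four_block_mat g (0\<^sub>m n (a * n)) (0\<^sub>m (a * n) n) (kron (1\<^sub>m a) g)"
    (is "?l = ?r")
  proof (rule eq_matI)
    have r: "?r \<in> carrier_mat (n + a * n) (n + a * n)" using g kg by simp
    have l: "?l \<in> carrier_mat (n + a * n) (n + a * n)"
      using kron_carrier[OF one_carrier_mat[of "Suc a"] g] by simp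
    show "dim_row ?l = dim_row ?r" "dim_col ?l = dim_col ?r" using l r by auto
    fix i j assume "i < dim_row ?r" "j < dim_col ?r"
    then have ij: "i < n + a * n" "j < n + a * n" using r by auto
    then have "n > 0" by (cases n) auto
    have dm: "i div n < Suc a" "j div n < Suc a"
      using ij div_mod_less[of i "Suc a" n] div_mod_less[of j "Suc a" n] by auto
    have split: "k div n = Suc ((k - n) div n)" "k mod n = (k - n) mod n" if "\<not> k < n" for k
      using that \<open>n > 0\<close> by (auto simp: le_div_geq le_mod_geq)
    have lt: "(k - n) div n < a" if "\<not> k < n" "k < n + a * n" for k
      using that div_mod_less[of "k - n" a n] by simp
    show "?l $$ (i, j) = ?r $$ (i, j)"
      using ij dm g kg kron_index[OF one_carrier_mat[of "Suc a"] g, of i j]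
        kron_index[OF one_carrier_mat[of a] g, of "i - n" "j - n"] split[of i] split[of j]
        lt[of i] lt[of j]
      by (cases "i < n"; cases "j < n") auto
  qed
  then have "det (kron (1\<^sub>m (Suc a)) g) = det g * det (kron (1\<^sub>m a) g)"
    using det_four_block_mat_lower_left_zero[OF g zero_carrier_mat refl kg] by simp
  with Suc show ?case by simp
qed

lemma regular_mat_kron:
  assumes P: "P \<in> carrier_mat r c" and A: "regular_mat C X r' c' A"
  shows "regular_mat C X (r * r') (c * c') (\<lambda>x. kron P (A x))"
  unfolding regular_mat_def
proof (intro conjI allI impI ballI)
  have cA: "A x \<in> carrier_mat r' c'" if "x \<in> X" for x
    using that A unfolding regular_mat_def by auto
  show "kron P (A x) \<in> carrier_mat (r * r') (c * c')" if "x \<in> X" for x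
    using kron_carrier[OF P cA[OF that]] .
  fix i j assume ij: "i < r * r'" "j < c * c'"
  note ij' = div_mod_less[OF ij(1)] div_mod_less[OF ij(2)]
  have "kron P (A x) $$ (i, j) = P $$ (i div r', j div c') * A x $$ (i mod r', j mod c')"
    if "x \<in> X" for x using kron_index[OF P cA[OF that] ij] .
  moreover have "regular_on C X (\<lambda>x. P $$ (i div r', j div c') * A x $$ (i mod r', j mod c'))"
    using A ij' unfolding regular_mat_def by (auto intro: regular_on_mult regular_on_const)
  ultimately show "regular_on C X (\<lambda>x. kron P (A x) $$ (i, j))"
    by (simp cong: regular_on_cong)
qed

section \<open>Determinantal semi-invariants\<close>

lemma GL_inv:
  fixes g :: "'a::field mat"
  assumes "g \<in> carrier (GL n)"
  shows "inv\<^bsub>GL n\<^esub> g \<in> carrier_mat n n" "inv\<^bsub>GL n\<^esub> g * g = 1\<^sub>m n" "g * inv\<^bsub>GL n\<^esub> g = 1\<^sub>m n"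
    "det (inv\<^bsub>GL n\<^esub> g) = inverse (det g)"
proof -
  interpret group "GL n :: 'a mat monoid" by (rule group_GL)
  have mult: "x \<otimes>\<^bsub>GL n\<^esub> y = x * y" for x y :: "'a mat"
    by (simp add: GL_def units_of_mult ring_mat_simps)
  have one: "\<one>\<^bsub>GL n\<^esub> = (1\<^sub>m n :: 'a mat)"
    by (simp add: GL_def units_of_one ring_mat_simps)
  show c: "inv\<^bsub>GL n\<^esub> g \<in> carrier_mat n n"
    using inv_closed[OF assms] by (simp add: carrier_GL)
  show l: "inv\<^bsub>GL n\<^esub> g * g = 1\<^sub>m n" using l_inv[OF assms] mult one by simp
  show "g * inv\<^bsub>GL n\<^esub> g = 1\<^sub>m n" using r_inv[OF assms] mult one by simp
  have "g \<in> carrier_mat n n" "det g \<noteq> 0" using assms by (auto simp: carrier_GL)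
  then have "det (inv\<^bsub>GL n\<^esub> g) * det g = 1" using det_mult[OF c] l by fastforce
  then show "det (inv\<^bsub>GL n\<^esub> g) = inverse (det g)" using \<open>det g \<noteq> 0\<close> by (simp add: field_simps)
qed

lemma GL_inv_eqI:
  fixes g :: "'a::field mat"
  assumes "g \<in> carrier (GL n)" "h \<in> carrier_mat n n" "h * g = 1\<^sub>m n"
  shows "inv\<^bsub>GL n\<^esub> g = h"
proof -
  have g: "g \<in> carrier_mat n n" using assms(1) by (simp add: carrier_GL)
  have "h = h * (g * inv\<^bsub>GL n\<^esub> g)" using GL_inv[OF assms(1)] assms by simp
  also have "\<dots> = (h * g) * inv\<^bsub>GL n\<^esub> g"
    using GL_inv(1)[OF assms(1)] g assms(2) by (intro assoc_mult_mat[symmetric]) auto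
  finally show ?thesis using GL_inv(1)[OF assms(1)] assms(3) by simp
qed

lemma carrier_lomadze_group:
  "(g0, g1) \<in> carrier (lomadze_group n p) \<longleftrightarrow> g0 \<in> carrier (GL n) \<and> g1 \<in> carrier (GL (n + p))"
  unfolding lomadze_group_def by simp

lemma lomadze_systems_iff:
  "(K, L, M) \<in> lomadze_systems n m p \<longleftrightarrow> K \<in> carrier_mat (n + p) n \<and>
    L \<in> carrier_mat (n + p) n \<and> M \<in> carrier_mat (n + p) (p + m)"
  unfolding lomadze_systems_def by simp

lemma lomadze_systemsD:
  assumes "(K, L, M) \<in> lomadze_systems n m p"
  shows "K \<in> carrier_mat (n + p) n" "L \<in> carrier_mat (n + p) n" "M \<in> carrier_mat (n + p) (p + m)"
  using assms by (simp_all add: lomadze_systems_iff)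

lemma lomadze_act_closed:
  assumes "g \<in> carrier (lomadze_group n p)" "x \<in> lomadze_systems n m p"
  shows "lomadze_act n p g x \<in> lomadze_systems n m p"
proof -
  obtain g0 g1 K L M where [simp]: "g = (g0, g1)" "x = (K, L, M)" by (metis prod_cases3 surj_pair)
  show ?thesis using assms GL_inv(1)[of g0 n]
    by (auto simp: carrier_lomadze_group lomadze_systems_iff carrier_GL)
qed

text \<open>
  Semi-invariance with natural exponents: weight \<open>(a, b)\<close> stands for the character \<open>(-a, b)\<close>. The exponents
  add under multiplication of functions.
\<close>

definition weight_fun ::
    "nat \<Rightarrow> nat \<Rightarrow> nat \<Rightarrow> nat \<Rightarrow> nat \<Rightarrow> ('k::field lomadze \<Rightarrow> 'k) \<Rightarrow> bool" where
  "weight_fun n m p a b f \<longleftrightarrow> regular_on (lomadze_coords n m p) (lomadze_systems n m p) f \<and>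
    (\<forall>g0 \<in> carrier (GL n). \<forall>g1 \<in> carrier (GL (n + p)). \<forall>x \<in> lomadze_systems n m p.
      f (lomadze_act n p (g0, g1) x) = inverse (det g0) ^ a * det g1 ^ b * f x)"

lemma weight_fun_mult:
  "weight_fun n m p a b f \<Longrightarrow> weight_fun n m p a' b' g \<Longrightarrow>
    weight_fun n m p (a + a') (b + b') (\<lambda>x. f x * g x)"
  unfolding weight_fun_def by (auto simp: power_add mult_ac intro: regular_on_mult)

lemma weight_fun_power:
  "weight_fun n m p a b f \<Longrightarrow> weight_fun n m p (k * a) (k * b) (\<lambda>x. f x ^ k)"
  unfolding weight_fun_def
  by (auto simp: power_mult_distrib power_mult mult.commute[of k] intro: regular_on_power)

lemma weight_fun_semi_invariant:
  fixes f :: "'k::field lomadze \<Rightarrow> 'k"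
  assumes f: "weight_fun n m p a b f"
  obtains f' where "semi_invariant n m p (- int a, int b) 1 f'"
    "\<And>x. x \<in> lomadze_systems n m p \<Longrightarrow> f' x = f x"
proof -
  obtain f' where f': "f' \<in> regular_functions (lomadze_coords n m p)"
    "\<And>x. x \<in> lomadze_systems n m p \<Longrightarrow> f' x = f x"
    using f unfolding weight_fun_def regular_on_def by metis
  have "semi_invariant n m p (- int a, int b) 1 f'"
    unfolding semi_invariant_def
  proof (intro conjI ballI)
    fix g :: "'k mat \<times> 'k mat" and x :: "'k lomadze"
    assume gx: "g \<in> carrier (lomadze_group n p)" "x \<in> lomadze_systems n m p"
    obtain g0 g1 where g: "g = (g0, g1)" by (cases g)
    have "f (lomadze_act n p (g0, g1) x) = inverse (det g0) ^ a * det g1 ^ b * f x"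
      using f gx unfolding weight_fun_def g carrier_lomadze_group by blast
    moreover have "character (- int a, int b) g = inverse (det g0) ^ a * det g1 ^ b"
      by (simp add: g power_int_minus power_inverse)
    ultimately show "f' (lomadze_act n p g x) = character (- int a, int b) g ^ 1 * f' x"
      using f'(2)[OF gx(2)] f'(2)[OF lomadze_act_closed[OF gx]] by (simp only: g power_one_right)
  qed (fact f')
  with f' that show ?thesis by blast
qed

text \<open>
  Column operations on the first block only; this isolates the factor of the determinant that comes
  from the group acting on the domain.
\<close>

lemma hconcat_mult_block_diag:
  fixes X :: "'a::comm_ring_1 mat"
  assumes X: "X \<in> carrier_mat r c" and Y: "Y \<in> carrier_mat r d" and V: "V \<in> carrier_mat c c"
  shows "hconcat X Y * four_block_mat V (0\<^sub>m c d) (0\<^sub>m d c) (1\<^sub>m d) = hconcat (X * V) Y"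
    (is "_ * ?B = _")
proof (rule eq_matI)
  have XV: "X * V \<in> carrier_mat r c" using X V by simp
  note h = hconcat_carrier[OF X Y] and h' = hconcat_carrier[OF XV Y]
  have B: "?B \<in> carrier_mat (c + d) (c + d)" using V by simp
  show "dim_row (hconcat X Y * ?B) = dim_row (hconcat (X * V) Y)"
    "dim_col (hconcat X Y * ?B) = dim_col (hconcat (X * V) Y)" using X Y V by auto
  fix i j assume "i < dim_row (hconcat (X * V) Y)" "j < dim_col (hconcat (X * V) Y)"
  then have ij: "i < r" "j < c + d" using h' by auto
  have "(hconcat X Y * ?B) $$ (i, j) = (\<Sum>k<c + d. hconcat X Y $$ (i, k) * ?B $$ (k, j))"
    by (rule mult_mat_entry[OF h B ij])
  also have "\<dots> = (\<Sum>k<c. X $$ (i, k) * ?B $$ (k, j)) + (\<Sum>k<d. Y $$ (i, k) * ?B $$ (c + k, j))"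
  proof -
    have *: "(\<Sum>k<c + d. F k) = (\<Sum>k<c. F k) + (\<Sum>k<d. F (c + k))" for F :: "nat \<Rightarrow> 'a"
      by (induction d) (auto simp: add.assoc)
    show ?thesis unfolding * using ij by (auto simp: hconcat_index[OF X Y] intro!: arg_cong2[of _ _ _ _ "(+)"] sum.cong)
  qed
  also have "\<dots> = hconcat (X * V) Y $$ (i, j)"
  proof (cases "j < c")
    case True
    then show ?thesis using ij X V Y
      by (auto simp: hconcat_index[OF XV Y] scalar_prod_def atLeast0LessThan)
  next
    case False
    have "(\<Sum>k<d. Y $$ (i, k) * ?B $$ (c + k, j)) = (\<Sum>k<d. if k = j - c then Y $$ (i, k) else 0)"
      using False ij V by (intro sum.cong) auto
    then show ?thesis using False ij X V Y
      by (auto simp: hconcat_index[OF XV Y])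
  qed
  finally show "(hconcat X Y * ?B) $$ (i, j) = hconcat (X * V) Y $$ (i, j)" .
qed

text \<open>
  The determinantal semi-invariants of a framed Kronecker module: \<open>P\<close> and \<open>Q\<close> describe a pencil that is
  tensored with \<open>(K, L)\<close>, and \<open>R\<close> selects as many combinations of the framing columns as are needed for a
  square matrix.
\<close>

definition det_form :: "'k::field mat \<Rightarrow> 'k mat \<Rightarrow> 'k mat \<Rightarrow> 'k lomadze \<Rightarrow> 'k" where
  "det_form P Q R = (\<lambda>(K, L, M).
    det (hconcat (kron P K + kron Q L) (kron (1\<^sub>m (dim_row P)) M * R)))"

lemma regular_mat_lomadze:
  "regular_mat (lomadze_coords n m p) (lomadze_systems n m p) (n + p) n fst"
  "regular_mat (lomadze_coords n m p) (lomadze_systems n m p) (n + p) n (\<lambda>x. fst (snd x))"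
  "regular_mat (lomadze_coords n m p) (lomadze_systems n m p) (n + p) (p + m) (\<lambda>x. snd (snd x))"
  unfolding regular_mat_def
  by (auto simp: lomadze_systems_def lomadze_coords_def case_prod_beta' intro!: regular_on_coord)

text \<open>
  Acting by \<open>(g0, g1)\<close> multiplies the block matrix by \<open>1 \<otimes> g1\<close> from the left and by the block diagonal
  matrix of \<open>1 \<otimes> g0\<^sup>-\<^sup>1\<close> and \<open>1\<close> from the right.
\<close>

lemma det_form_weight:
  fixes P Q R :: "'k::field mat"
  assumes P: "P \<in> carrier_mat b a" and Q: "Q \<in> carrier_mat b a"
    and R: "R \<in> carrier_mat (b * (p + m)) (b * (n + p) - a * n)" and le: "a * n \<le> b * (n + p)"
  shows "weight_fun n m p a b (det_form P Q R)"
  unfolding weight_fun_def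
proof (intro conjI ballI)
  let ?C = "lomadze_coords n m p :: ('k lomadze \<Rightarrow> 'k) set"
  let ?X = "lomadze_systems n m p :: 'k lomadze set"
  have dim: "a * n + (b * (n + p) - a * n) = b * (n + p)" using le by simp
  have "regular_mat ?C ?X (b * (n + p)) (a * n + (b * (n + p) - a * n))
    (\<lambda>x. hconcat (kron P (fst x) + kron Q (fst (snd x))) (kron (1\<^sub>m b) (snd (snd x)) * R))"
    by (intro regular_mat_hconcat regular_mat_add regular_mat_mult[of _ _ _ "b * (p + m)"]
      regular_mat_kron regular_mat_lomadze regular_mat_const P Q R one_carrier_mat)
  then have "regular_on ?C ?X
    (\<lambda>x. det (hconcat (kron P (fst x) + kron Q (fst (snd x))) (kron (1\<^sub>m b) (snd (snd x)) * R)))"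
    unfolding dim by (rule regular_on_det)
  then show "regular_on ?C ?X (det_form P Q R)"
    using P unfolding det_form_def by (simp add: case_prod_beta')
next
  fix g0 g1 :: "'k mat" and x :: "'k lomadze"
  assume g: "g0 \<in> carrier (GL n)" "g1 \<in> carrier (GL (n + p))" and x: "x \<in> lomadze_systems n m p"
  obtain K L M where xx: "x = (K, L, M)" by (cases x)
  note c = lomadze_systemsD[OF x[unfolded xx]]
  have g1: "g1 \<in> carrier_mat (n + p) (n + p)" using g by (simp add: carrier_GL)
  define h where "h = inv\<^bsub>GL n\<^esub> g0"
  have h: "h \<in> carrier_mat n n" "det h = inverse (det g0)"
    using GL_inv[OF g(1)] unfolding h_def by auto
  define U V where "U = kron (1\<^sub>m b) g1" and "V = kron (1\<^sub>m a) h"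
  have U: "U \<in> carrier_mat (b * (n + p)) (b * (n + p))"
    using kron_carrier[OF one_carrier_mat g1] unfolding U_def .
  have V: "V \<in> carrier_mat (a * n) (a * n)"
    using kron_carrier[OF one_carrier_mat h(1)] unfolding V_def .
  define d where "d = b * (n + p) - a * n"
  have dim: "a * n + d = b * (n + p)" using le unfolding d_def by simp
  note PK = kron_carrier[OF P c(1)] and QL = kron_carrier[OF Q c(2)]
  define X where "X = kron P K + kron Q L"
  have X: "X \<in> carrier_mat (b * (n + p)) (a * n)" using PK QL unfolding X_def by simp
  define Y where "Y = kron (1\<^sub>m b) M * R"
  note M1 = kron_carrier[OF one_carrier_mat[of b] c(3)]
  have Y: "Y \<in> carrier_mat (b * (n + p)) d" using M1 R unfolding Y_def d_def by simp
  have tr: "kron S (g1 * N * h) = U * kron S N * V"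
    if S: "S \<in> carrier_mat b a" and N: "N \<in> carrier_mat (n + p) n" for S N
  proof -
    have "U * kron S N = kron S (g1 * N)"
      unfolding U_def using kron_mult[OF one_carrier_mat g1 S N] S by simp
    moreover have "g1 * N \<in> carrier_mat (n + p) n" using g1 N by simp
    ultimately show ?thesis
      unfolding V_def using kron_mult[OF S _ one_carrier_mat h(1)] S by simp
  qed
  have "kron P (g1 * K * h) + kron Q (g1 * L * h) = U * kron P K * V + U * kron Q L * V"
    using tr[OF P c(1)] tr[OF Q c(2)] by simp
  also have "\<dots> = (U * kron P K + U * kron Q L) * V"
    using U PK QL V by (intro add_mult_distrib_mat[symmetric]) auto
  also have "U * kron P K + U * kron Q L = U * X"
    unfolding X_def using U PK QL by (intro mult_add_distrib_mat[symmetric]) auto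
  also have "U * X * V = U * (X * V)" using U X V by simp
  finally have e1: "kron P (g1 * K * h) + kron Q (g1 * L * h) = U * (X * V)" .
  have "kron (1\<^sub>m b) (g1 * M) = U * kron (1\<^sub>m b) M"
    unfolding U_def using kron_mult[OF one_carrier_mat g1 one_carrier_mat[of b] c(3)] by simp
  then have e2: "kron (1\<^sub>m b) (g1 * M) * R = U * Y"
    unfolding Y_def using U M1 R by simp
  define D where "D = four_block_mat V (0\<^sub>m (a * n) d) (0\<^sub>m d (a * n)) (1\<^sub>m d)"
  have D: "D \<in> carrier_mat (b * (n + p)) (b * (n + p))"
    unfolding dim[symmetric] D_def using V by (intro four_block_carrier_mat) auto
  have detD: "det D = det V"
    unfolding D_def using det_four_block_mat_lower_left_zero[OF V zero_carrier_mat refl one_carrier_mat]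
    by simp
  have XY: "hconcat X Y \<in> carrier_mat (b * (n + p)) (b * (n + p))"
    using hconcat_carrier[OF X Y] dim by simp
  have "hconcat (U * (X * V)) (U * Y) = U * hconcat (X * V) Y"
    using mult_hconcat[OF U _ Y, of "X * V" "a * n"] X V by simp
  also have "hconcat (X * V) Y = hconcat X Y * D"
    unfolding D_def using hconcat_mult_block_diag[OF X Y V] by simp
  finally have "det (hconcat (U * (X * V)) (U * Y)) = det U * (det (hconcat X Y) * det D)"
    using det_mult[OF U, of "hconcat X Y * D"] det_mult[OF XY D] XY D by simp
  also have "\<dots> = inverse (det g0) ^ a * det g1 ^ b * det (hconcat X Y)"
    using detD h(2) det_kron_one[OF g1, of b] det_kron_one[OF h(1), of a]
    unfolding U_def V_def by simp
  finally have "det (hconcat (U * (X * V)) (U * Y)) =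
    inverse (det g0) ^ a * det g1 ^ b * det (hconcat X Y)" .
  then show "det_form P Q R (lomadze_act n p (g0, g1) x) =
      inverse (det g0) ^ a * det g1 ^ b * det_form P Q R x"
    using P unfolding det_form_def xx
    by (simp add: e1[unfolded h_def] e2 X_def[symmetric] Y_def[symmetric])
qed

section \<open>Destabilizing one-parameter subgroups\<close>

lemma det_mat_diag: "det (mat_diag n f) = (\<Prod>i<n. f i :: 'a::comm_ring_1)"
proof -
  have "det (mat_diag n f) = prod_list (diag_mat (mat_diag n f))"
    by (rule det_upper_triangular[of _ n]) (auto simp: mat_diag_def)
  also have "\<dots> = (\<Prod>i<n. f i)"
    unfolding prod_list_diag_prod by (auto simp: mat_diag_def atLeast0LessThan intro!: prod.cong)
  finally show ?thesis .
qed

lemma prod_power_int: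
  fixes n :: nat
  shows "t \<noteq> 0 \<Longrightarrow> (\<Prod>i<n. t powi \<alpha> i) = (t :: 'a::field) powi (\<Sum>i<n. \<alpha> i)"
  by (induction n) (auto simp: power_int_add)

lemma semi_invariantD:
  "semi_invariant n m p \<chi> N f \<Longrightarrow> g \<in> carrier (lomadze_group n p) \<Longrightarrow> x \<in> lomadze_systems n m p \<Longrightarrow>
    f (lomadze_act n p g x) = character \<chi> g ^ N * f x"
  unfolding semi_invariant_def by blast

text \<open>
  The easy half of the Hilbert--Mumford criterion. The torus element with entries \<open>t powi \<alpha> j\<close> and
  \<open>t powi \<beta> i\<close> moves the system along a polynomial curve, while \<open>f\<close> is multiplied by a negative power of \<open>t\<close>;
  clearing the denominator shows that the value of \<open>f\<close> is divisible by \<open>t\<close>.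
\<close>

lemma one_parameter_subgroup_vanishing:
  fixes f :: "'k::field_char_0 lomadze \<Rightarrow> 'k"
  assumes f: "semi_invariant n m p (- int a, int b) N f" and "N \<ge> 1"
    and S: "(K, L, M) \<in> lomadze_systems n m p"
    and wK: "\<And>i j. i < n + p \<Longrightarrow> j < n \<Longrightarrow> K $$ (i, j) \<noteq> 0 \<Longrightarrow> \<alpha> j \<le> \<beta> i"
    and wL: "\<And>i j. i < n + p \<Longrightarrow> j < n \<Longrightarrow> L $$ (i, j) \<noteq> 0 \<Longrightarrow> \<alpha> j \<le> \<beta> i"
    and wM: "\<And>i j. i < n + p \<Longrightarrow> j < p + m \<Longrightarrow> M $$ (i, j) \<noteq> 0 \<Longrightarrow> 0 \<le> \<beta> i"
    and neg: "int b * (\<Sum>i<n + p. \<beta> i) < int a * (\<Sum>j<n. \<alpha> j)"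
  shows "f (K, L, M) = 0"
proof -
  note c = lomadze_systemsD[OF S]
  \<comment> \<open>The orbit of the torus, extended to \<open>t = 0\<close>; truncated exponents occur only at zero entries.\<close>
  define \<gamma> where "\<gamma> t =
    (mat (n + p) n (\<lambda>(i, j). t ^ nat (\<beta> i - \<alpha> j) * K $$ (i, j)),
     mat (n + p) n (\<lambda>(i, j). t ^ nat (\<beta> i - \<alpha> j) * L $$ (i, j)),
     mat (n + p) (p + m) (\<lambda>(i, j). t ^ nat (\<beta> i) * M $$ (i, j)))" for t :: 'k
  have "\<exists>P. \<forall>t\<in>UNIV. f (\<gamma> t) = poly P t"
  proof (rule regular_function_along_curve[where C = "lomadze_coords n m p"])
    show "f \<in> regular_functions (lomadze_coords n m p)"
      using f unfolding semi_invariant_def by blast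
    fix g :: "'k lomadze \<Rightarrow> 'k" assume "g \<in> lomadze_coords n m p"
    then consider
        (1) i j where "g = (\<lambda>(K, L, M). K $$ (i, j))" "i < n + p" "j < n"
      | (2) i j where "g = (\<lambda>(K, L, M). L $$ (i, j))" "i < n + p" "j < n"
      | (3) i j where "g = (\<lambda>(K, L, M). M $$ (i, j))" "i < n + p" "j < p + m"
      unfolding lomadze_coords_def by blast
    then show "\<exists>P. \<forall>t\<in>UNIV. g (\<gamma> t) = poly P t"
    proof cases
      case 1
      then show ?thesis unfolding \<gamma>_def
        by (intro exI[of _ "monom (K $$ (i, j)) (nat (\<beta> i - \<alpha> j))"]) (simp add: poly_monom)
    next
      case 2
      then show ?thesis unfolding \<gamma>_def
        by (intro exI[of _ "monom (L $$ (i, j)) (nat (\<beta> i - \<alpha> j))"]) (simp add: poly_monom)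
    next
      case 3
      then show ?thesis unfolding \<gamma>_def
        by (intro exI[of _ "monom (M $$ (i, j)) (nat (\<beta> i))"]) (simp add: poly_monom)
    qed
  qed
  then obtain P where P: "\<And>t. f (\<gamma> t) = poly P t" by blast
  \<comment> \<open>Minus the exponent of \<open>t\<close> in the value of the character.\<close>
  define e where "e = int N * (int a * (\<Sum>j<n. \<alpha> j) - int b * (\<Sum>i<n + p. \<beta> i))"
  have "e > 0" unfolding e_def using neg \<open>N \<ge> 1\<close> by simp
  have "t ^ nat e * poly P t = f (K, L, M)" if t: "t \<noteq> 0" for t
  proof -
    define g0 g1 h0 where "g0 = mat_diag n (\<lambda>j. t powi \<alpha> j)"
      and "g1 = mat_diag (n + p) (\<lambda>i. t powi \<beta> i)"
      and "h0 = mat_diag n (\<lambda>j. t powi (- \<alpha> j))"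
    have d0: "det g0 = t powi (\<Sum>j<n. \<alpha> j)" and d1: "det g1 = t powi (\<Sum>i<n + p. \<beta> i)"
      unfolding g0_def g1_def det_mat_diag using prod_power_int[OF t] by auto
    have g: "g0 \<in> carrier (GL n)" "g1 \<in> carrier (GL (n + p))"
      using d0 d1 t unfolding carrier_GL by (auto simp: g0_def g1_def)
    have "h0 * g0 = mat_diag n (\<lambda>j. t powi (- \<alpha> j) * t powi \<alpha> j)"
      unfolding h0_def g0_def by simp
    also have "\<dots> = 1\<^sub>m n"
      using t by (simp add: power_int_add[symmetric])
    finally have inv: "inv\<^bsub>GL n\<^esub> g0 = h0"
      by (intro GL_inv_eqI g) (auto simp: h0_def)
    have tp: "t powi \<beta> i * x * t powi (- \<alpha> j) = t ^ nat (\<beta> i - \<alpha> j) * x"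
      if "x \<noteq> 0 \<Longrightarrow> \<alpha> j \<le> \<beta> i" for x i j
    proof (cases "x = 0")
      case False
      have "t powi \<beta> i * x * t powi (- \<alpha> j) = t powi (\<beta> i - \<alpha> j) * x"
        using t by (simp add: power_int_diff power_int_minus field_simps)
      also have "t powi (\<beta> i - \<alpha> j) = t ^ nat (\<beta> i - \<alpha> j)"
        using that[OF False] by (simp add: power_int_def)
      finally show ?thesis .
    qed simp
    have tpM: "t powi \<beta> i * x = t ^ nat (\<beta> i) * x" if "x \<noteq> 0 \<Longrightarrow> 0 \<le> \<beta> i" for x i
      using that by (cases "x = 0") (auto simp: power_int_def)
    have conj: "g1 * A * h0 = mat (n + p) n (\<lambda>(i, j). t powi \<beta> i * A $$ (i, j) * t powi (- \<alpha> j))"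
      if A: "A \<in> carrier_mat (n + p) n" for A
      unfolding g1_def h0_def mat_diag_mult_left[OF A]
      by (subst mat_diag_mult_right[of _ "n + p"]) auto
    have "g1 * K * h0 = mat (n + p) n (\<lambda>(i, j). t ^ nat (\<beta> i - \<alpha> j) * K $$ (i, j))"
      unfolding conj[OF c(1)] by (intro eq_matI) (simp_all add: tp[OF wK])
    moreover have "g1 * L * h0 = mat (n + p) n (\<lambda>(i, j). t ^ nat (\<beta> i - \<alpha> j) * L $$ (i, j))"
      unfolding conj[OF c(2)] by (intro eq_matI) (simp_all add: tp[OF wL])
    moreover have "g1 * M = mat (n + p) (p + m) (\<lambda>(i, j). t ^ nat (\<beta> i) * M $$ (i, j))"
      unfolding g1_def mat_diag_mult_left[OF c(3)]
      by (intro eq_matI) (simp_all add: tpM[OF wM])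
    ultimately have "lomadze_act n p (g0, g1) (K, L, M) = \<gamma> t"
      by (simp add: inv \<gamma>_def)
    moreover have "f (lomadze_act n p (g0, g1) (K, L, M)) =
        character (- int a, int b) (g0, g1) ^ N * f (K, L, M)"
      using g by (intro semi_invariantD[OF f _ S]) (simp add: carrier_lomadze_group)
    moreover have "character (- int a, int b) (g0, g1) ^ N = t powi (- e)"
    proof -
      have "character (- int a, int b) (g0, g1) =
          (t powi (\<Sum>j<n. \<alpha> j)) powi (- int a) * (t powi (\<Sum>i<n + p. \<beta> i)) powi int b"
        by (simp only: character.simps d0 d1)
      also have "\<dots> = t powi ((\<Sum>j<n. \<alpha> j) * (- int a) + (\<Sum>i<n + p. \<beta> i) * int b)"
        using t by (simp only: power_int_mult power_int_add simp_thms)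
      finally have "character (- int a, int b) (g0, g1) ^ N =
          (t powi ((\<Sum>j<n. \<alpha> j) * (- int a) + (\<Sum>i<n + p. \<beta> i) * int b)) powi int N"
        by (simp only: power_int_of_nat)
      also have "\<dots> = t powi (((\<Sum>j<n. \<alpha> j) * (- int a) + (\<Sum>i<n + p. \<beta> i) * int b) * int N)"
        by (simp only: power_int_mult)
      also have "((\<Sum>j<n. \<alpha> j) * (- int a) + (\<Sum>i<n + p. \<beta> i) * int b) * int N = - e"
        unfolding e_def by (simp add: algebra_simps)
      finally show ?thesis .
    qed
    ultimately have "poly P t = t powi (- e) * f (K, L, M)" using P by simp
    then have "t powi e * poly P t = t powi (e + (- e)) * f (K, L, M)"
      using t by (subst power_int_add) (auto simp: mult.assoc)
    then show ?thesis using \<open>e > 0\<close> by (simp add: power_int_def)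
  qed
  then show ?thesis using constant_divisible_by_power[of "nat e" P] \<open>e > 0\<close> by simp
qed

lemma semi_invariant_act_zero:
  fixes f :: "'k::field lomadze \<Rightarrow> 'k"
  assumes "semi_invariant n m p \<chi> N f" "S \<in> lomadze_systems n m p"
    "g0 \<in> carrier (GL n)" "g1 \<in> carrier (GL (n + p))" "f (lomadze_act n p (g0, g1) S) = 0"
  shows "f S = 0"
proof -
  obtain \<chi>0 \<chi>1 where \<chi>: "\<chi> = (\<chi>0, \<chi>1)" by (cases \<chi>)
  have "f (lomadze_act n p (g0, g1) S) = character \<chi> (g0, g1) ^ N * f S"
    using assms unfolding semi_invariant_def by (simp add: carrier_lomadze_group)
  moreover have "character \<chi> (g0, g1) \<noteq> 0"
    using assms(3,4) by (auto simp: \<chi> carrier_GL)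
  ultimately show ?thesis using assms(5) by simp
qed

lemma adapted_basis:
  fixes C :: "'a::field mat"
  assumes C: "C \<in> carrier_mat r c" "injective_mat C"
  obtains G H where "c \<le> r" "G \<in> carrier_mat r r" "H \<in> carrier_mat r r" "G * H = 1\<^sub>m r" "H * G = 1\<^sub>m r"
    "det G \<noteq> 0" "det H \<noteq> 0" "\<And>j. j < c \<Longrightarrow> col H j = col C j"
    "G * C = mat r c (\<lambda>(i, j). if i = j then 1 else 0)"
proof -
  obtain R where R: "c \<le> r" "R \<in> carrier_mat r (r - c)" "det (hconcat C R) \<noteq> 0"
    using complete_columns[OF C(1)] injective_matD[OF C(2,1)] by blast
  define H where "H = hconcat C R"
  have H: "H \<in> carrier_mat r r" "det H \<noteq> 0"
    using hconcat_carrier[OF C(1) R(2)] R unfolding H_def by auto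
  obtain G where G: "G \<in> carrier_mat r r" "G * H = 1\<^sub>m r" "H * G = 1\<^sub>m r" "det G \<noteq> 0"
    using invertible_mat_inverse[OF H] by metis
  have cH: "col H j = col C j" if "j < c" for j
    using that R C H by (intro eq_vecI) (auto simp: H_def hconcat_index[OF C(1) R(2)])
  have "G * C = mat r c (\<lambda>(i, j). if i = j then 1 else 0)"
  proof (rule eq_matI)
    fix i j assume "i < dim_row (mat r c (\<lambda>(i, j). if i = j then 1 else 0 :: 'a))"
      "j < dim_col (mat r c (\<lambda>(i, j). if i = j then 1 else 0 :: 'a))"
    then have ij: "i < r" "j < c" by auto
    have "(G * C) $$ (i, j) = row G i \<bullet> col H j" using ij G(1) C(1) cH[of j] by simp
    also have "\<dots> = (G * H) $$ (i, j)" using ij G(1) H(1) R(1) by simp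
    finally have "(G * C) $$ (i, j) = (G * H) $$ (i, j)" .
    then show "(G * C) $$ (i, j) = mat r c (\<lambda>(i, j). if i = j then 1 else 0) $$ (i, j)"
      unfolding G(2) using ij R(1) by auto
  qed (use G C in auto)
  with that R G H cH show ?thesis by metis
qed

text \<open>
  The columns of \<open>U\<close> span a subspace of the domain, and \<open>K U\<close>, \<open>L U\<close> lie in the column span of \<open>C\<close>. In bases
  adapted to both subspaces the weight \<open>1\<close> on them and \<open>0\<close> elsewhere is admissible.
\<close>

lemma destabilizing_subsystem:
  fixes f :: "'k::field_char_0 lomadze \<Rightarrow> 'k"
  assumes f: "semi_invariant n m p (- int a, int b) N f" and "N \<ge> 1"
    and S: "(K, L, M) \<in> lomadze_systems n m p"
    and U: "U \<in> carrier_mat n d" "injective_mat U"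
    and C: "C \<in> carrier_mat (n + p) c"
    and X: "X \<in> carrier_mat c d" and Y: "Y \<in> carrier_mat c d"
    and KU: "K * U = C * X" and LU: "L * U = C * Y"
    and lt: "b * c < a * d"
  shows "f (K, L, M) = 0"
proof -
  have cS: "K \<in> carrier_mat (n + p) n" "L \<in> carrier_mat (n + p) n" "M \<in> carrier_mat (n + p) (p + m)"
    using S unfolding lomadze_systems_iff by auto
  obtain c' C' Z where C': "C' \<in> carrier_mat (n + p) c'" "injective_mat C'" and
    Z: "Z \<in> carrier_mat c' c" "surjective_mat Z" and CZ: "C = C' * Z"
    using rank_factorization[OF C] by metis
  have "c' \<le> c" using surjective_mat_dim[OF Z(2,1)] .
  obtain G0 H0 where G0: "d \<le> n" "G0 \<in> carrier_mat n n" "H0 \<in> carrier_mat n n" "H0 * G0 = 1\<^sub>m n"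
    "det G0 \<noteq> 0" "\<And>j. j < d \<Longrightarrow> col H0 j = col U j"
    using adapted_basis[OF U] by metis
  obtain G1 where G1: "c' \<le> n + p" "G1 \<in> carrier_mat (n + p) (n + p)" "det G1 \<noteq> 0"
    "G1 * C' = mat (n + p) c' (\<lambda>(i, j). if i = j then 1 else 0)"
    using adapted_basis[OF C'] by metis
  have g: "G0 \<in> carrier (GL n)" "G1 \<in> carrier (GL (n + p))"
    using G0 G1 by (auto simp: carrier_GL)
  have inv: "inv\<^bsub>GL n\<^esub> G0 = H0" using GL_inv_eqI[OF g(1) G0(3,4)] .
  have block: "(G1 * A * H0) $$ (i, j) = 0"
    if A: "A \<in> carrier_mat (n + p) n" and X: "X \<in> carrier_mat c d" and AU: "A * U = C * X"
      and ij: "c' \<le> i" "i < n + p" "j < d" for A X i j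
  proof -
    have "(G1 * A * H0) $$ (i, j) = (G1 * (A * H0)) $$ (i, j)"
      using assoc_mult_mat[OF G1(2) A G0(3)] by simp
    also have "\<dots> = row G1 i \<bullet> col (A * H0) j"
      using ij G0(1,3) G1(2) A by (intro index_mult_mat(1)) auto
    also have "col (A * H0) j = A *\<^sub>v col H0 j"
      using ij(3) G0(1) by (intro col_mult2[OF A G0(3)]) simp
    also have "\<dots> = A *\<^sub>v col U j" using G0(6)[of j] ij by simp
    also have "\<dots> = col (A * U) j" by (rule col_mult2[OF A U(1) ij(3), symmetric])
    also have "A * U = C' * (Z * X)"
      unfolding AU CZ by (rule assoc_mult_mat[OF C'(1) Z(1) X])
    also have "row G1 i \<bullet> col (C' * (Z * X)) j = (G1 * (C' * (Z * X))) $$ (i, j)"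
      using ij G1 C' Z X by simp
    also have "G1 * (C' * (Z * X)) = (G1 * C') * (Z * X)"
      using G1(2) C'(1) Z X by (intro assoc_mult_mat[symmetric]) auto
    also have "\<dots> $$ (i, j) = (\<Sum>k<c'. (G1 * C') $$ (i, k) * (Z * X) $$ (k, j))"
      using ij G1(2) C' Z X by (intro mult_mat_entry) auto
    also have "\<dots> = 0" unfolding G1(4) using ij by (intro sum.neutral) auto
    finally show ?thesis .
  qed
  have "f (G1 * K * H0, G1 * L * H0, G1 * M) = 0"
  proof (rule one_parameter_subgroup_vanishing[OF f \<open>N \<ge> 1\<close>, where
        \<alpha> = "\<lambda>j. if j < d then 1 else 0" and \<beta> = "\<lambda>i. if i < c' then 1 else 0"])
    show "(G1 * K * H0, G1 * L * H0, G1 * M) \<in> lomadze_systems n m p"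
      unfolding lomadze_systems_iff using G0 G1 cS by auto
    have "{..<n} \<inter> {j. j < d} = {..<d}" "{..<n + p} \<inter> {i. i < c'} = {..<c'}"
      using G0(1) G1(1) by auto
    then have sums: "(\<Sum>j<n. if j < d then 1 else 0 :: int) = int d"
      "(\<Sum>i<n + p. if i < c' then 1 else 0 :: int) = int c'"
      by (simp_all add: sum.If_cases)
    have "b * c' < a * d" using mult_le_mono2[OF \<open>c' \<le> c\<close>, of b] lt by linarith
    then have "int b * int c' < int a * int d" by (metis of_nat_less_iff of_nat_mult)
    then show "int b * (\<Sum>i<n + p. if i < c' then 1 else 0) < int a * (\<Sum>j<n. if j < d then 1 else 0)"
      unfolding sums .
  next
    fix i j assume ij: "i < n + p" "j < n" "(G1 * K * H0) $$ (i, j) \<noteq> 0"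
    then show "(if j < d then 1 else 0) \<le> (if i < c' then 1 else 0 :: int)"
      using block[OF cS(1) X KU, of i j] by (cases "j < d"; cases "i < c'") auto
  next
    fix i j assume ij: "i < n + p" "j < n" "(G1 * L * H0) $$ (i, j) \<noteq> 0"
    then show "(if j < d then 1 else 0) \<le> (if i < c' then 1 else 0 :: int)"
      using block[OF cS(2) Y LU, of i j] by (cases "j < d"; cases "i < c'") auto
  qed auto
  then have "f (lomadze_act n p (G0, G1) (K, L, M)) = 0" using inv by simp
  from semi_invariant_act_zero[OF f S g this] show ?thesis .
qed

text \<open>
  Dually, the rows of \<open>\<Phi>\<close> are functionals that kill \<open>M\<close> and whose compositions with \<open>K\<close> and \<open>L\<close> lie in
  the row span of \<open>\<Psi>\<close>. Here the quotient gets weight \<open>-1\<close>; the entries of \<open>M\<close> in the negative rows vanish.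
\<close>

lemma destabilizing_quotient:
  fixes f :: "'k::field_char_0 lomadze \<Rightarrow> 'k"
  assumes f: "semi_invariant n m p (- int a, int b) N f" and "N \<ge> 1"
    and S: "(K, L, M) \<in> lomadze_systems n m p"
    and \<Phi>: "\<Phi> \<in> carrier_mat c1 (n + p)" "surjective_mat \<Phi>"
    and \<Psi>: "\<Psi> \<in> carrier_mat c0 n"
    and X: "X \<in> carrier_mat c1 c0" and Y: "Y \<in> carrier_mat c1 c0"
    and \<Phi>K: "\<Phi> * K = X * \<Psi>" and \<Phi>L: "\<Phi> * L = Y * \<Psi>" and \<Phi>M: "\<Phi> * M = 0\<^sub>m c1 (p + m)"
    and lt: "a * c0 < b * c1"
  shows "f (K, L, M) = 0"
proof -
  have cS: "K \<in> carrier_mat (n + p) n" "L \<in> carrier_mat (n + p) n" "M \<in> carrier_mat (n + p) (p + m)"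
    using S unfolding lomadze_systems_iff by auto
  obtain c' C' Z where C': "C' \<in> carrier_mat n c'" "injective_mat C'" and
    Z: "Z \<in> carrier_mat c' c0" "surjective_mat Z" and CZ: "\<Psi>\<^sup>T = C' * Z"
    using rank_factorization[of "\<Psi>\<^sup>T" n c0] \<Psi> by (metis transpose_carrier_mat)
  have "c' \<le> c0" using surjective_mat_dim[OF Z(2,1)] .
  have \<Psi>Z: "\<Psi> = Z\<^sup>T * C'\<^sup>T"
    using CZ transpose_mult[OF C'(1) Z(1)] by (metis transpose_transpose)
  obtain G0 where G0: "c' \<le> n" "G0 \<in> carrier_mat n n" "det G0 \<noteq> 0"
    "G0 * C' = mat n c' (\<lambda>(i, j). if i = j then 1 else 0)"
    using adapted_basis[OF C'] by metis
  define h0 where "h0 = G0\<^sup>T"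
  have h0: "h0 \<in> carrier_mat n n" "det h0 \<noteq> 0"
    unfolding h0_def using G0 det_transpose[OF G0(2)] by auto
  have Ch0: "C'\<^sup>T * h0 = mat c' n (\<lambda>(i, j). if i = j then 1 else 0)"
  proof -
    have "C'\<^sup>T * h0 = (G0 * C')\<^sup>T" unfolding h0_def using transpose_mult[OF G0(2) C'(1)] by simp
    also have "\<dots> = mat c' n (\<lambda>(i, j). if i = j then 1 else 0)"
      unfolding G0(4) by (intro eq_matI) auto
    finally show ?thesis .
  qed
  obtain g0 where g0: "g0 \<in> carrier_mat n n" "h0 * g0 = 1\<^sub>m n" "det g0 \<noteq> 0"
    using invertible_mat_inverse[OF h0] by metis
  have "injective_mat \<Phi>\<^sup>T" using surjective_mat_transpose[OF \<Phi>(1)] \<Phi>(2) by simp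
  then obtain H1 where H1: "c1 \<le> n + p" "H1 \<in> carrier_mat (n + p) (n + p)" "det H1 \<noteq> 0"
    "\<And>j. j < c1 \<Longrightarrow> col H1 j = col \<Phi>\<^sup>T j"
    using adapted_basis[of "\<Phi>\<^sup>T" "n + p" c1] \<Phi>(1) by (metis transpose_carrier_mat)
  define g1 where "g1 = H1\<^sup>T"
  have g1: "g1 \<in> carrier_mat (n + p) (n + p)" "det g1 \<noteq> 0"
    unfolding g1_def using H1 det_transpose[OF H1(2)] by auto
  have rg1: "row g1 i = row \<Phi> i" if "i < c1" for i
    using H1(4)[OF that] that H1(1,2) \<Phi>(1) unfolding g1_def by simp
  have g: "g0 \<in> carrier (GL n)" "g1 \<in> carrier (GL (n + p))"
    using g0 g1 by (auto simp: carrier_GL)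
  have inv: "inv\<^bsub>GL n\<^esub> g0 = h0" using GL_inv_eqI[OF g(1) h0(1) g0(2)] .
  have rows: "row (g1 * A) i = row (\<Phi> * A) i" if "A \<in> carrier_mat (n + p) k" "i < c1" for A k i
    using that g1(1) \<Phi>(1) H1(1) rg1[OF that(2)] by (intro eq_vecI) auto
  have block: "(g1 * A * h0) $$ (i, j) = 0"
    if A: "A \<in> carrier_mat (n + p) n" and X: "X \<in> carrier_mat c1 c0" and A\<Phi>: "\<Phi> * A = X * \<Psi>"
      and ij: "i < c1" "c' \<le> j" "j < n" for A X i j
  proof -
    have "(g1 * A * h0) $$ (i, j) = row (\<Phi> * A) i \<bullet> col h0 j"
      unfolding rows[OF A ij(1), symmetric]
      using ij H1(1) g1(1) h0(1) A by (intro index_mult_mat(1)) auto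
    also have "\<dots> = (\<Phi> * A * h0) $$ (i, j)"
      using ij \<Phi>(1) h0(1) A by (intro index_mult_mat(1)[symmetric]) auto
    also have "\<Phi> * A * h0 = (X * Z\<^sup>T) * (C'\<^sup>T * h0)"
    proof -
      have "\<Phi> * A = (X * Z\<^sup>T) * C'\<^sup>T"
        unfolding A\<Phi> \<Psi>Z using X Z C' by (intro assoc_mult_mat[symmetric]) auto
      then have "\<Phi> * A * h0 = (X * Z\<^sup>T) * C'\<^sup>T * h0" by (rule arg_cong)
      also have "\<dots> = (X * Z\<^sup>T) * (C'\<^sup>T * h0)"
        using X Z C' h0 by (intro assoc_mult_mat) auto
      finally show ?thesis .
    qed
    also have "\<dots> $$ (i, j) = (\<Sum>k<c'. (X * Z\<^sup>T) $$ (i, k) * (C'\<^sup>T * h0) $$ (k, j))"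
      using ij X Z C' h0 by (intro mult_mat_entry) auto
    also have "\<dots> = 0" unfolding Ch0 using ij by (intro sum.neutral) auto
    finally show ?thesis .
  qed
  have "f (g1 * K * h0, g1 * L * h0, g1 * M) = 0"
  proof (rule one_parameter_subgroup_vanishing[OF f \<open>N \<ge> 1\<close>, where
        \<alpha> = "\<lambda>j. if j < c' then -1 else 0" and \<beta> = "\<lambda>i. if i < c1 then -1 else 0"])
    show "(g1 * K * h0, g1 * L * h0, g1 * M) \<in> lomadze_systems n m p"
      unfolding lomadze_systems_iff using h0 g1 cS by auto
    have "{..<n} \<inter> {j. j < c'} = {..<c'}" "{..<n + p} \<inter> {i. i < c1} = {..<c1}"
      using G0(1) H1(1) by auto
    then have sums: "(\<Sum>j<n. if j < c' then -1 else 0 :: int) = - int c'"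
      "(\<Sum>i<n + p. if i < c1 then -1 else 0 :: int) = - int c1"
      by (simp_all add: sum.If_cases)
    have "a * c' < b * c1" using mult_le_mono2[OF \<open>c' \<le> c0\<close>, of a] lt by linarith
    then have "int a * int c' < int b * int c1" by (metis of_nat_less_iff of_nat_mult)
    then show "int b * (\<Sum>i<n + p. if i < c1 then -1 else 0) < int a * (\<Sum>j<n. if j < c' then -1 else 0)"
      unfolding sums by simp
  next
    fix i j assume ij: "i < n + p" "j < n" "(g1 * K * h0) $$ (i, j) \<noteq> 0"
    then show "(if j < c' then -1 else 0) \<le> (if i < c1 then -1 else 0 :: int)"
      using block[OF cS(1) X \<Phi>K, of i j] by (cases "j < c'"; cases "i < c1") auto
  next
    fix i j assume ij: "i < n + p" "j < n" "(g1 * L * h0) $$ (i, j) \<noteq> 0"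
    then show "(if j < c' then -1 else 0) \<le> (if i < c1 then -1 else 0 :: int)"
      using block[OF cS(2) Y \<Phi>L, of i j] by (cases "j < c'"; cases "i < c1") auto
  next
    fix i j assume ij: "i < n + p" "j < p + m" "(g1 * M) $$ (i, j) \<noteq> 0"
    have "\<not> i < c1"
    proof
      assume "i < c1"
      then have "row (g1 * M) i = row (0\<^sub>m c1 (p + m)) i" using rows[OF cS(3)] \<Phi>M by simp
      then have "(g1 * M) $$ (i, j) = 0"
        using ij(1,2) g1(1) cS(3) \<open>i < c1\<close>
        by (metis carrier_matD index_mult_mat(2,3) index_row(1) index_zero_mat)
      with ij(3) show False by simp
    qed
    then show "0 \<le> (if i < c1 then -1 else 0 :: int)" by simp
  qed
  then have "f (lomadze_act n p (g0, g1) (K, L, M)) = 0" using inv by simp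
  from semi_invariant_act_zero[OF f S g this] show ?thesis .
qed

section \<open>Singular pencils\<close>

text \<open>
  Too many vectors are dependent; the first one that depends on its predecessors is a combination of an
  independent family, and this combination is nontrivial because the vector is not zero.
\<close>

lemma dependent_prefix:
  fixes u :: "nat \<Rightarrow> 'a::field vec"
  assumes u: "\<And>j. j \<le> c \<Longrightarrow> u j \<in> carrier_vec c" "\<And>j. j \<le> c \<Longrightarrow> u j \<noteq> 0\<^sub>v c"
  obtains d w where "d \<le> c" "injective_mat (mat c d (\<lambda>(i, j). u j $ i))" "w \<in> carrier_vec d"
    "w \<noteq> 0\<^sub>v d" "mat c d (\<lambda>(i, j). u j $ i) *\<^sub>v w = u d"
proof -
  define U where "U d = mat c d (\<lambda>(i, j). u j $ i)" for d
  have U: "U d \<in> carrier_mat c d" for d unfolding U_def by simp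
  have "\<not> injective_mat (U (Suc c))" using injective_mat_dim[OF _ U, of "Suc c"] by auto
  moreover have "injective_mat (U 0)" using injective_mat_iff_kernel[OF U] by auto
  ultimately obtain d where d: "d < Suc c" "injective_mat (U d)" "\<not> injective_mat (U (Suc d))"
    using ex_least_nat_less[of "\<lambda>d. \<not> injective_mat (U d)" "Suc c"] by auto
  obtain z where z: "z \<in> carrier_vec (Suc d)" "z \<noteq> 0\<^sub>v (Suc d)" "U (Suc d) *\<^sub>v z = 0\<^sub>v c"
    using injective_mat_iff_kernel[OF U] d(3) by blast
  define w where "w = vec d (\<lambda>j. - z $ j / z $ d)"
  have rel: "(\<Sum>j<d. u j $ i * z $ j) + u d $ i * z $ d = 0" if "i < c" for i
  proof -
    have "(U (Suc d) *\<^sub>v z) $ i = 0" using z that by simp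
    then show ?thesis using that z(1) by (simp add: U_def scalar_prod_def atLeast0LessThan)
  qed
  have zd: "z $ d \<noteq> 0"
  proof
    assume 0: "z $ d = 0"
    define z' where "z' = vec d (\<lambda>j. z $ j)"
    have "U d *\<^sub>v z' = 0\<^sub>v c"
      using rel 0 by (intro eq_vecI) (auto simp: U_def z'_def scalar_prod_def atLeast0LessThan)
    then have "z' = 0\<^sub>v d" using injective_matD[OF d(2) U] unfolding z'_def by simp
    then have "z $ j = 0" if "j < d" for j using that unfolding z'_def by (metis index_vec index_zero_vec(1))
    then have "z = 0\<^sub>v (Suc d)" using 0 z(1) by (intro eq_vecI) (auto simp: less_Suc_eq)
    with z(2) show False by simp
  qed
  have Uw: "U d *\<^sub>v w = u d"
  proof (rule eq_vecI)
    fix i assume "i < dim_vec (u d)"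
    then have i: "i < c" using u(1)[of d] d(1) by simp
    have "(U d *\<^sub>v w) $ i = (\<Sum>j<d. u j $ i * (- z $ j / z $ d))"
      using i by (simp add: U_def w_def scalar_prod_def atLeast0LessThan)
    also have "\<dots> = - (\<Sum>j<d. u j $ i * z $ j) / z $ d"
      by (simp add: sum_divide_distrib sum_negf)
    also have "(\<Sum>j<d. u j $ i * z $ j) = - (u d $ i * z $ d)"
      using rel[OF i] by (simp add: eq_neg_iff_add_eq_0)
    also have "- (- (u d $ i * z $ d)) / z $ d = u d $ i" using zd by simp
    finally show "(U d *\<^sub>v w) $ i = u d $ i" .
  qed (use u(1)[of d] d(1) in \<open>auto simp: U_def\<close>)
  have w: "w \<in> carrier_vec d" unfolding w_def by simp
  have "w \<noteq> 0\<^sub>v d"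
  proof
    assume "w = 0\<^sub>v d"
    then have "u d = 0\<^sub>v c" using Uw U by (metis mult_mat_vec_0)
    then show False using u(2)[of d] d(1) by simp
  qed
  with that[of d w] d w Uw show ?thesis unfolding U_def by simp
qed

text \<open>
  Let \<open>U\<close> have the independent kernel vectors \<open>u_j\<close> as columns. On them \<open>K\<close> acts as \<open>-L\<close> times a diagonal
  matrix with distinct entries. Applying \<open>K + d L\<close> to the dependent vector \<open>u_d\<close> gives a second relation
  between the vectors \<open>L u_j\<close>, nontrivial since \<open>d \<noteq> j\<close>. So \<open>K\<close> and \<open>L\<close> map the span of \<open>U\<close> into a space of
  smaller dimension.
\<close>

lemma singular_pencil_subspace:
  fixes K L :: "'a::field_char_0 mat"
  assumes K: "K \<in> carrier_mat r c" and L: "L \<in> carrier_mat r c"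
    and u: "\<And>j. j \<le> c \<Longrightarrow> u j \<in> carrier_vec c" "\<And>j. j \<le> c \<Longrightarrow> u j \<noteq> 0\<^sub>v c"
    and ker: "\<And>j. j \<le> c \<Longrightarrow> pencil K L 1 (of_nat j) *\<^sub>v u j = 0\<^sub>v r"
  obtains d U D where "d \<le> c" "U = mat c d (\<lambda>(i, j). u j $ i)" "injective_mat U" "D \<in> carrier_mat d d"
    "K * U = L * U * D" "\<not> injective_mat (L * U)"
proof -
  obtain d w where d: "d \<le> c" and inj: "injective_mat (mat c d (\<lambda>(i, j). u j $ i))"
    and w: "w \<in> carrier_vec d" "w \<noteq> 0\<^sub>v d" "mat c d (\<lambda>(i, j). u j $ i) *\<^sub>v w = u d"
    using dependent_prefix[of c u] u by metis
  define U where "U = mat c d (\<lambda>(i, j). u j $ i)"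
  have U: "U \<in> carrier_mat c d" unfolding U_def by simp
  \<comment> \<open>Since \<open>K u_j = - j L u_j\<close>.\<close>
  define D where "D = mat_diag d (\<lambda>j. - of_nat j :: 'a)"
  have D: "D \<in> carrier_mat d d" unfolding D_def by simp
  have Kv: "K *\<^sub>v v = - t \<cdot>\<^sub>v (L *\<^sub>v v)" if "v \<in> carrier_vec c" "pencil K L 1 t *\<^sub>v v = 0\<^sub>v r" for v t
  proof (rule eq_vecI)
    fix i assume "i < dim_vec (- t \<cdot>\<^sub>v (L *\<^sub>v v))"
    then have i: "i < r" using L by simp
    have "(1 \<cdot>\<^sub>v (K *\<^sub>v v) + t \<cdot>\<^sub>v (L *\<^sub>v v)) $ i = 0"
      using that(2) i unfolding pencil_mult_vec[OF K L that(1)] by simp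
    then show "(K *\<^sub>v v) $ i = (- t \<cdot>\<^sub>v (L *\<^sub>v v)) $ i"
      using i K L by (simp add: eq_neg_iff_add_eq_0)
  qed (use K L in auto)
  have colU: "col U j = u j" if "j < d" for j
    using that u(1)[of j] d unfolding U_def by (intro eq_vecI) auto
  have LU: "L * U \<in> carrier_mat r d" using L U by simp
  have KU: "K * U = L * U * D"
  proof (rule eq_matI)
    fix i j assume "i < dim_row (L * U * D)" "j < dim_col (L * U * D)"
    then have ij: "i < r" "j < d" using L D by auto
    have "(K * U) $$ (i, j) = (K *\<^sub>v u j) $ i"
      using ij K U colU by simp
    also have "\<dots> = - of_nat j * (L *\<^sub>v u j) $ i"
      using Kv[OF u(1) ker, of j] ij d L by simp
    also have "\<dots> = (L * U * D) $$ (i, j)"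
      unfolding D_def mat_diag_mult_right[OF LU] using ij L U colU by simp
    finally show "(K * U) $$ (i, j) = (L * U * D) $$ (i, j)" .
  qed (use K L U D in auto)
  have "\<not> injective_mat (L * U)"
  proof
    assume inj': "injective_mat (L * U)"
    \<comment> \<open>The coefficients of \<open>(K + d L) u_d = 0\<close> in terms of the vectors \<open>L u_j\<close>.\<close>
    define w' where "w' = D *\<^sub>v w + of_nat d \<cdot>\<^sub>v w"
    have w': "w' \<in> carrier_vec d" unfolding w'_def using D w by auto
    have Uw: "U *\<^sub>v w = u d" using w(3) unfolding U_def .
    have "(L * U) *\<^sub>v w' = (L * U) *\<^sub>v (D *\<^sub>v w) + (L * U) *\<^sub>v (of_nat d \<cdot>\<^sub>v w)"
      unfolding w'_def using LU D w by (intro mult_add_distrib_mat_vec) auto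
    also have "(L * U) *\<^sub>v (D *\<^sub>v w) = (K * U) *\<^sub>v w"
      unfolding KU using LU D w by (intro assoc_mult_mat_vec[symmetric]) auto
    also have "\<dots> = K *\<^sub>v u d" using K U w Uw by (simp add: assoc_mult_mat_vec[OF K U w(1)])
    also have "(L * U) *\<^sub>v (of_nat d \<cdot>\<^sub>v w) = of_nat d \<cdot>\<^sub>v (L *\<^sub>v u d)"
      using mult_mat_vec[OF LU w(1)] assoc_mult_mat_vec[OF L U w(1)] Uw by simp
    also have "K *\<^sub>v u d + of_nat d \<cdot>\<^sub>v (L *\<^sub>v u d) = 0\<^sub>v r"
      using Kv[OF u(1) ker, of d] d L by (intro eq_vecI) auto
    finally have "w' = 0\<^sub>v d" using injective_matD[OF inj' LU w'] by simp
    moreover have "w' $ j = (of_nat d - of_nat j) * w $ j" if j: "j < d" for j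
    proof -
      have "(D *\<^sub>v w) $ j = (\<Sum>k<d. (if j = k then - of_nat k else 0) * w $ k)"
        using j w(1) by (simp add: D_def mat_diag_def scalar_prod_def atLeast0LessThan)
      also have "\<dots> = (\<Sum>k<d. if k = j then - of_nat j * w $ j else 0)"
        by (intro sum.cong) auto
      also have "\<dots> = - of_nat j * w $ j" using j by simp
      finally show ?thesis unfolding w'_def using j w(1) by (simp add: algebra_simps)
    qed
    ultimately have "(of_nat d - of_nat j) * w $ j = 0" if "j < d" for j
      using that by (metis index_zero_vec(1))
    then have "w $ j = 0" if "j < d" for j using that by fastforce
    then have "w = 0\<^sub>v d" using w(1) by (intro eq_vecI) auto
    with w(2) show False by simp
  qed
  with that[of d U D] d inj D KU show ?thesis unfolding U_def by blast
qed

section \<open>Semistable systems are controllable or observable\<close>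

lemma surjective_hconcat_iff:
  assumes A: "A \<in> carrier_mat r c" and B: "B \<in> carrier_mat r q"
  shows "surjective_mat (hconcat A B) \<longleftrightarrow> (\<forall>\<phi> \<in> carrier_vec r.
    A\<^sup>T *\<^sub>v \<phi> = 0\<^sub>v c \<and> B\<^sup>T *\<^sub>v \<phi> = 0\<^sub>v q \<longrightarrow> \<phi> = 0\<^sub>v r)"
proof -
  have "(hconcat A B)\<^sup>T *\<^sub>v \<phi> = 0\<^sub>v (c + q) \<longleftrightarrow> A\<^sup>T *\<^sub>v \<phi> = 0\<^sub>v c \<and> B\<^sup>T *\<^sub>v \<phi> = 0\<^sub>v q"
    if "\<phi> \<in> carrier_vec r" for \<phi>
  proof -
    have "A\<^sup>T *\<^sub>v \<phi> \<in> carrier_vec c" "B\<^sup>T *\<^sub>v \<phi> \<in> carrier_vec q"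
      using A B that by (metis mult_mat_vec_carrier transpose_carrier_mat)+
    then show ?thesis
      unfolding transpose_hconcat_mult_vec[OF A B that] by (rule append_vec_eq_0)
  qed
  then show ?thesis
    unfolding surjective_mat_iff_cokernel[OF hconcat_carrier[OF A B]] by auto
qed

lemma controllable_iff:
  assumes "(K, L, M) \<in> lomadze_systems n m p"
  shows "controllable n p (K, L, M) \<longleftrightarrow> (\<exists>s t. injective_mat (pencil K L s t)) \<and>
    (\<forall>s t. (s, t) \<noteq> (0, 0) \<longrightarrow> surjective_mat (hconcat (pencil K L s t) M))"
proof -
  note c = lomadze_systemsD[OF assms]
  note P = pencil_carrier[OF c(1,2)]
  have "dim_row (pencil K L s t) = n + p" "dim_row (hconcat (pencil K L s t) M) = n + p" for s t
    using c by auto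
  then show ?thesis
    using rank_eq_cols_iff_injective[OF P] rank_eq_rows_iff_surjective[OF hconcat_carrier[OF P c(3)]]
    by simp
qed

lemma observable_iff:
  assumes "(K, L, M) \<in> lomadze_systems n m p"
  shows "observable n p (K, L, M) \<longleftrightarrow>
    (\<forall>s t. (s, t) \<noteq> (0, 0) \<longrightarrow> injective_mat (pencil K L s t)) \<and>
    (\<exists>s t. surjective_mat (hconcat (pencil K L s t) M))"
proof -
  note c = lomadze_systemsD[OF assms]
  note P = pencil_carrier[OF c(1,2)]
  have "dim_row (pencil K L s t) = n + p" "dim_row (hconcat (pencil K L s t) M) = n + p" for s t
    using c by auto
  then show ?thesis
    using rank_eq_cols_iff_injective[OF P] rank_eq_rows_iff_surjective[OF hconcat_carrier[OF P c(3)]]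
    by simp
qed

definition col_mat :: "'a vec \<Rightarrow> 'a mat" where
  "col_mat v = mat (dim_vec v) 1 (\<lambda>(i, _). v $ i)"

lemma col_mat_carrier: "v \<in> carrier_vec n \<Longrightarrow> col_mat v \<in> carrier_mat n 1"
  unfolding col_mat_def by auto

lemma mult_col_mat:
  assumes "A \<in> carrier_mat r c" "v \<in> carrier_vec c"
  shows "A * col_mat v = col_mat (A *\<^sub>v v)"
proof (rule eq_matI)
  fix i j assume "i < dim_row (col_mat (A *\<^sub>v v))" "j < dim_col (col_mat (A *\<^sub>v v))"
  then have ij: "i < r" "j = 0" using assms by (auto simp: col_mat_def)
  have "col (col_mat v) 0 = v" unfolding col_mat_def by (intro eq_vecI) auto
  then show "(A * col_mat v) $$ (i, j) = col_mat (A *\<^sub>v v) $$ (i, j)"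
    using ij assms by (simp add: col_mat_def)
qed (use assms in \<open>auto simp: col_mat_def\<close>)

lemma injective_col_mat:
  fixes v :: "'a::field vec"
  assumes v: "v \<in> carrier_vec n" "v \<noteq> 0\<^sub>v n"
  shows "injective_mat (col_mat v)"
  unfolding injective_mat_iff_kernel[OF col_mat_carrier[OF v(1)]]
proof (intro ballI impI)
  fix x :: "'a vec" assume x: "x \<in> carrier_vec 1" "col_mat v *\<^sub>v x = 0\<^sub>v n"
  obtain i where i: "i < n" "v $ i \<noteq> 0" using v by (auto simp: vec_eq_iff)
  have "(col_mat v *\<^sub>v x) $ i = 0" unfolding x(2) using i by simp
  then have "v $ i * x $ 0 = 0"
    using i v x by (simp add: scalar_prod_def col_mat_def)
  then have "x $ 0 = 0" using i by simp
  then show "x = 0\<^sub>v 1" using x(1) by (intro eq_vecI) auto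
qed

lemma col_mat_smult: "col_mat (c \<cdot>\<^sub>v v) = c \<cdot>\<^sub>m col_mat v"
  unfolding col_mat_def by (intro eq_matI) auto

text \<open>
  A zero of a pencil at a vector makes the two images of the vector proportional.
\<close>

lemma proportional_images:
  fixes A B :: "'a::field mat"
  assumes A: "A \<in> carrier_mat r c" and B: "B \<in> carrier_mat r c" and v: "v \<in> carrier_vec c"
    and st: "(s, t) \<noteq> (0, 0)" and ker: "pencil A B s t *\<^sub>v v = 0\<^sub>v r"
  obtains u x y where "u \<in> carrier_vec r" "A *\<^sub>v v = x \<cdot>\<^sub>v u" "B *\<^sub>v v = y \<cdot>\<^sub>v u"
proof -
  have rel: "s * (A *\<^sub>v v) $ i + t * (B *\<^sub>v v) $ i = 0" if "i < r" for i
  proof -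
    have "(s \<cdot>\<^sub>v (A *\<^sub>v v) + t \<cdot>\<^sub>v (B *\<^sub>v v)) $ i = 0"
      unfolding pencil_mult_vec[OF A B v, symmetric] ker using that by simp
    then show ?thesis using that A B v by (simp del: index_mult_mat_vec)
  qed
  have Av: "A *\<^sub>v v \<in> carrier_vec r" and Bv: "B *\<^sub>v v \<in> carrier_vec r" using A B v by auto
  show ?thesis
  proof (cases "s = 0")
    case True
    then have "t \<noteq> 0" using st by simp
    have "B *\<^sub>v v = 0 \<cdot>\<^sub>v (A *\<^sub>v v)"
    proof (rule eq_vecI)
      fix i assume "i < dim_vec (0 \<cdot>\<^sub>v (A *\<^sub>v v))"
      then have "i < r" using A by simp
      with rel[OF this] True \<open>t \<noteq> 0\<close> A B
      show "(B *\<^sub>v v) $ i = (0 \<cdot>\<^sub>v (A *\<^sub>v v)) $ i" by (simp del: index_mult_mat_vec)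
    qed (use A B in auto)
    with that[of "A *\<^sub>v v" 1 0] Av show ?thesis by simp
  next
    case False
    have "A *\<^sub>v v = (- t / s) \<cdot>\<^sub>v (B *\<^sub>v v)"
    proof (rule eq_vecI)
      fix i assume "i < dim_vec ((- t / s) \<cdot>\<^sub>v (B *\<^sub>v v))"
      then have i: "i < r" using B by simp
      have "(A *\<^sub>v v) $ i = - t / s * (B *\<^sub>v v) $ i"
        using rel[OF i] False by (simp add: field_simps eq_neg_iff_add_eq_0 del: index_mult_mat_vec)
      then show "(A *\<^sub>v v) $ i = ((- t / s) \<cdot>\<^sub>v (B *\<^sub>v v)) $ i"
        using i A B by (simp del: index_mult_mat_vec)
    qed (use A B in auto)
    with that[of "B *\<^sub>v v" "- t / s" 1] Bv show ?thesis by simp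
  qed
qed

lemma smult_eq_mult_single:
  fixes A :: "'a::comm_ring_1 mat"
  assumes "A \<in> carrier_mat r 1"
  shows "c \<cdot>\<^sub>m A = A * mat 1 1 (\<lambda>_. c)"
  using assms by (intro eq_matI) (auto simp: scalar_prod_def)

text \<open>
  If the pencil were nowhere injective, \<open>singular_pencil_subspace\<close> would give a subsystem of dimensions
  \<open>(d, k)\<close> with \<open>k < d \<le> n\<close>, which destabilizes since \<open>a/b > (n - 1)/n\<close>. A functional that violates surjectivity
  at a point gives a quotient of dimensions at most \<open>(1, 1)\<close>, which destabilizes since \<open>a < b\<close>.
\<close>

lemma semistable_imp_controllable:
  fixes f :: "'k::field_char_0 lomadze \<Rightarrow> 'k"
  assumes f: "semi_invariant n m p (- int a, int b) N f" and "N \<ge> 1"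
    and S: "S \<in> lomadze_systems n m p" and "f S \<noteq> 0"
    and "a < b" and slope: "b * n < a * n + b"
  shows "controllable n p S"
proof -
  obtain K L M where SS: "S = (K, L, M)" by (cases S)
  note S' = S[unfolded SS]
  note c = lomadze_systemsD[OF S']
  have f0: "f (K, L, M) \<noteq> 0" using \<open>f S \<noteq> 0\<close> SS by simp
  note P = pencil_carrier[OF c(1,2)]
  have "\<exists>s t. injective_mat (pencil K L s t)"
  proof (rule ccontr)
    assume "\<not> ?thesis"
    then have "\<exists>v \<in> carrier_vec n. pencil K L 1 (of_nat j) *\<^sub>v v = 0\<^sub>v (n + p) \<and> v \<noteq> 0\<^sub>v n" for j
      using injective_mat_iff_kernel[OF P] by blast
    then obtain u where u: "\<And>j. u j \<in> carrier_vec n" "\<And>j. u j \<noteq> 0\<^sub>v n"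
      "\<And>j. pencil K L 1 (of_nat j) *\<^sub>v u j = 0\<^sub>v (n + p)" by metis
    obtain d U D where U: "d \<le> n" "U = mat n d (\<lambda>(i, j). u j $ i)" "injective_mat U" and
      D: "D \<in> carrier_mat d d" and KU: "K * U = L * U * D" and LU: "\<not> injective_mat (L * U)"
      using singular_pencil_subspace[OF c(1,2) u] by metis
    have cU: "U \<in> carrier_mat n d" using U(2) by simp
    have cLU: "L * U \<in> carrier_mat (n + p) d" using c cU by simp
    obtain k C Y where C: "C \<in> carrier_mat (n + p) k" and Y: "Y \<in> carrier_mat k d"
      and CY: "L * U = C * Y" and "k < d"
      using rank_factorization[OF cLU] LU by metis
    have YD: "Y * D \<in> carrier_mat k d" using Y D by simp
    have KCY: "K * U = C * (Y * D)" unfolding KU CY using C Y D by simp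
    have lt: "b * k < a * d"
    proof -
      have "(b - a) * d \<le> (b - a) * n" using U(1) by simp
      then have "b * d - a * d \<le> b * n - a * n" by (simp add: diff_mult_distrib)
      moreover have "a * d \<le> b * d" "a * n \<le> b * n" using \<open>a < b\<close> by auto
      ultimately have "b * d < a * d + b" using slope by linarith
      moreover have "b * Suc k \<le> b * d" using \<open>k < d\<close> by (intro mult_le_mono2) simp
      ultimately show ?thesis by simp
    qed
    show False
      using destabilizing_subsystem[OF f \<open>N \<ge> 1\<close> S' cU U(3) C YD Y KCY CY lt] f0 by simp
  qed
  moreover have "surjective_mat (hconcat (pencil K L s t) M)" if st: "(s, t) \<noteq> (0, 0)" for s t
  proof (rule ccontr)
    assume "\<not> ?thesis"
    then obtain \<phi> where \<phi>: "\<phi> \<in> carrier_vec (n + p)" "\<phi> \<noteq> 0\<^sub>v (n + p)"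
      "(pencil K L s t)\<^sup>T *\<^sub>v \<phi> = 0\<^sub>v n" "M\<^sup>T *\<^sub>v \<phi> = 0\<^sub>v (p + m)"
      unfolding surjective_hconcat_iff[OF P c(3)] by blast
    have ct: "K\<^sup>T \<in> carrier_mat n (n + p)" "L\<^sup>T \<in> carrier_mat n (n + p)" "M\<^sup>T \<in> carrier_mat (p + m) (n + p)"
      using c by auto
    obtain u x y where u: "u \<in> carrier_vec n" "K\<^sup>T *\<^sub>v \<phi> = x \<cdot>\<^sub>v u" "L\<^sup>T *\<^sub>v \<phi> = y \<cdot>\<^sub>v u"
      using proportional_images[OF ct(1,2) \<phi>(1) st] \<phi>(3) pencil_transpose[OF c(1,2)] by metis
    define \<Phi> \<Psi> where "\<Phi> = (col_mat \<phi>)\<^sup>T" and "\<Psi> = (col_mat u)\<^sup>T"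
    have c\<Phi>: "\<Phi> \<in> carrier_mat 1 (n + p)" "\<Psi> \<in> carrier_mat 1 n"
      unfolding \<Phi>_def \<Psi>_def using col_mat_carrier \<phi>(1) u(1) by auto
    have surj: "surjective_mat \<Phi>"
      using surjective_mat_transpose[OF c\<Phi>(1)] injective_col_mat[OF \<phi>(1,2)] unfolding \<Phi>_def by simp
    have tr: "\<Phi> * A = mat 1 1 (\<lambda>_. z) * \<Psi>"
      if A: "A \<in> carrier_mat (n + p) n" and e: "A\<^sup>T *\<^sub>v \<phi> = z \<cdot>\<^sub>v u" for A z
    proof -
      have "(\<Phi> * A)\<^sup>T = A\<^sup>T * col_mat \<phi>"
        using transpose_mult[OF c\<Phi>(1) A] unfolding \<Phi>_def by simp
      also have "\<dots> = z \<cdot>\<^sub>m col_mat u"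
        using mult_col_mat[of "A\<^sup>T" n "n + p" \<phi>] A \<phi>(1) e col_mat_smult by simp
      also have "\<dots> = (mat 1 1 (\<lambda>_. z) * \<Psi>)\<^sup>T"
      proof -
        have "(mat 1 1 (\<lambda>_. z) * \<Psi>)\<^sup>T = \<Psi>\<^sup>T * (mat 1 1 (\<lambda>_. z))\<^sup>T"
          by (rule transpose_mult[OF mat_carrier c\<Phi>(2)])
        also have "(mat 1 1 (\<lambda>_. z))\<^sup>T = mat 1 1 (\<lambda>_. z)" by (intro eq_matI) auto
        also have "\<Psi>\<^sup>T = col_mat u" unfolding \<Psi>_def by simp
        finally show ?thesis unfolding smult_eq_mult_single[OF col_mat_carrier[OF u(1)]] by simp
      qed
      finally show ?thesis by (metis transpose_transpose)
    qed
    have "\<Phi> * M = 0\<^sub>m 1 (p + m)"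
    proof -
      have "(\<Phi> * M)\<^sup>T = col_mat (0\<^sub>v (p + m))"
        using transpose_mult[OF c\<Phi>(1) c(3)] mult_col_mat[OF ct(3) \<phi>(1)] \<phi>(4)
        unfolding \<Phi>_def by simp
      also have "\<dots> = (0\<^sub>m 1 (p + m))\<^sup>T" unfolding col_mat_def by (intro eq_matI) auto
      finally show ?thesis by (metis transpose_transpose)
    qed
    then show False
      using destabilizing_quotient[OF f \<open>N \<ge> 1\<close> S' c\<Phi>(1) surj c\<Phi>(2) _ _ tr[OF c(1) u(2)] tr[OF c(2) u(3)]]
        \<open>a < b\<close> f0 by simp
  qed
  ultimately show ?thesis unfolding SS controllable_iff[OF S'] by blast
qed

text \<open>
  Now a kernel vector at a point gives a subsystem of dimensions at most \<open>(1, 1)\<close>, which destabilizes since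
  \<open>b < a\<close>. Failure of surjectivity everywhere is treated by \<open>singular_pencil_subspace\<close> for the transposed
  pencil; the quotient has dimensions \<open>(k, d)\<close> with \<open>k < d\<close> and \<open>k \<le> n\<close>, and \<open>a/b < (n + 1)/n\<close> suffices.
\<close>

lemma semistable_imp_observable:
  fixes f :: "'k::field_char_0 lomadze \<Rightarrow> 'k"
  assumes f: "semi_invariant n m p (- int a, int b) N f" and "N \<ge> 1"
    and S: "S \<in> lomadze_systems n m p" and "f S \<noteq> 0"
    and "b < a" and slope: "a * n < b * n + b"
  shows "observable n p S"
proof -
  obtain K L M where SS: "S = (K, L, M)" by (cases S)
  note S' = S[unfolded SS]
  note c = lomadze_systemsD[OF S']
  have f0: "f (K, L, M) \<noteq> 0" using \<open>f S \<noteq> 0\<close> SS by simp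
  note P = pencil_carrier[OF c(1,2)]
  have ct: "K\<^sup>T \<in> carrier_mat n (n + p)" "L\<^sup>T \<in> carrier_mat n (n + p)" "M\<^sup>T \<in> carrier_mat (p + m) (n + p)"
    using c by auto
  have "injective_mat (pencil K L s t)" if st: "(s, t) \<noteq> (0, 0)" for s t
  proof (rule ccontr)
    assume "\<not> ?thesis"
    then obtain v where v: "v \<in> carrier_vec n" "v \<noteq> 0\<^sub>v n" "pencil K L s t *\<^sub>v v = 0\<^sub>v (n + p)"
      using injective_mat_iff_kernel[OF P] by blast
    obtain u x y where u: "u \<in> carrier_vec (n + p)" "K *\<^sub>v v = x \<cdot>\<^sub>v u" "L *\<^sub>v v = y \<cdot>\<^sub>v u"
      using proportional_images[OF c(1,2) v(1) st v(3)] by metis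
    have "A * col_mat v = col_mat u * mat 1 1 (\<lambda>_. z)"
      if "A \<in> carrier_mat (n + p) n" "A *\<^sub>v v = z \<cdot>\<^sub>v u" for A z
      by (simp only: mult_col_mat[OF that(1) v(1)] that(2) col_mat_smult
        smult_eq_mult_single[OF col_mat_carrier[OF u(1)], of z])
    from this[OF c(1) u(2)] this[OF c(2) u(3)] show False
      using destabilizing_subsystem[OF f \<open>N \<ge> 1\<close> S' col_mat_carrier[OF v(1)] injective_col_mat[OF v(1,2)]
        col_mat_carrier[OF u(1)], of "mat 1 1 (\<lambda>_. x)" "mat 1 1 (\<lambda>_. y)"] \<open>b < a\<close> f0 by simp
  qed
  moreover have "\<exists>s t. surjective_mat (hconcat (pencil K L s t) M)"
  proof (rule ccontr)
    assume "\<not> ?thesis"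
    then have "\<exists>\<phi> \<in> carrier_vec (n + p). (pencil K L 1 (of_nat j))\<^sup>T *\<^sub>v \<phi> = 0\<^sub>v n \<and>
        M\<^sup>T *\<^sub>v \<phi> = 0\<^sub>v (p + m) \<and> \<phi> \<noteq> 0\<^sub>v (n + p)" for j
      unfolding surjective_hconcat_iff[OF P c(3)] by blast
    then obtain u where u: "\<And>j. u j \<in> carrier_vec (n + p)" "\<And>j. u j \<noteq> 0\<^sub>v (n + p)"
      "\<And>j. pencil K\<^sup>T L\<^sup>T 1 (of_nat j) *\<^sub>v u j = 0\<^sub>v n"
      and uM: "\<And>j. M\<^sup>T *\<^sub>v u j = 0\<^sub>v (p + m)"
      unfolding pencil_transpose[OF c(1,2)] by metis
    obtain d U D where U: "d \<le> n + p" "U = mat (n + p) d (\<lambda>(i, j). u j $ i)" "injective_mat U" and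
      D: "D \<in> carrier_mat d d" and KU: "K\<^sup>T * U = L\<^sup>T * U * D" and LU: "\<not> injective_mat (L\<^sup>T * U)"
      using singular_pencil_subspace[OF ct(1,2) u] by metis
    have cU: "U \<in> carrier_mat (n + p) d" using U(2) by simp
    have cLU: "L\<^sup>T * U \<in> carrier_mat n d" using ct cU by simp
    obtain k C Y where C: "C \<in> carrier_mat n k" "injective_mat C" and Y: "Y \<in> carrier_mat k d"
      and CY: "L\<^sup>T * U = C * Y" and "k < d"
      using rank_factorization[OF cLU] LU by metis
    have KCY: "K\<^sup>T * U = C * (Y * D)" unfolding KU CY using C Y D by simp
    have MU: "M\<^sup>T * U = 0\<^sub>m (p + m) d"
    proof (rule eq_matI)
      fix i j assume "i < dim_row (0\<^sub>m (p + m) d :: 'k mat)" "j < dim_col (0\<^sub>m (p + m) d :: 'k mat)"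
      then have ij: "i < p + m" "j < d" by auto
      have "col U j = u j" using ij u(1)[of j] U(2) by (intro eq_vecI) auto
      then have "(M\<^sup>T * U) $$ (i, j) = (M\<^sup>T *\<^sub>v u j) $ i" using ij ct cU by simp
      then show "(M\<^sup>T * U) $$ (i, j) = 0\<^sub>m (p + m) d $$ (i, j)" using uM ij by simp
    qed (use ct cU in auto)
    have tr: "U\<^sup>T * A = Z\<^sup>T * C\<^sup>T"
      if A: "A \<in> carrier_mat (n + p) n" and Z: "Z \<in> carrier_mat k d" and e: "A\<^sup>T * U = C * Z" for A Z
    proof -
      have "U\<^sup>T * A = (A\<^sup>T * U)\<^sup>T" using transpose_mult[of "A\<^sup>T" n "n + p" U d] A cU by simp
      then show ?thesis unfolding e transpose_mult[OF C(1) Z] .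
    qed
    have UM: "U\<^sup>T * M = 0\<^sub>m d (p + m)"
    proof -
      have "U\<^sup>T * M = (M\<^sup>T * U)\<^sup>T" using transpose_mult[OF ct(3) cU] by simp
      then show ?thesis unfolding MU by simp
    qed
    have "k \<le> n" using injective_mat_dim[OF C(2,1)] .
    have "(a - b) * k \<le> (a - b) * n" using \<open>k \<le> n\<close> by simp
    then have "a * k - b * k \<le> a * n - b * n" by (simp add: diff_mult_distrib)
    moreover have "b * k \<le> a * k" "b * n \<le> a * n" using \<open>b < a\<close> by auto
    ultimately have "a * k < b * k + b" using slope by linarith
    moreover have "b * Suc k \<le> b * d" using \<open>k < d\<close> by (intro mult_le_mono2) simp
    ultimately have lt: "a * k < b * d" by simp
    have "surjective_mat U\<^sup>T" using surjective_mat_transpose[of "U\<^sup>T" d "n + p"] cU U(3) by simp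
    moreover have "Y * D \<in> carrier_mat k d" using Y D by simp
    ultimately have "f (K, L, M) = 0"
      using destabilizing_quotient[OF f \<open>N \<ge> 1\<close> S', of "U\<^sup>T" d "C\<^sup>T" k "(Y * D)\<^sup>T" "Y\<^sup>T"]
        tr[OF c(1) _ KCY] tr[OF c(2) Y CY] UM lt cU C Y by simp
    with f0 show False by simp
  qed
  ultimately show ?thesis unfolding SS observable_iff[OF S'] by blast
qed

section \<open>Homomorphisms between controllable or observable systems\<close>

text \<open>
  The pencil on the image of \<open>(h0, h1)\<close> is a subpencil of the target and a quotient of the source on
  which the framing is zero. So it inherits injectivity from the former and surjectivity, with the framing,
  from the latter.
\<close>

lemma induced_pencil:
  fixes K L :: "'a::field mat"
  assumes x: "K \<in> carrier_mat r c" "L \<in> carrier_mat r c" "M \<in> carrier_mat r q"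
    and y: "K' \<in> carrier_mat r c" "L' \<in> carrier_mat r c"
    and h: "h0 \<in> carrier_mat c c" "h1 \<in> carrier_mat r r"
    and hK: "h1 * K = K' * h0" and hL: "h1 * L = L' * h0" and hM: "h1 * M = 0\<^sub>m r q"
  shows "\<exists>r0 r1 A B. A \<in> carrier_mat r1 r0 \<and> B \<in> carrier_mat r1 r0 \<and>
    (\<forall>s t. injective_mat (pencil K' L' s t) \<longrightarrow> injective_mat (pencil A B s t)) \<and>
    (\<forall>s t. surjective_mat (hconcat (pencil K L s t) M) \<longrightarrow> surjective_mat (pencil A B s t)) \<and>
    (r0 = 0 \<longrightarrow> h0 = 0\<^sub>m c c) \<and> (r1 = 0 \<longrightarrow> h1 = 0\<^sub>m r r)"
proof -
  obtain r0 C0 Y0 where C0: "C0 \<in> carrier_mat c r0" "injective_mat C0"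
    and Y0: "Y0 \<in> carrier_mat r0 c" "surjective_mat Y0" and h0: "h0 = C0 * Y0"
    using rank_factorization[OF h(1)] by metis
  obtain r1 C1 Y1 where C1: "C1 \<in> carrier_mat r r1" "injective_mat C1"
    and Y1: "Y1 \<in> carrier_mat r1 r" "surjective_mat Y1" and h1: "h1 = C1 * Y1"
    using rank_factorization[OF h(2)] by metis
  \<comment> \<open>A section of the projection \<open>Y0\<close> to the image of \<open>h0\<close>; the induced maps are \<open>Y1 K Z\<close> and \<open>Y1 L Z\<close>.\<close>
  obtain Z where Z: "Z \<in> carrier_mat c r0" "Y0 * Z = 1\<^sub>m r0"
    using Y0 unfolding surjective_mat_def by auto
  have ind: "C1 * (Y1 * E * Z) = E' * C0 \<and> (Y1 * E * Z) * Y0 = Y1 * E"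
    if E: "E \<in> carrier_mat r c" and E': "E' \<in> carrier_mat r c" and e: "h1 * E = E' * h0" for E E'
  proof
    have YE: "Y1 * E \<in> carrier_mat r1 c" using Y1 E by simp
    have EC: "E' * C0 \<in> carrier_mat r r0" using E' C0 by simp
    have e2: "C1 * (Y1 * E) = (E' * C0) * Y0"
      using e unfolding h0 h1 assoc_mult_mat[OF C1(1) Y1(1) E] assoc_mult_mat[OF E' C0(1) Y0(1)] .
    have "C1 * (Y1 * E * Z) = (C1 * (Y1 * E)) * Z"
      by (rule assoc_mult_mat[OF C1(1) YE Z(1), symmetric])
    also have "\<dots> = (E' * C0) * (Y0 * Z)"
      unfolding e2 by (rule assoc_mult_mat[OF EC Y0(1) Z(1)])
    finally show e3: "C1 * (Y1 * E * Z) = E' * C0" unfolding Z(2) right_mult_one_mat[OF EC] .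
    have YEZ: "Y1 * E * Z \<in> carrier_mat r1 r0" using YE Z by simp
    have e4: "C1 * ((Y1 * E * Z) * Y0) = C1 * (Y1 * E)"
      unfolding e2 e3[symmetric] by (rule assoc_mult_mat[OF C1(1) YEZ Y0(1), symmetric])
    show "(Y1 * E * Z) * Y0 = Y1 * E"
      by (rule injective_mat_cancel[OF C1(2,1) _ YE e4]) (use YEZ Y0 in simp)
  qed
  define A B where "A = Y1 * K * Z" and "B = Y1 * L * Z"
  have A: "A \<in> carrier_mat r1 r0" and B: "B \<in> carrier_mat r1 r0"
    unfolding A_def B_def using Y1 x Z by auto
  have A2: "C1 * A = K' * C0" "A * Y0 = Y1 * K" and B2: "C1 * B = L' * C0" "B * Y0 = Y1 * L"
    using ind[OF x(1) y(1) hK] ind[OF x(2) y(2) hL] unfolding A_def B_def by auto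
  have "Y1 * M = 0\<^sub>m r1 q"
  proof (rule injective_mat_cancel[OF C1(2,1)])
    show "C1 * (Y1 * M) = C1 * 0\<^sub>m r1 q"
      using hM C1 unfolding h1 assoc_mult_mat[OF C1(1) Y1(1) x(3)] by simp
  qed (use Y1 x in auto)
  then have Y1M: "M\<^sup>T * Y1\<^sup>T = 0\<^sub>m q r1"
    using transpose_mult[OF Y1(1) x(3)] by simp
  have pC: "C1 * pencil A B s t = pencil K' L' s t * C0" for s t
  proof -
    have "C1 * pencil A B s t = s \<cdot>\<^sub>m (C1 * A) + t \<cdot>\<^sub>m (C1 * B)"
      using C1 A B by (simp add: mult_add_distrib_mat[of _ r r1 _ r0] mult_smult_distrib[OF C1(1)])
    also have "\<dots> = pencil K' L' s t * C0"
      unfolding A2 B2 using y C0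
      by (simp add: add_mult_distrib_mat[of _ r c] mult_smult_assoc_mat[of _ r c])
    finally show ?thesis .
  qed
  have pY: "pencil A B s t * Y0 = Y1 * pencil K L s t" for s t
  proof -
    have "Y1 * pencil K L s t = s \<cdot>\<^sub>m (Y1 * K) + t \<cdot>\<^sub>m (Y1 * L)"
      using Y1 x by (simp add: mult_add_distrib_mat[of _ r1 r _ c] mult_smult_distrib[OF Y1(1)])
    also have "\<dots> = pencil A B s t * Y0"
      unfolding A2(2)[symmetric] B2(2)[symmetric] using A B Y0
      by (simp add: add_mult_distrib_mat[of _ r1 r0] mult_smult_assoc_mat[of _ r1 r0])
    finally show ?thesis by simp
  qed
  note pAB = pencil_carrier[OF A B] and pKL = pencil_carrier[OF x(1,2)] and pKL' = pencil_carrier[OF y]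
  show ?thesis
  proof (rule exI[of _ r0], rule exI[of _ r1], rule exI[of _ A], rule exI[of _ B],
      intro conjI allI impI A B)
    fix s t assume inj: "injective_mat (pencil K' L' s t)"
    show "injective_mat (pencil A B s t)"
      unfolding injective_mat_iff_kernel[OF pAB]
    proof (intro ballI impI)
      fix v assume v: "v \<in> carrier_vec r0" "pencil A B s t *\<^sub>v v = 0\<^sub>v r1"
      have "pencil K' L' s t *\<^sub>v (C0 *\<^sub>v v) = (C1 * pencil A B s t) *\<^sub>v v"
        unfolding pC by (rule assoc_mult_mat_vec[OF pKL' C0(1) v(1), symmetric])
      also have "\<dots> = C1 *\<^sub>v (pencil A B s t *\<^sub>v v)"
        by (rule assoc_mult_mat_vec[OF C1(1) pAB v(1)])
      also have "\<dots> = 0\<^sub>v r" unfolding v(2) using C1(1) by simp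
      finally have "C0 *\<^sub>v v = 0\<^sub>v c"
        using injective_matD[OF inj pKL', of "C0 *\<^sub>v v"] C0 v by auto
      then show "v = 0\<^sub>v r0" using injective_matD[OF C0(2,1) v(1)] by simp
    qed
  next
    fix s t assume surj: "surjective_mat (hconcat (pencil K L s t) M)"
    show "surjective_mat (pencil A B s t)"
      unfolding surjective_mat_iff_cokernel[OF pAB]
    proof (intro ballI impI)
      fix \<phi> assume \<phi>: "\<phi> \<in> carrier_vec r1" "(pencil A B s t)\<^sup>T *\<^sub>v \<phi> = 0\<^sub>v r0"
      have cT: "Y1\<^sup>T \<in> carrier_mat r r1" "(pencil K L s t)\<^sup>T \<in> carrier_mat c r"
        "(pencil A B s t)\<^sup>T \<in> carrier_mat r0 r1" "Y0\<^sup>T \<in> carrier_mat c r0" "M\<^sup>T \<in> carrier_mat q r"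
        using Y1 Y0 x pKL[of s t] pAB[of s t] by auto
      have "(pencil K L s t)\<^sup>T *\<^sub>v (Y1\<^sup>T *\<^sub>v \<phi>) = ((pencil K L s t)\<^sup>T * Y1\<^sup>T) *\<^sub>v \<phi>"
        by (rule assoc_mult_mat_vec[OF cT(2,1) \<phi>(1), symmetric])
      also have "(pencil K L s t)\<^sup>T * Y1\<^sup>T = Y0\<^sup>T * (pencil A B s t)\<^sup>T"
        unfolding transpose_mult[OF Y1(1) pKL, symmetric] pY[symmetric]
        by (rule transpose_mult[OF pAB Y0(1)])
      also have "\<dots> *\<^sub>v \<phi> = Y0\<^sup>T *\<^sub>v ((pencil A B s t)\<^sup>T *\<^sub>v \<phi>)"
        by (rule assoc_mult_mat_vec[OF cT(4,3) \<phi>(1)])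
      also have "\<dots> = 0\<^sub>v c" unfolding \<phi>(2) using cT(4) by simp
      finally have 1: "(pencil K L s t)\<^sup>T *\<^sub>v (Y1\<^sup>T *\<^sub>v \<phi>) = 0\<^sub>v c" .
      have 2: "M\<^sup>T *\<^sub>v (Y1\<^sup>T *\<^sub>v \<phi>) = 0\<^sub>v q"
        unfolding assoc_mult_mat_vec[OF cT(5,1) \<phi>(1), symmetric] Y1M
        using \<phi>(1) by (intro eq_vecI) auto
      have "Y1\<^sup>T *\<^sub>v \<phi> \<in> carrier_vec r" using cT \<phi> by auto
      then have "Y1\<^sup>T *\<^sub>v \<phi> = 0\<^sub>v r"
        using surj 1 2 unfolding surjective_hconcat_iff[OF pKL x(3)] by blast
      then show "\<phi> = 0\<^sub>v r1" using surjective_matD[OF Y1(2,1) \<phi>(1)] by simp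
    qed
  next
    assume "r0 = 0"
    then show "h0 = 0\<^sub>m c c" unfolding h0 using C0 Y0
      by (intro eq_matI) (auto simp: scalar_prod_def)
  next
    assume "r1 = 0"
    then show "h1 = 0\<^sub>m r r" unfolding h1 using C1 Y1
      by (intro eq_matI) (auto simp: scalar_prod_def)
  qed
qed

text \<open>
  No nonzero homomorphism from the first system to the second one kills the framing.
\<close>

definition rigid_pair :: "nat \<Rightarrow> nat \<Rightarrow> nat \<Rightarrow> 'k::field lomadze \<Rightarrow> 'k lomadze \<Rightarrow> bool" where
  "rigid_pair n m p x y \<longleftrightarrow> (case x of (K, L, M) \<Rightarrow> case y of (K', L', M') \<Rightarrow>
    \<forall>h0 \<in> carrier_mat n n. \<forall>h1 \<in> carrier_mat (n + p) (n + p).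
      h1 * K = K' * h0 \<and> h1 * L = L' * h0 \<and> h1 * M = 0\<^sub>m (n + p) (p + m) \<longrightarrow>
      h0 = 0\<^sub>m n n \<and> h1 = 0\<^sub>m (n + p) (n + p))"

lemma rigid_pairI:
  fixes K L M K' L' M' :: "'k::field mat"
  assumes x: "(K, L, M) \<in> lomadze_systems n m p" and y: "(K', L', M') \<in> lomadze_systems n m p"
    and trivial: "\<And>r c A B. A \<in> carrier_mat r c \<Longrightarrow> B \<in> carrier_mat r c \<Longrightarrow>
      \<forall>s t. injective_mat (pencil K' L' s t) \<longrightarrow> injective_mat (pencil A B s t) \<Longrightarrow>
      \<forall>s t. surjective_mat (hconcat (pencil K L s t) M) \<longrightarrow> surjective_mat (pencil A B s t) \<Longrightarrow>
      r = 0 \<and> c = 0"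
  shows "rigid_pair n m p (K, L, M) (K', L', M')"
  unfolding rigid_pair_def prod.case
proof (intro ballI impI, elim conjE)
  fix h0 h1 assume h: "h0 \<in> carrier_mat n n" "h1 \<in> carrier_mat (n + p) (n + p)"
    "h1 * K = K' * h0" "h1 * L = L' * h0" "h1 * M = 0\<^sub>m (n + p) (p + m)"
  obtain r0 r1 A B where AB: "A \<in> carrier_mat r1 r0" "B \<in> carrier_mat r1 r0"
    and i: "\<forall>s t. injective_mat (pencil K' L' s t) \<longrightarrow> injective_mat (pencil A B s t)"
    and s: "\<forall>s t. surjective_mat (hconcat (pencil K L s t) M) \<longrightarrow> surjective_mat (pencil A B s t)"
    and z: "r0 = 0 \<longrightarrow> h0 = 0\<^sub>m n n" "r1 = 0 \<longrightarrow> h1 = 0\<^sub>m (n + p) (n + p)"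
    using induced_pencil[OF lomadze_systemsD[OF x] lomadze_systemsD(1,2)[OF y] h] by blast
  from trivial[OF AB i s] z show "h0 = 0\<^sub>m n n \<and> h1 = 0\<^sub>m (n + p) (n + p)" by simp
qed

lemma controllable_rigid_pair:
  fixes x y :: "'k::alg_closed_field lomadze"
  assumes "x \<in> lomadze_systems n m p" "controllable n p x"
    and "y \<in> lomadze_systems n m p" "controllable n p y"
  shows "rigid_pair n m p x y"
proof -
  obtain K L M K' L' M' where xy: "x = (K, L, M)" "y = (K', L', M')" by (metis prod_cases3)
  note x = assms(1)[unfolded xy] and y = assms(3)[unfolded xy]
  have surj: "surjective_mat (hconcat (pencil K L s t) M)" if "(s, t) \<noteq> (0, 0)" for s t
    using assms(2) controllable_iff[OF x] that unfolding xy by blast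
  obtain s t where inj: "injective_mat (pencil K' L' s t)"
    using assms(4) controllable_iff[OF y] unfolding xy by blast
  show ?thesis
    unfolding xy
  proof (rule rigid_pairI[OF x y])
    fix r c A B assume "A \<in> carrier_mat r c" "B \<in> carrier_mat r c"
      and i: "\<forall>s t. injective_mat (pencil K' L' s t) \<longrightarrow> injective_mat (pencil A B s t)"
      and s: "\<forall>s t. surjective_mat (hconcat (pencil K L s t) M) \<longrightarrow> surjective_mat (pencil A B s t)"
    then show "r = 0 \<and> c = 0"
      using everywhere_surjective_pencil_trivial[OF _ _ i[rule_format, OF inj] s[rule_format, OF surj]]
      by simp
  qed
qed

lemma observable_rigid_pair:
  fixes x y :: "'k::alg_closed_field lomadze"
  assumes "x \<in> lomadze_systems n m p" "observable n p x"
    and "y \<in> lomadze_systems n m p" "observable n p y"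
  shows "rigid_pair n m p x y"
proof -
  obtain K L M K' L' M' where xy: "x = (K, L, M)" "y = (K', L', M')" by (metis prod_cases3)
  note x = assms(1)[unfolded xy] and y = assms(3)[unfolded xy]
  obtain s t where surj: "surjective_mat (hconcat (pencil K L s t) M)"
    using assms(2) observable_iff[OF x] unfolding xy by blast
  have inj: "injective_mat (pencil K' L' s t)" if "(s, t) \<noteq> (0, 0)" for s t
    using assms(4) observable_iff[OF y] that unfolding xy by blast
  show ?thesis
    unfolding xy
  proof (rule rigid_pairI[OF x y])
    fix r c A B assume "A \<in> carrier_mat r c" "B \<in> carrier_mat r c"
      and i: "\<forall>s t. injective_mat (pencil K' L' s t) \<longrightarrow> injective_mat (pencil A B s t)"
      and s: "\<forall>s t. surjective_mat (hconcat (pencil K L s t) M) \<longrightarrow> surjective_mat (pencil A B s t)"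
    then show "r = 0 \<and> c = 0"
      using everywhere_injective_pencil_trivial[OF _ _ s[rule_format, OF surj] i[rule_format, OF inj]]
      by simp
  qed
qed

section \<open>Semi-invariants that do not vanish\<close>

text \<open>
  The pencil with coefficients \<open>diag_block\<close> and \<open>upper_shift\<close> of format \<open>r \<times> (r + 1)\<close>, and its transpose, are
  the indecomposable Kronecker modules whose slopes, for format \<open>n \<times> (n + 1)\<close> and \<open>n \<times> (n - 1)\<close>, are the outer
  bounds of the two chambers.
\<close>

definition diag_block :: "nat \<Rightarrow> nat \<Rightarrow> 'a::zero_neq_one mat" where
  "diag_block r c = mat r c (\<lambda>(i, j). if i = j then 1 else 0)"

definition upper_shift :: "nat \<Rightarrow> nat \<Rightarrow> 'a::zero_neq_one mat" where
  "upper_shift r c = mat r c (\<lambda>(i, j). if j = Suc i then 1 else 0)"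

definition lower_shift :: "nat \<Rightarrow> nat \<Rightarrow> 'a::zero_neq_one mat" where
  "lower_shift r c = mat r c (\<lambda>(i, j). if i = Suc j then 1 else 0)"

lemma block_carrier [simp]:
  "diag_block r c \<in> carrier_mat r c" "upper_shift r c \<in> carrier_mat r c"
  "lower_shift r c \<in> carrier_mat r c"
  unfolding diag_block_def upper_shift_def lower_shift_def by auto

lemma transpose_block [simp]:
  "(diag_block r c)\<^sup>T = diag_block c r" "(upper_shift r c)\<^sup>T = lower_shift c r"
  "(lower_shift r c)\<^sup>T = upper_shift c r"
  unfolding diag_block_def upper_shift_def lower_shift_def by (auto intro!: eq_matI)

lemma transpose_kron:
  assumes A: "A \<in> carrier_mat r c" and B: "B \<in> carrier_mat r' c'"
  shows "(kron A B)\<^sup>T = kron A\<^sup>T B\<^sup>T"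
proof (rule eq_matI)
  have AT: "A\<^sup>T \<in> carrier_mat c r" and BT: "B\<^sup>T \<in> carrier_mat c' r'" using A B by auto
  show "dim_row (kron A B)\<^sup>T = dim_row (kron A\<^sup>T B\<^sup>T)" "dim_col (kron A B)\<^sup>T = dim_col (kron A\<^sup>T B\<^sup>T)"
    using kron_carrier[OF A B] kron_carrier[OF AT BT] by auto
  fix i j assume "i < dim_row (kron A\<^sup>T B\<^sup>T)" "j < dim_col (kron A\<^sup>T B\<^sup>T)"
  then have ij: "i < c * c'" "j < r * r'" using kron_carrier[OF AT BT] by auto
  show "(kron A B)\<^sup>T $$ (i, j) = kron A\<^sup>T B\<^sup>T $$ (i, j)"
    using ij div_mod_less[OF ij(1)] div_mod_less[OF ij(2)] A B kron_carrier[OF A B]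
    by (simp add: kron_index[OF A B] kron_index[OF AT BT])
qed

text \<open>
  Kronecker products act on stacked columns: position \<open>j * n + l\<close> of the vector is row \<open>l\<close> of column \<open>j\<close>.
\<close>

definition unvec :: "nat \<Rightarrow> nat \<Rightarrow> 'a vec \<Rightarrow> 'a mat" where
  "unvec n a v = mat n a (\<lambda>(l, j). v $ (j * n + l))"

lemma unvec_carrier [simp]: "unvec n a v \<in> carrier_mat n a"
  unfolding unvec_def by simp

lemma block_index_less: "j < a \<Longrightarrow> l < n \<Longrightarrow> j * n + l < a * (n::nat)"
  by (metis add.commute less_mult_imp_div_less mult.commute mod_less_divisor mod_mult_self2 nat_less_le
      mult_Suc_right add_less_cancel_left less_le_trans mult_le_mono1 Suc_leI mult_Suc)

lemma unvec_eq_0D: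
  assumes v: "v \<in> carrier_vec (a * n)" and "unvec n a v = 0\<^sub>m n a"
  shows "v = 0\<^sub>v (a * n)"
proof (rule eq_vecI)
  fix k assume "k < dim_vec (0\<^sub>v (a * n) :: 'a vec)"
  then have k: "k < a * n" by simp
  note dm = div_mod_less[OF k]
  have "unvec n a v $$ (k mod n, k div n) = 0" unfolding assms(2) using dm by simp
  then show "v $ k = 0\<^sub>v (a * n) $ k" using dm k by (simp add: unvec_def)
qed (use v in auto)

lemma kron_mult_vec_index:
  fixes P :: "'a::comm_ring_1 mat"
  assumes P: "P \<in> carrier_mat b a" and K: "K \<in> carrier_mat r n" and v: "v \<in> carrier_vec (a * n)"
    and i: "i < b" and l: "l < r"
  shows "(kron P K *\<^sub>v v) $ (i * r + l) = (\<Sum>j<a. P $$ (i, j) * (K * unvec n a v) $$ (l, j))"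
proof -
  have il: "i * r + l < b * r" by (rule block_index_less[OF i l])
  note PK = kron_carrier[OF P K]
  have "(kron P K *\<^sub>v v) $ (i * r + l) = (\<Sum>k<a * n. kron P K $$ (i * r + l, k) * v $ k)"
    using PK il v by (simp add: scalar_prod_def atLeast0LessThan)
  also have "\<dots> = (\<Sum>k<a * n. (\<lambda>j l'. P $$ (i, j) * K $$ (l, l') * v $ (j * n + l')) (k div n) (k mod n))"
    using il l by (intro sum.cong) (auto simp: kron_index[OF P K])
  also have "\<dots> = (\<Sum>j<a. \<Sum>l'<n. P $$ (i, j) * K $$ (l, l') * v $ (j * n + l'))"
    by (rule sum_div_mod)
  also have "\<dots> = (\<Sum>j<a. P $$ (i, j) * (K * unvec n a v) $$ (l, j))"
  proof (rule sum.cong[OF refl])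
    fix j assume "j \<in> {..<a}"
    then have "(K * unvec n a v) $$ (l, j) = (\<Sum>l'<n. K $$ (l, l') * unvec n a v $$ (l', j))"
      using l by (intro mult_mat_entry[OF K unvec_carrier]) auto
    then show "(\<Sum>l'<n. P $$ (i, j) * K $$ (l, l') * v $ (j * n + l')) =
        P $$ (i, j) * (K * unvec n a v) $$ (l, j)"
      using \<open>j \<in> {..<a}\<close> by (simp add: sum_distrib_left unvec_def mult.assoc)
  qed
  finally show ?thesis .
qed

lemma kron_one_mult_vec_eq_0:
  fixes E :: "'a::comm_ring_1 mat"
  assumes E: "E \<in> carrier_mat q n" and v: "v \<in> carrier_vec (a * n)"
    and "kron (1\<^sub>m a) E *\<^sub>v v = 0\<^sub>v (a * q)"
  shows "E * unvec n a v = 0\<^sub>m q a"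
proof (rule eq_matI)
  fix l i assume "l < dim_row (0\<^sub>m q a :: 'a mat)" "i < dim_col (0\<^sub>m q a :: 'a mat)"
  then have li: "l < q" "i < a" by auto
  have "0 = (kron (1\<^sub>m a) E *\<^sub>v v) $ (i * q + l)"
    unfolding assms(3) using block_index_less[OF li(2,1)] by simp
  also have "\<dots> = (\<Sum>j<a. (1\<^sub>m a :: 'a mat) $$ (i, j) * (E * unvec n a v) $$ (l, j))"
    by (rule kron_mult_vec_index[OF one_carrier_mat E v li(2,1)])
  also have "\<dots> = (\<Sum>j<a. if j = i then (E * unvec n a v) $$ (l, j) else 0)"
    using li by (intro sum.cong) auto
  also have "\<dots> = (E * unvec n a v) $$ (l, i)" using li by simp
  finally show "(E * unvec n a v) $$ (l, i) = 0\<^sub>m q a $$ (l, i)" using li by simp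
qed (use E in \<open>auto simp: unvec_def\<close>)

lemma kron_pencil_mult_vec_eq_0:
  fixes A B :: "'a::comm_ring_1 mat"
  assumes P: "P \<in> carrier_mat b a" and Q: "Q \<in> carrier_mat b a"
    and A: "A \<in> carrier_mat r n" and B: "B \<in> carrier_mat r n" and v: "v \<in> carrier_vec (a * n)"
    and eq: "(kron P A + kron Q B) *\<^sub>v v = 0\<^sub>v (b * r)" and i: "i < b" and l: "l < r"
  shows "(\<Sum>j<a. P $$ (i, j) * (A * unvec n a v) $$ (l, j)) +
    (\<Sum>j<a. Q $$ (i, j) * (B * unvec n a v) $$ (l, j)) = 0"
proof -
  note PA = kron_carrier[OF P A] and QB = kron_carrier[OF Q B]
  have il: "i * r + l < b * r" by (rule block_index_less[OF i l])
  have "0 = ((kron P A + kron Q B) *\<^sub>v v) $ (i * r + l)" unfolding eq using il by simp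
  also have "(kron P A + kron Q B) *\<^sub>v v = kron P A *\<^sub>v v + kron Q B *\<^sub>v v"
    by (rule add_mult_distrib_mat_vec[OF PA QB v])
  also have "\<dots> $ (i * r + l) = (kron P A *\<^sub>v v) $ (i * r + l) + (kron Q B *\<^sub>v v) $ (i * r + l)"
    using PA QB il by (intro index_add_vec(1)) auto
  finally show ?thesis
    unfolding kron_mult_vec_index[OF P A v i l] kron_mult_vec_index[OF Q B v i l] by simp
qed

text \<open>
  The equations read \<open>A v_0 = 0\<close>, \<open>A v_(i+1) + B v_i = 0\<close>, so the columns vanish one after the other.
\<close>

lemma tall_shift_kernel:
  fixes A B E :: "'a::field mat"
  assumes A: "A \<in> carrier_mat r c" and B: "B \<in> carrier_mat r c" and E: "E \<in> carrier_mat q c"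
    and reg: "\<And>x. x \<in> carrier_vec c \<Longrightarrow> A *\<^sub>v x = 0\<^sub>v r \<Longrightarrow> E *\<^sub>v x = 0\<^sub>v q \<Longrightarrow> x = 0\<^sub>v c"
    and v: "v \<in> carrier_vec (N * c)"
    and eq: "(kron (diag_block (Suc N) N) A + kron (lower_shift (Suc N) N) B) *\<^sub>v v = 0\<^sub>v (Suc N * r)"
    and Ev: "kron (1\<^sub>m N) E *\<^sub>v v = 0\<^sub>v (N * q)"
  shows "v = 0\<^sub>v (N * c)"
proof (rule unvec_eq_0D[OF v])
  define V where "V = unvec c N v"
  have V: "V \<in> carrier_mat c N" unfolding V_def by simp
  have rel: "(\<Sum>j<N. (if i = j then (A * V) $$ (l, j) else 0)) +
      (\<Sum>j<N. (if i = Suc j then (B * V) $$ (l, j) else 0)) = 0" if "i < Suc N" "l < r" for i l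
  proof -
    have "(\<Sum>j<N. diag_block (Suc N) N $$ (i, j) * (A * V) $$ (l, j)) +
      (\<Sum>j<N. lower_shift (Suc N) N $$ (i, j) * (B * V) $$ (l, j)) = 0"
      unfolding V_def using that
      by (intro kron_pencil_mult_vec_eq_0[OF _ _ A B v eq]) auto
    moreover have "(\<Sum>j<N. diag_block (Suc N) N $$ (i, j) * (A * V) $$ (l, j)) =
        (\<Sum>j<N. (if i = j then (A * V) $$ (l, j) else 0))"
      using that by (intro sum.cong) (auto simp: diag_block_def simp del: index_mult_mat)
    moreover have "(\<Sum>j<N. lower_shift (Suc N) N $$ (i, j) * (B * V) $$ (l, j)) =
        (\<Sum>j<N. (if i = Suc j then (B * V) $$ (l, j) else 0))"
      using that by (intro sum.cong) (auto simp: lower_shift_def simp del: index_mult_mat)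
    ultimately show ?thesis by simp
  qed
  have EV: "E * V = 0\<^sub>m q N" unfolding V_def by (rule kron_one_mult_vec_eq_0[OF E v Ev])
  have "col V i = 0\<^sub>v c" if "i < N" for i
    using that
  proof (induction i)
    case (0)
    show ?case
    proof (rule reg)
      show "E *\<^sub>v col V 0 = 0\<^sub>v q" unfolding col_mult2[OF E V 0, symmetric] EV using 0 by simp
      show "A *\<^sub>v col V 0 = 0\<^sub>v r"
      proof (rule eq_vecI)
        fix l assume "l < dim_vec (0\<^sub>v r :: 'a vec)"
        then have l: "l < r" by simp
        have "(A * V) $$ (l, 0) = 0" using rel[of 0 l] l 0 by (simp del: index_mult_mat)
        then show "(A *\<^sub>v col V 0) $ l = 0\<^sub>v r $ l"
          using l 0 A V by simp
      qed (use A in auto)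
    qed (use V in auto)
  next
    case (Suc i)
    then have IH: "col V i = 0\<^sub>v c" by simp
    show ?case
    proof (rule reg)
      show "E *\<^sub>v col V (Suc i) = 0\<^sub>v q"
        unfolding col_mult2[OF E V Suc.prems, symmetric] EV using Suc.prems by simp
      show "A *\<^sub>v col V (Suc i) = 0\<^sub>v r"
      proof (rule eq_vecI)
        fix l assume "l < dim_vec (0\<^sub>v r :: 'a vec)"
        then have l: "l < r" by simp
        have "(B * V) $$ (l, i) = 0" using IH l Suc.prems B V by simp
        moreover have "(\<Sum>j<N. (if Suc i = Suc j then (B * V) $$ (l, j) else 0)) = (B * V) $$ (l, i)"
          using Suc.prems by (simp del: index_mult_mat)
        ultimately have "(A * V) $$ (l, Suc i) = 0"
          using rel[of "Suc i" l] l Suc.prems by (simp del: index_mult_mat)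
        then show "(A *\<^sub>v col V (Suc i)) $ l = 0\<^sub>v r $ l"
          using l Suc.prems A V by simp
      qed (use A in auto)
    qed (use V in auto)
  qed
  then have "V $$ (l, i) = 0" if "l < c" "i < N" for l i
    using that V by (metis carrier_matD index_col index_zero_vec(1))
  then show "unvec c N v = 0\<^sub>m c N" unfolding V_def[symmetric] using V by (intro eq_matI) auto
qed

text \<open>
  A sequence with \<open>A v_i + B v_(i+1) = 0\<close> behaves like a module over polynomials: \<open>A\<close> acts as \<open>-B\<close> after
  shifting. Take a relation \<open>\<Sum> h_i v_i = 0\<close> whose polynomial \<open>h\<close> has least degree. If \<open>h = (X - z) g\<close>, then
  \<open>x = \<Sum> g_i v_i\<close> satisfies \<open>\<Sum> g_i v_(i+1) = z x\<close>, whence \<open>(A + z B) x = 0\<close> and \<open>x = 0\<close> by regularity, contradicting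
  minimality. So \<open>h\<close> is constant, \<open>v_0 = 0\<close>, and the remaining members vanish one after the other.
\<close>

lemma shift_sequence_vanishes:
  fixes A B E V :: "'a::alg_closed_field mat"
  assumes A: "A \<in> carrier_mat r c" and B: "B \<in> carrier_mat r c" and E: "E \<in> carrier_mat q c"
    and reg: "\<And>s t x. (s, t) \<noteq> (0, 0) \<Longrightarrow> x \<in> carrier_vec c \<Longrightarrow> pencil A B s t *\<^sub>v x = 0\<^sub>v r \<Longrightarrow>
      E *\<^sub>v x = 0\<^sub>v q \<Longrightarrow> x = 0\<^sub>v c"
    and V: "V \<in> carrier_mat c (Suc N)"
    and rel: "\<And>l i. l < r \<Longrightarrow> i < N \<Longrightarrow> (A * V) $$ (l, i) + (B * V) $$ (l, Suc i) = 0"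
    and EV: "E * V = 0\<^sub>m q (Suc N)"
    and w: "w \<in> carrier_vec (Suc N)" "w \<noteq> 0\<^sub>v (Suc N)" "V *\<^sub>v w = 0\<^sub>v c"
  shows "V = 0\<^sub>m c (Suc N)"
proof -
  define cv where "cv h = vec (Suc N) (coeff h)" for h :: "'a poly"
  have cv: "cv h \<in> carrier_vec (Suc N)" for h unfolding cv_def by simp
  define good where "good h \<longleftrightarrow> h \<noteq> 0 \<and> degree h \<le> N \<and> V *\<^sub>v cv h = 0\<^sub>v c" for h :: "'a poly"
  have "\<exists>h. good h"
  proof -
    define h where "h = (\<Sum>i\<le>N. monom (w $ i) i)"
    have co: "coeff h k = (if k \<le> N then w $ k else 0)" for k
      unfolding h_def coeff_sum coeff_monom by simp
    then have "cv h = w" unfolding cv_def using w(1) by (intro eq_vecI) auto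
    moreover have "h \<noteq> 0"
    proof
      assume "h = 0"
      then have "w = 0\<^sub>v (Suc N)" using \<open>cv h = w\<close> unfolding cv_def by (intro eq_vecI) auto
      with w(2) show False by simp
    qed
    moreover have "degree h \<le> N" by (rule degree_le) (simp add: co)
    ultimately show ?thesis unfolding good_def using w(3) by blast
  qed
  then obtain h where h: "good h" and min: "\<And>h'. good h' \<Longrightarrow> degree h \<le> degree h'"
    using ex_has_least_nat[of good _ degree] by blast
  have "degree h = 0"
  proof (rule ccontr)
    assume deg: "degree h \<noteq> 0"
    then obtain z where "poly h z = 0" using alg_closed_imp_poly_has_root by blast
    then obtain g where g: "h = [:-z, 1:] * g" using poly_eq_0_iff_dvd by blast
    then have "g \<noteq> 0" using h unfolding good_def by auto
    then have degg: "degree h = Suc (degree g)" unfolding g by (subst degree_mult_eq) auto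
    have "pCons 0 g = h + smult z g" unfolding g by simp
    then have "cv (pCons 0 g) = cv h + z \<cdot>\<^sub>v cv g"
      unfolding cv_def by (intro eq_vecI) (auto simp: coeff_pCons)
    then have "V *\<^sub>v cv (pCons 0 g) = V *\<^sub>v cv h + z \<cdot>\<^sub>v (V *\<^sub>v cv g)"
      using mult_add_distrib_mat_vec[OF V cv, of "z \<cdot>\<^sub>v cv g"] mult_mat_vec[OF V cv] cv by simp
    also have "V *\<^sub>v cv h = 0\<^sub>v c" using h unfolding good_def by simp
    also have "0\<^sub>v c + z \<cdot>\<^sub>v (V *\<^sub>v cv g) = z \<cdot>\<^sub>v (V *\<^sub>v cv g)" using V by (intro eq_vecI) auto
    finally have Vg: "V *\<^sub>v cv (pCons 0 g) = z \<cdot>\<^sub>v (V *\<^sub>v cv g)" .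
    define x where "x = V *\<^sub>v cv g"
    have x: "x \<in> carrier_vec c" unfolding x_def using V cv by (intro mult_mat_vec_carrier) auto
    have AV: "A * V \<in> carrier_mat r (Suc N)" and BV: "B * V \<in> carrier_mat r (Suc N)"
      using A B V by auto
    have "pencil A B 1 z *\<^sub>v x = 0\<^sub>v r"
      unfolding pencil_mult_vec[OF A B x]
    proof (rule eq_vecI)
      fix l assume "l < dim_vec (0\<^sub>v r :: 'a vec)"
      then have l: "l < r" by simp
      have gN: "coeff g N = 0" using degg h unfolding good_def by (intro coeff_eq_0) simp
      have "(A *\<^sub>v x) $ l = ((A * V) *\<^sub>v cv g) $ l"
        unfolding x_def assoc_mult_mat_vec[OF A V cv] ..
      also have "\<dots> = (\<Sum>i<Suc N. (A * V) $$ (l, i) * coeff g i)"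
        using l AV by (simp add: scalar_prod_def atLeast0LessThan cv_def del: index_mult_mat sum.lessThan_Suc)
      also have "\<dots> = (\<Sum>i<N. (A * V) $$ (l, i) * coeff g i)"
        using gN by simp
      also have "\<dots> = (\<Sum>i<N. - ((B * V) $$ (l, Suc i) * coeff g i))"
        using rel[OF l] by (intro sum.cong) (auto simp: eq_neg_iff_add_eq_0 distrib_right[symmetric] simp del: index_mult_mat)
      also have "\<dots> = - (\<Sum>i<Suc N. (B * V) $$ (l, i) * coeff (pCons 0 g) i)"
        unfolding sum.lessThan_Suc_shift by (simp add: sum_negf del: index_mult_mat)
      also have "(\<Sum>i<Suc N. (B * V) $$ (l, i) * coeff (pCons 0 g) i) = ((B * V) *\<^sub>v cv (pCons 0 g)) $ l"
        using l BV by (simp add: scalar_prod_def atLeast0LessThan cv_def del: index_mult_mat sum.lessThan_Suc)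
      also have "(B * V) *\<^sub>v cv (pCons 0 g) = z \<cdot>\<^sub>v (B *\<^sub>v x)"
        unfolding assoc_mult_mat_vec[OF B V cv] Vg x_def[symmetric] using mult_mat_vec[OF B x] .
      finally show "(1 \<cdot>\<^sub>v (A *\<^sub>v x) + z \<cdot>\<^sub>v (B *\<^sub>v x)) $ l = 0\<^sub>v r $ l"
        using l A B by (simp del: index_mult_mat_vec)
    qed (use B in auto)
    moreover have "E *\<^sub>v x = 0\<^sub>v q"
    proof -
      have "E *\<^sub>v x = (E * V) *\<^sub>v cv g" unfolding x_def assoc_mult_mat_vec[OF E V cv] ..
      also have "\<dots> = 0\<^sub>v q" unfolding EV using cv[of g] by (intro eq_vecI) auto
      finally show ?thesis .
    qed
    ultimately have "x = 0\<^sub>v c" using reg[of 1 z x] x by simp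
    then have "good g" using \<open>g \<noteq> 0\<close> degg h unfolding good_def x_def by simp
    from min[OF this] degg show False by simp
  qed
  then obtain a where a: "h = [:a:]" by (rule degree_eq_zeroE)
  then have "a \<noteq> 0" using h unfolding good_def by auto
  have "V *\<^sub>v cv h = a \<cdot>\<^sub>v col V 0"
  proof (rule eq_vecI)
    fix l assume "l < dim_vec (a \<cdot>\<^sub>v col V 0)"
    then have l: "l < c" using V by simp
    have "(V *\<^sub>v cv h) $ l = (\<Sum>i<Suc N. V $$ (l, i) * coeff h i)"
      using l V by (simp add: scalar_prod_def atLeast0LessThan cv_def del: sum.lessThan_Suc)
    also have "\<dots> = V $$ (l, 0) * a" unfolding sum.lessThan_Suc_shift a by simp
    finally show "(V *\<^sub>v cv h) $ l = (a \<cdot>\<^sub>v col V 0) $ l" using l V by simp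
  qed (use V in auto)
  then have "a \<cdot>\<^sub>v col V 0 = 0\<^sub>v c" using h unfolding good_def by simp
  then have "(a \<cdot>\<^sub>v col V 0) $ l = 0" if "l < c" for l using that by simp
  then have V0: "col V 0 = 0\<^sub>v c" using \<open>a \<noteq> 0\<close> V by (intro eq_vecI) auto
  have "col V i = 0\<^sub>v c" if "i < Suc N" for i
    using that
  proof (induction i)
    case 0
    show ?case by (rule V0)
  next
    case (Suc i)
    then have IH: "col V i = 0\<^sub>v c" by simp
    have cV: "col V (Suc i) \<in> carrier_vec c" using V by auto
    show ?case
    proof (rule reg[of 0 1])
      show "E *\<^sub>v col V (Suc i) = 0\<^sub>v q"
        unfolding col_mult2[OF E V Suc.prems, symmetric] EV using Suc.prems by simp
      show "pencil A B 0 1 *\<^sub>v col V (Suc i) = 0\<^sub>v r"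
        unfolding pencil_mult_vec[OF A B cV]
      proof (rule eq_vecI)
        fix l assume "l < dim_vec (0\<^sub>v r :: 'a vec)"
        then have l: "l < r" by simp
        have "(A * V) $$ (l, i) = 0" using IH l Suc.prems A V by simp
        then have "(B * V) $$ (l, Suc i) = 0"
          using rel[OF l, of i] Suc.prems by (simp del: index_mult_mat)
        then show "(0 \<cdot>\<^sub>v (A *\<^sub>v col V (Suc i)) + 1 \<cdot>\<^sub>v (B *\<^sub>v col V (Suc i))) $ l = 0\<^sub>v r $ l"
          using l Suc.prems A B V by simp
      qed (use B in auto)
    qed (use cV in auto)
  qed
  then have "V $$ (l, i) = 0" if "l < c" "i < Suc N" for l i
    using that V by (metis carrier_matD index_col index_zero_vec(1))
  then show ?thesis using V by (intro eq_matI) auto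
qed

text \<open>
  The equations read \<open>A v_i + B v_(i+1) = 0\<close> for \<open>N + 1\<close> vectors. A relation between the vectors exists for
  dimension reasons if \<open>c \<le> N\<close>; if \<open>r = N + 1\<close>, the square pencil with columns \<open>A v_i\<close> and \<open>B v_i\<close> has a singular member,
  and regularity turns its kernel vector into a relation.
\<close>

lemma wide_shift_kernel:
  fixes A B E :: "'a::alg_closed_field mat"
  assumes A: "A \<in> carrier_mat r c" and B: "B \<in> carrier_mat r c" and E: "E \<in> carrier_mat q c"
    and reg: "\<And>s t x. (s, t) \<noteq> (0, 0) \<Longrightarrow> x \<in> carrier_vec c \<Longrightarrow> pencil A B s t *\<^sub>v x = 0\<^sub>v r \<Longrightarrow>
      E *\<^sub>v x = 0\<^sub>v q \<Longrightarrow> x = 0\<^sub>v c"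
    and dim: "r = Suc N \<or> c \<le> N"
    and v: "v \<in> carrier_vec (Suc N * c)"
    and eq: "(kron (diag_block N (Suc N)) A + kron (upper_shift N (Suc N)) B) *\<^sub>v v = 0\<^sub>v (N * r)"
    and Ev: "kron (1\<^sub>m (Suc N)) E *\<^sub>v v = 0\<^sub>v (Suc N * q)"
  shows "v = 0\<^sub>v (Suc N * c)"
proof (rule unvec_eq_0D[OF v])
  define V where "V = unvec c (Suc N) v"
  have V: "V \<in> carrier_mat c (Suc N)" unfolding V_def by simp
  have rel: "(A * V) $$ (l, i) + (B * V) $$ (l, Suc i) = 0" if "l < r" "i < N" for i l
  proof -
    have "(\<Sum>j<Suc N. diag_block N (Suc N) $$ (i, j) * (A * V) $$ (l, j)) +
      (\<Sum>j<Suc N. upper_shift N (Suc N) $$ (i, j) * (B * V) $$ (l, j)) = 0"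
      unfolding V_def using that
      by (intro kron_pencil_mult_vec_eq_0[OF _ _ A B v eq]) auto
    moreover have "(\<Sum>j<Suc N. diag_block N (Suc N) $$ (i, j) * (A * V) $$ (l, j)) =
        (\<Sum>j<Suc N. (if j = i then (A * V) $$ (l, j) else 0))"
      using that by (intro sum.cong) (auto simp: diag_block_def simp del: index_mult_mat)
    moreover have "(\<Sum>j<Suc N. upper_shift N (Suc N) $$ (i, j) * (B * V) $$ (l, j)) =
        (\<Sum>j<Suc N. (if j = Suc i then (B * V) $$ (l, j) else 0))"
      using that by (intro sum.cong) (auto simp: upper_shift_def simp del: index_mult_mat)
    ultimately show ?thesis using that by (simp del: index_mult_mat sum.lessThan_Suc)
  qed
  have EV: "E * V = 0\<^sub>m q (Suc N)" unfolding V_def by (rule kron_one_mult_vec_eq_0[OF E v Ev])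
  have "\<exists>w \<in> carrier_vec (Suc N). w \<noteq> 0\<^sub>v (Suc N) \<and> V *\<^sub>v w = 0\<^sub>v c"
  proof (cases "c \<le> N")
    case True
    then show ?thesis using wide_mat_kernel[OF V] by simp
  next
    case False
    then have r: "r = Suc N" using dim by simp
    have AV: "A * V \<in> carrier_mat (Suc N) (Suc N)" and BV: "B * V \<in> carrier_mat (Suc N) (Suc N)"
      using A B V r by auto
    obtain s t w where st: "(s, t) \<noteq> (0, 0)" and w: "w \<in> carrier_vec (Suc N)" "w \<noteq> 0\<^sub>v (Suc N)"
      "pencil (A * V) (B * V) s t *\<^sub>v w = 0\<^sub>v (Suc N)"
      using square_pencil_singular[OF AV BV] by auto
    have Vw: "V *\<^sub>v w \<in> carrier_vec c" using V w by (intro mult_mat_vec_carrier) auto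
    have "pencil A B s t *\<^sub>v (V *\<^sub>v w) = pencil (A * V) (B * V) s t *\<^sub>v w"
      unfolding pencil_mult_vec[OF A B Vw] pencil_mult_vec[OF AV BV w(1)]
        assoc_mult_mat_vec[OF A V w(1)] assoc_mult_mat_vec[OF B V w(1)] ..
    moreover have "E *\<^sub>v (V *\<^sub>v w) = 0\<^sub>v q"
      unfolding assoc_mult_mat_vec[OF E V w(1), symmetric] EV using w by (intro eq_vecI) auto
    ultimately have "V *\<^sub>v w = 0\<^sub>v c" using reg[OF st Vw] w(3) r by simp
    with w show ?thesis by blast
  qed
  then obtain w where w: "w \<in> carrier_vec (Suc N)" "w \<noteq> 0\<^sub>v (Suc N)" "V *\<^sub>v w = 0\<^sub>v c" by blast
  show "unvec c (Suc N) v = 0\<^sub>m c (Suc N)"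
    unfolding V_def[symmetric] by (rule shift_sequence_vanishes[OF A B E reg V rel EV w])
qed

text \<open>
  Allowing two members of the pencil in place of \<open>K\<close> and \<open>L\<close> costs nothing, since a linear substitution can
  be absorbed into \<open>P\<close> and \<open>Q\<close>; it permits the assumption that the first member is regular.
\<close>

lemma det_form_nonvanishing:
  fixes P Q :: "'k::field mat"
  assumes S: "(K, L, M) \<in> lomadze_systems n m p"
    and P: "P \<in> carrier_mat b a" and Q: "Q \<in> carrier_mat b a"
    and inj: "\<And>v. v \<in> carrier_vec (a * n) \<Longrightarrow>
      (kron P (pencil K L s t) + kron Q (pencil K L s' t')) *\<^sub>v v = 0\<^sub>v (b * (n + p)) \<Longrightarrow> v = 0\<^sub>v (a * n)"
    and surj: "\<And>\<phi>. \<phi> \<in> carrier_vec (b * (n + p)) \<Longrightarrow>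
      (kron P (pencil K L s t) + kron Q (pencil K L s' t'))\<^sup>T *\<^sub>v \<phi> = 0\<^sub>v (a * n) \<Longrightarrow>
      (kron (1\<^sub>m b) M)\<^sup>T *\<^sub>v \<phi> = 0\<^sub>v (b * (p + m)) \<Longrightarrow> \<phi> = 0\<^sub>v (b * (n + p))"
  shows "\<exists>f. weight_fun n m p a b f \<and> f (K, L, M) \<noteq> 0"
proof -
  note c = lomadze_systemsD[OF S]
  \<comment> \<open>The substitution in \<open>K, L\<close>, read as one in \<open>P, Q\<close>.\<close>
  define P' Q' where "P' = pencil P Q s s'" and "Q' = pencil P Q t t'"
  have P': "P' \<in> carrier_mat b a" and Q': "Q' \<in> carrier_mat b a"
    unfolding P'_def Q'_def using P Q by auto
  have pen: "pencil K L x y \<in> carrier_mat (n + p) n" for x y using c by auto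
  have eq: "kron P' K + kron Q' L = kron P (pencil K L s t) + kron Q (pencil K L s' t')" (is "?X = ?Y")
  proof (rule eq_matI)
    note k = kron_carrier[OF P' c(1)] kron_carrier[OF Q' c(2)] kron_carrier[OF P pen[of s t]]
      kron_carrier[OF Q pen[of s' t']]
    show "dim_row ?X = dim_row ?Y" "dim_col ?X = dim_col ?Y"
      using k by auto
    fix i j assume "i < dim_row ?Y" "j < dim_col ?Y"
    then have ij: "i < b * (n + p)" "j < a * n" using k(4) by auto
    note dm = div_mod_less[OF ij(1)] div_mod_less[OF ij(2)]
    let ?i = "i div (n + p)" and ?j = "j div n" and ?k = "i mod (n + p)" and ?l = "j mod n"
    have "?X $$ (i, j) = P' $$ (?i, ?j) * K $$ (?k, ?l) + Q' $$ (?i, ?j) * L $$ (?k, ?l)"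
      unfolding kron_index[OF P' c(1) ij, symmetric] kron_index[OF Q' c(2) ij, symmetric]
      using ij k(2) by (intro index_add_mat(1)) auto
    also have "\<dots> = P $$ (?i, ?j) * pencil K L s t $$ (?k, ?l) + Q $$ (?i, ?j) * pencil K L s' t' $$ (?k, ?l)"
      using dm P Q c by (simp add: P'_def Q'_def algebra_simps)
    also have "\<dots> = ?Y $$ (i, j)"
      unfolding kron_index[OF P pen ij, symmetric] kron_index[OF Q pen ij, symmetric]
      using ij k(4) by (intro index_add_mat(1)[symmetric]) auto
    finally show "?X $$ (i, j) = ?Y $$ (i, j)" .
  qed
  have X: "?X \<in> carrier_mat (b * (n + p)) (a * n)"
    using kron_carrier[OF P' c(1)] kron_carrier[OF Q' c(2)] by simp
  obtain R where le: "a * n \<le> b * (n + p)" and R: "R \<in> carrier_mat (b * (p + m)) (b * (n + p) - a * n)"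
    and det: "det (hconcat ?X (kron (1\<^sub>m b) M * R)) \<noteq> 0"
    using extend_columns[OF X kron_carrier[OF one_carrier_mat c(3)]] inj surj unfolding eq by blast
  have "det_form P' Q' R (K, L, M) \<noteq> 0"
    using det P' unfolding det_form_def by simp
  with det_form_weight[OF P' Q' R le] show ?thesis by blast
qed

lemma independent_direction:
  fixes s t :: "'a::field"
  assumes "(s, t) \<noteq> (0, 0)"
  obtains s' t' where "\<And>x y. (x, y) \<noteq> (0, 0) \<Longrightarrow> (x * s + y * s', x * t + y * t') \<noteq> (0, 0)"
proof (cases "s = 0")
  case False
  show ?thesis by (rule that[of 0 1]) (use False in auto)
next
  case True
  show ?thesis by (rule that[of 1 0]) (use True assms in auto)
qed

lemma pencil_pencil:
  fixes K L :: "'a::comm_ring_1 mat"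
  assumes "K \<in> carrier_mat r c" "L \<in> carrier_mat r c"
  shows "pencil (pencil K L s t) (pencil K L s' t') x y = pencil K L (x * s + y * s') (x * t + y * t')"
  using assms by (intro eq_matI) (auto simp: algebra_simps)

lemma regular_point_nonvanishing:
  fixes K L M :: "'k::field mat"
  assumes S: "(K, L, M) \<in> lomadze_systems n m p"
    and inj: "injective_mat (pencil K L s t)" and surj: "surjective_mat (hconcat (pencil K L s t) M)"
  shows "\<exists>f. weight_fun n m p 1 1 f \<and> f (K, L, M) \<noteq> 0"
proof (rule det_form_nonvanishing[OF S one_carrier_mat zero_carrier_mat, of 1 s t 0 0])
  note c = lomadze_systemsD[OF S]
  have pen: "pencil K L x y \<in> carrier_mat (n + p) n" for x y using c by auto
  have k1: "kron (1\<^sub>m 1) A = A" if "A \<in> carrier_mat r q" for A :: "'k mat" and r q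
    using that kron_carrier[OF one_carrier_mat[of 1] that] div_mod_less[of _ 1]
    by (intro eq_matI) (auto simp: kron_index[OF one_carrier_mat that])
  have k0: "kron (0\<^sub>m 1 1) A = 0\<^sub>m r q" if "A \<in> carrier_mat r q" for A :: "'k mat" and r q
    using that kron_carrier[OF zero_carrier_mat[of 1 1] that] div_mod_less[of _ 1]
    by (intro eq_matI) (auto simp: kron_index[OF zero_carrier_mat that])
  have X: "kron (1\<^sub>m 1) (pencil K L s t) + kron (0\<^sub>m 1 1) (pencil K L 0 0) = pencil K L s t"
    unfolding k1[OF pen] k0[OF pen] using right_add_zero_mat[OF pen] .
  show "v = 0\<^sub>v (1 * n)" if "v \<in> carrier_vec (1 * n)"
    "(kron (1\<^sub>m 1) (pencil K L s t) + kron (0\<^sub>m 1 1) (pencil K L 0 0)) *\<^sub>v v = 0\<^sub>v (1 * (n + p))" for v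
    using injective_matD[OF inj pen] that unfolding X by simp
  show "\<phi> = 0\<^sub>v (1 * (n + p))" if "\<phi> \<in> carrier_vec (1 * (n + p))"
    "(kron (1\<^sub>m 1) (pencil K L s t) + kron (0\<^sub>m 1 1) (pencil K L 0 0))\<^sup>T *\<^sub>v \<phi> = 0\<^sub>v (1 * n)"
    "(kron (1\<^sub>m 1) M)\<^sup>T *\<^sub>v \<phi> = 0\<^sub>v (1 * (p + m))" for \<phi>
    using surj that unfolding X k1[OF c(3)] surjective_hconcat_iff[OF pen c(3)] by simp
qed

lemma transpose_kron_pencil:
  assumes P: "P \<in> carrier_mat b a" and Q: "Q \<in> carrier_mat b a"
    and A: "A \<in> carrier_mat r c" and B: "B \<in> carrier_mat r c"
  shows "(kron P A + kron Q B)\<^sup>T = kron P\<^sup>T A\<^sup>T + kron Q\<^sup>T B\<^sup>T"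
  using transpose_add[OF kron_carrier[OF P A] kron_carrier[OF Q B]]
    transpose_kron[OF P A] transpose_kron[OF Q B] by simp

lemma kron_empty_mult_vec:
  assumes "v \<in> carrier_vec (a * n)"
  shows "kron (1\<^sub>m a) (0\<^sub>m 0 n) *\<^sub>v v = 0\<^sub>v (a * 0)"
  using kron_carrier[OF one_carrier_mat[of a] zero_carrier_mat[of 0 n]] by (intro eq_vecI) auto

text \<open>
  With a regular first member \<open>A\<close> of the pencil, injectivity is immediate from \<open>tall_shift_kernel\<close>; the
  surjectivity is \<open>wide_shift_kernel\<close> for the transposed pencil, with \<open>M\<^sup>T\<close> as additional equation.
\<close>

lemma controllable_shift_nonvanishing:
  fixes K L M :: "'k::alg_closed_field mat"
  assumes S: "(K, L, M) \<in> lomadze_systems (Suc N) m p"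
    and st: "(s, t) \<noteq> (0, 0)" and inj: "injective_mat (pencil K L s t)"
    and surj: "\<And>s t. (s, t) \<noteq> (0, 0) \<Longrightarrow> surjective_mat (hconcat (pencil K L s t) M)"
  shows "\<exists>f. weight_fun (Suc N) m p N (Suc N) f \<and> f (K, L, M) \<noteq> 0"
proof -
  note c = lomadze_systemsD[OF S]
  have pen: "pencil K L x y \<in> carrier_mat (Suc N + p) (Suc N)" for x y using c by auto
  obtain s' t' where st': "\<And>x y. (x, y) \<noteq> (0, 0) \<Longrightarrow> (x * s + y * s', x * t + y * t') \<noteq> (0, 0)"
    using independent_direction[OF st] by metis
  define A B where "A = pencil K L s t" and "B = pencil K L s' t'"
  have A: "A \<in> carrier_mat (Suc N + p) (Suc N)" and B: "B \<in> carrier_mat (Suc N + p) (Suc N)"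
    unfolding A_def B_def using pen by auto
  have AT: "A\<^sup>T \<in> carrier_mat (Suc N) (Suc N + p)" "B\<^sup>T \<in> carrier_mat (Suc N) (Suc N + p)"
    "M\<^sup>T \<in> carrier_mat (p + m) (Suc N + p)" using A B c by auto
  let ?P = "diag_block (Suc N) N :: 'k mat" and ?Q = "lower_shift (Suc N) N :: 'k mat"
  show ?thesis
  proof (rule det_form_nonvanishing[OF S, of ?P _ _ ?Q s t s' t', folded A_def B_def])
    show "v = 0\<^sub>v (N * Suc N)" if v: "v \<in> carrier_vec (N * Suc N)"
      "(kron ?P A + kron ?Q B) *\<^sub>v v = 0\<^sub>v (Suc N * (Suc N + p))" for v
      by (rule tall_shift_kernel[OF A B zero_carrier_mat _ v kron_empty_mult_vec[OF v(1)]])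
        (rule injective_matD[OF inj[folded A_def] A])
    fix \<phi> assume \<phi>: "\<phi> \<in> carrier_vec (Suc N * (Suc N + p))"
      "(kron ?P A + kron ?Q B)\<^sup>T *\<^sub>v \<phi> = 0\<^sub>v (N * Suc N)"
      "(kron (1\<^sub>m (Suc N)) M)\<^sup>T *\<^sub>v \<phi> = 0\<^sub>v (Suc N * (p + m))"
    show "\<phi> = 0\<^sub>v (Suc N * (Suc N + p))"
    proof (rule wide_shift_kernel[OF AT _ _ \<phi>(1)])
      show "(kron (diag_block N (Suc N)) A\<^sup>T + kron (upper_shift N (Suc N)) B\<^sup>T) *\<^sub>v \<phi> = 0\<^sub>v (N * Suc N)"
        using \<phi>(2) transpose_kron_pencil[of ?P "Suc N" N ?Q, OF _ _ A B] by simp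
      show "kron (1\<^sub>m (Suc N)) M\<^sup>T *\<^sub>v \<phi> = 0\<^sub>v (Suc N * (p + m))"
        using \<phi>(3) transpose_kron[OF one_carrier_mat c(3)] by simp
      fix x y z
      assume "(x, y) \<noteq> (0, 0)" and z: "z \<in> carrier_vec (Suc N + p)"
        "pencil A\<^sup>T B\<^sup>T x y *\<^sub>v z = 0\<^sub>v (Suc N)" "M\<^sup>T *\<^sub>v z = 0\<^sub>v (p + m)"
      from surj[OF st'[OF this(1)]] have "surjective_mat (hconcat (pencil A B x y) M)"
        unfolding A_def B_def pencil_pencil[OF c(1,2)] .
      then show "z = 0\<^sub>v (Suc N + p)"
        using z unfolding surjective_hconcat_iff[OF pencil_carrier[OF A B] c(3)] pencil_transpose[OF A B]
        by blast
    qed simp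
  qed auto
qed

text \<open>
  The roles of the two kernel lemmas are exchanged, since the shift matrices are transposed.
\<close>

lemma observable_shift_nonvanishing:
  fixes K L M :: "'k::alg_closed_field mat"
  assumes S: "(K, L, M) \<in> lomadze_systems n m p"
    and st: "(s, t) \<noteq> (0, 0)" and surj: "surjective_mat (hconcat (pencil K L s t) M)"
    and inj: "\<And>s t. (s, t) \<noteq> (0, 0) \<Longrightarrow> injective_mat (pencil K L s t)"
  shows "\<exists>f. weight_fun n m p (Suc n) n f \<and> f (K, L, M) \<noteq> 0"
proof -
  note c = lomadze_systemsD[OF S]
  have pen: "pencil K L x y \<in> carrier_mat (n + p) n" for x y using c by auto
  obtain s' t' where st': "\<And>x y. (x, y) \<noteq> (0, 0) \<Longrightarrow> (x * s + y * s', x * t + y * t') \<noteq> (0, 0)"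
    using independent_direction[OF st] by metis
  define A B where "A = pencil K L s t" and "B = pencil K L s' t'"
  have A: "A \<in> carrier_mat (n + p) n" and B: "B \<in> carrier_mat (n + p) n"
    unfolding A_def B_def using pen by auto
  have AT: "A\<^sup>T \<in> carrier_mat n (n + p)" "B\<^sup>T \<in> carrier_mat n (n + p)"
    "M\<^sup>T \<in> carrier_mat (p + m) (n + p)" using A B c by auto
  let ?P = "diag_block n (Suc n) :: 'k mat" and ?Q = "upper_shift n (Suc n) :: 'k mat"
  show ?thesis
  proof (rule det_form_nonvanishing[OF S, of ?P _ _ ?Q s t s' t', folded A_def B_def])
    fix v assume v: "v \<in> carrier_vec (Suc n * n)" "(kron ?P A + kron ?Q B) *\<^sub>v v = 0\<^sub>v (n * (n + p))"
    show "v = 0\<^sub>v (Suc n * n)"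
    proof (rule wide_shift_kernel[OF A B zero_carrier_mat _ _ v kron_empty_mult_vec[OF v(1)]])
      fix x y z
      assume "(x, y) \<noteq> (0, 0)" and z: "z \<in> carrier_vec n" "pencil A B x y *\<^sub>v z = 0\<^sub>v (n + p)"
      from inj[OF st'[OF this(1)]] have "injective_mat (pencil A B x y)"
        unfolding A_def B_def pencil_pencil[OF c(1,2)] .
      then show "z = 0\<^sub>v n" by (rule injective_matD[OF _ pencil_carrier[OF A B] z])
    qed simp
  next
    fix \<phi> assume \<phi>: "\<phi> \<in> carrier_vec (n * (n + p))"
      "(kron ?P A + kron ?Q B)\<^sup>T *\<^sub>v \<phi> = 0\<^sub>v (Suc n * n)"
      "(kron (1\<^sub>m n) M)\<^sup>T *\<^sub>v \<phi> = 0\<^sub>v (n * (p + m))"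
    show "\<phi> = 0\<^sub>v (n * (n + p))"
    proof (rule tall_shift_kernel[OF AT _ \<phi>(1)])
      show "(kron (diag_block (Suc n) n) A\<^sup>T + kron (lower_shift (Suc n) n) B\<^sup>T) *\<^sub>v \<phi> = 0\<^sub>v (Suc n * n)"
        using \<phi>(2) transpose_kron_pencil[of ?P n "Suc n" ?Q, OF _ _ A B] by simp
      show "kron (1\<^sub>m n) M\<^sup>T *\<^sub>v \<phi> = 0\<^sub>v (n * (p + m))"
        using \<phi>(3) transpose_kron[OF one_carrier_mat c(3)] by simp
      fix z assume "z \<in> carrier_vec (n + p)" "A\<^sup>T *\<^sub>v z = 0\<^sub>v n" "M\<^sup>T *\<^sub>v z = 0\<^sub>v (p + m)"
      then show "z = 0\<^sub>v (n + p)"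
        using surj unfolding A_def surjective_hconcat_iff[OF pen c(3)] by blast
    qed
  qed auto
qed

text \<open>
  The weight \<open>(a, b)\<close> is \<open>i (1, 1) + j (n - 1, n)\<close> with \<open>j = b - a\<close> and \<open>i = b - j n\<close>; the slope condition is
  the positivity of \<open>i\<close>.
\<close>

lemma controllable_semi_invariant:
  fixes S :: "'k::alg_closed_field lomadze"
  assumes "n > 0" and S: "S \<in> lomadze_systems n m p" and ctrl: "controllable n p S"
    and "a < b" and slope: "b * n < a * n + b"
  shows "\<exists>f. weight_fun n m p a b f \<and> f S \<noteq> 0"
proof -
  obtain K L M where SS: "S = (K, L, M)" by (cases S)
  note S' = S[unfolded SS]
  obtain s t where inj: "injective_mat (pencil K L s t)"
    and surj: "\<And>s t. (s, t) \<noteq> (0, 0) \<Longrightarrow> surjective_mat (hconcat (pencil K L s t) M)"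
    using ctrl controllable_iff[OF S'] unfolding SS by blast
  have c: "K \<in> carrier_mat (n + p) n" "L \<in> carrier_mat (n + p) n"
    using S' unfolding lomadze_systems_iff by auto
  have st: "(s, t) \<noteq> (0, 0)"
  proof
    assume "(s, t) = (0, 0)"
    then have "pencil K L s t *\<^sub>v unit_vec n 0 = 0\<^sub>v (n + p)"
      using c by (intro eq_vecI) (auto simp: pencil_mult_vec[OF c])
    then have "unit_vec n 0 = (0\<^sub>v n :: 'k vec)"
      using injective_matD[OF inj pencil_carrier[OF c]] by simp
    then show False using \<open>n > 0\<close> by simp
  qed
  obtain f1 where f1: "weight_fun n m p 1 1 f1" "f1 S \<noteq> 0"
    using regular_point_nonvanishing[OF S' inj surj[OF st]] unfolding SS by blast
  obtain N where n: "n = Suc N" using \<open>n > 0\<close> by (cases n) auto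
  obtain f2 where f2: "weight_fun n m p N n f2" "f2 S \<noteq> 0"
    using controllable_shift_nonvanishing[OF S'[unfolded n] st inj surj] unfolding n SS by blast
  define j i where "j = b - a" and "i = b - j * n"
  have b: "b = a + j" using \<open>a < b\<close> unfolding j_def by simp
  have "j * n < b" using slope unfolding b by (simp add: algebra_simps)
  then have i: "b = i + j * n" unfolding i_def by simp
  then have "a = i + j * N" using b unfolding n by simp
  with i have "weight_fun n m p a b (\<lambda>x. f1 x ^ i * f2 x ^ j)"
    using weight_fun_mult[OF weight_fun_power[OF f1(1), of i] weight_fun_power[OF f2(1), of j]] by simp
  with f1 f2 show ?thesis by (intro exI[of _ "\<lambda>x. f1 x ^ i * f2 x ^ j"]) simp
qed

text \<open>
  Here \<open>(a, b) = i (1, 1) + j (n + 1, n)\<close> with \<open>j = a - b\<close> and \<open>i = b - j n\<close>.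
\<close>

lemma observable_semi_invariant:
  fixes S :: "'k::alg_closed_field lomadze"
  assumes S: "S \<in> lomadze_systems n m p" and obs: "observable n p S"
    and "b < a" and slope: "a * n < b * n + b"
  shows "\<exists>f. weight_fun n m p a b f \<and> f S \<noteq> 0"
proof -
  obtain K L M where SS: "S = (K, L, M)" by (cases S)
  note S' = S[unfolded SS]
  note c = lomadze_systemsD[OF S']
  have inj: "\<And>s t. (s, t) \<noteq> (0, 0) \<Longrightarrow> injective_mat (pencil K L s t)"
    using obs observable_iff[OF S'] unfolding SS by blast
  obtain s0 t0 where surj0: "surjective_mat (hconcat (pencil K L s0 t0) M)"
    using obs observable_iff[OF S'] unfolding SS by blast
  \<comment> \<open>If \<open>M\<close> alone is surjective, the point may be \<open>(0, 0)\<close>; then every other point will do.\<close>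
  obtain s t where st: "(s, t) \<noteq> (0, 0)" and surj: "surjective_mat (hconcat (pencil K L s t) M)"
  proof (cases "(s0, t0) = (0, 0)")
    case True
    have "(pencil K L s0 t0)\<^sup>T *\<^sub>v \<phi> = 0\<^sub>v n" if "\<phi> \<in> carrier_vec (n + p)" for \<phi>
      using True c that unfolding pencil_transpose[OF c(1,2)]
      by (intro eq_vecI) (auto simp: pencil_mult_vec[of "K\<^sup>T" n "n + p"])
    then have "surjective_mat (hconcat (pencil K L 1 0) M)"
      using surj0 unfolding surjective_hconcat_iff[OF pencil_carrier[OF c(1,2)] c(3)] by blast
    then show ?thesis using that[of 1 0] by simp
  next
    case False
    then show ?thesis using that surj0 by blast
  qed
  obtain f1 where f1: "weight_fun n m p 1 1 f1" "f1 S \<noteq> 0"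
    using regular_point_nonvanishing[OF S' inj[OF st] surj] unfolding SS by blast
  obtain f2 where f2: "weight_fun n m p (Suc n) n f2" "f2 S \<noteq> 0"
    using observable_shift_nonvanishing[OF S' st surj inj] unfolding SS by blast
  define j i where "j = a - b" and "i = b - j * n"
  have a: "a = b + j" using \<open>b < a\<close> unfolding j_def by simp
  have "j * n < b" using slope unfolding a by (simp add: algebra_simps)
  then have i: "b = i + j * n" unfolding i_def by simp
  then have "a = i + j * Suc n" using a by simp
  with i have "weight_fun n m p a b (\<lambda>x. f1 x ^ i * f2 x ^ j)"
    using weight_fun_mult[OF weight_fun_power[OF f1(1), of i] weight_fun_power[OF f2(1), of j]] by simp
  with f1 f2 show ?thesis by (intro exI[of _ "\<lambda>x. f1 x ^ i * f2 x ^ j"]) simp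
qed

section \<open>Homeomorphisms of Zariski topologies\<close>

lemma irreducible_closed_image:
  assumes f: "homeomorphic_map T T' f" and Z: "irreducible_closed T Z"
  shows "irreducible_closed T' (f ` Z)"
  unfolding irreducible_closed_def
proof (intro conjI allI impI)
  have ZT: "closedin T Z" "Z \<subseteq> topspace T" "Z \<noteq> {}"
    using Z closedin_subset unfolding irreducible_closed_def by auto
  show "closedin T' (f ` Z)"
    using homeomorphic_map_closedness_eq[OF f, of Z] ZT by simp
  show "f ` Z \<noteq> {}" using ZT by simp
  fix A B assume AB: "closedin T' A \<and> closedin T' B \<and> f ` Z = A \<union> B"
  have cont: "continuous_map T T' f" using f homeomorphic_imp_continuous_map by blast
  define pre where "pre A = Z \<inter> {x \<in> topspace T. f x \<in> A}" for A
  have "closedin T (pre A)" "closedin T (pre B)"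
    unfolding pre_def using AB ZT(1) closedin_continuous_map_preimage[OF cont]
    by (auto intro!: closedin_Int)
  moreover have "Z = pre A \<union> pre B" unfolding pre_def using AB ZT(2) by blast
  ultimately have "Z = pre A \<or> Z = pre B" using Z unfolding irreducible_closed_def by blast
  then show "f ` Z = A \<or> f ` Z = B" unfolding pre_def using AB by blast
qed

lemma krull_dim_mono_homeomorphic:
  assumes f: "homeomorphic_map T T' f"
  shows "krull_dim T \<le> krull_dim T'"
  unfolding krull_dim_def
proof (rule Sup_subset_mono, safe)
  fix d :: nat and Z :: "nat \<Rightarrow> 'a set"
  assume Z: "\<forall>i\<le>d. irreducible_closed T (Z i)" "\<forall>i<d. Z i \<subset> Z (Suc i)"
  have inj: "inj_on f (topspace T)" using f homeomorphic_imp_injective_map by blast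
  have "f ` Z i \<subset> f ` Z (Suc i)" if "i < d" for i
  proof (rule image_strict_mono)
    have "Z (Suc i) \<subseteq> topspace T"
      using Z(1) that closedin_subset unfolding irreducible_closed_def by (metis Suc_leI)
    with inj show "inj_on f (Z (Suc i))" by (rule inj_on_subset)
    show "Z i \<subset> Z (Suc i)" using Z(2) that by blast
  qed
  then show "\<exists>d'. enat d = enat d' \<and> (\<exists>Z. (\<forall>i\<le>d'. irreducible_closed T' (Z i)) \<and> (\<forall>i<d'. Z i \<subset> Z (Suc i)))"
    using Z(1) irreducible_closed_image[OF f] by (intro exI[of _ d] conjI exI[of _ "\<lambda>i. f ` Z i"]) auto
qed

lemma krull_dim_homeomorphic:
  assumes "homeomorphic_map T T' f"
  shows "krull_dim T = krull_dim T'"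
proof -
  obtain g where "homeomorphic_maps T T' f g" using assms homeomorphic_map_maps by blast
  then have "homeomorphic_map T' T g" using homeomorphic_maps_sym homeomorphic_maps_imp_map by blast
  from krull_dim_mono_homeomorphic[OF assms] krull_dim_mono_homeomorphic[OF this]
  show ?thesis by (rule antisym)
qed

text \<open>
  Hence one set of coordinates serves the ambient space, the nonvanishing locus of a semi-invariant and
  an orbit.
\<close>

lemma subtopology_zariski:
  assumes "Y \<subseteq> X"
  shows "subtopology (zariski C X) Y = zariski C Y"
proof -
  have "openin (subtopology (zariski C X) Y) U \<longleftrightarrow> openin (zariski C Y) U" for U
  proof
    assume "openin (subtopology (zariski C X) Y) U"
    then obtain F where F: "F \<subseteq> regular_functions C" "U = {x \<in> X. \<exists>f\<in>F. f x \<noteq> 0} \<inter> Y"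
      unfolding openin_subtopology openin_zariski by blast
    have "U = {x \<in> Y. \<exists>f\<in>F. f x \<noteq> 0}" unfolding F(2) using assms by blast
    with F(1) show "openin (zariski C Y) U" unfolding openin_zariski by (intro exI[of _ F] conjI)
  next
    assume "openin (zariski C Y) U"
    then obtain F where F: "F \<subseteq> regular_functions C" "U = {x \<in> Y. \<exists>f\<in>F. f x \<noteq> 0}"
      unfolding openin_zariski by blast
    have "U = {x \<in> X. \<exists>f\<in>F. f x \<noteq> 0} \<inter> Y" unfolding F(2) using assms by blast
    moreover have "openin (zariski C X) {x \<in> X. \<exists>f\<in>F. f x \<noteq> 0}"
      unfolding openin_zariski using F(1) by (intro exI[of _ F] conjI refl)
    ultimately show "openin (subtopology (zariski C X) Y) U"
      unfolding openin_subtopology by (intro exI conjI)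
  qed
  then show ?thesis by (simp add: topology_eq)
qed

text \<open>
  Regular functions in the sense of algebraic geometry: near each point a quotient of polynomial
  functions.
\<close>

definition locally_fraction :: "('x \<Rightarrow> 'k::idom) set \<Rightarrow> 'x set \<Rightarrow> ('x \<Rightarrow> 'k) \<Rightarrow> bool" where
  "locally_fraction C X h \<longleftrightarrow> (\<forall>x0\<in>X. \<exists>q p. regular_on C X q \<and> regular_on C X p \<and> q x0 \<noteq> 0 \<and>
    (\<forall>x\<in>X. q x * h x = p x))"

lemma locally_fraction_regular: "regular_on C X h \<Longrightarrow> locally_fraction C X h"
  unfolding locally_fraction_def
  by (intro ballI exI[of _ "\<lambda>_. 1"] exI[of _ h]) (auto intro: regular_on_const)

lemma locally_fractionE:
  assumes "locally_fraction C X h" "x0 \<in> X"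
  obtains q p where "regular_on C X q" "regular_on C X p" "q x0 \<noteq> 0" "\<And>x. x \<in> X \<Longrightarrow> q x * h x = p x"
  using assms unfolding locally_fraction_def by blast

lemma locally_fraction_add:
  assumes h: "locally_fraction C X h" and h': "locally_fraction C X h'"
  shows "locally_fraction C X (\<lambda>x. h x + h' x)"
  unfolding locally_fraction_def
proof
  fix x0 assume x0: "x0 \<in> X"
  obtain q p where qp: "regular_on C X q" "regular_on C X p" "q x0 \<noteq> 0" "\<And>x. x \<in> X \<Longrightarrow> q x * h x = p x"
    using locally_fractionE[OF h x0] by metis
  obtain q' p' where qp': "regular_on C X q'" "regular_on C X p'" "q' x0 \<noteq> 0"
    "\<And>x. x \<in> X \<Longrightarrow> q' x * h' x = p' x"
    using locally_fractionE[OF h' x0] by metis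
  have "q x * q' x * (h x + h' x) = q' x * p x + q x * p' x" if "x \<in> X" for x
    unfolding qp(4)[OF that, symmetric] qp'(4)[OF that, symmetric] by (simp add: algebra_simps)
  with qp(1-3) qp'(1-3)
  show "\<exists>q p. regular_on C X q \<and> regular_on C X p \<and> q x0 \<noteq> 0 \<and> (\<forall>x\<in>X. q x * (h x + h' x) = p x)"
    by (intro exI[of _ "\<lambda>x. q x * q' x"] exI[of _ "\<lambda>x. q' x * p x + q x * p' x"] conjI
      regular_on_mult regular_on_add ballI) auto
qed

lemma locally_fraction_mult:
  assumes h: "locally_fraction C X h" and h': "locally_fraction C X h'"
  shows "locally_fraction C X (\<lambda>x. h x * h' x)"
  unfolding locally_fraction_def
proof
  fix x0 assume x0: "x0 \<in> X"
  obtain q p where qp: "regular_on C X q" "regular_on C X p" "q x0 \<noteq> 0" "\<And>x. x \<in> X \<Longrightarrow> q x * h x = p x"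
    using locally_fractionE[OF h x0] by metis
  obtain q' p' where qp': "regular_on C X q'" "regular_on C X p'" "q' x0 \<noteq> 0"
    "\<And>x. x \<in> X \<Longrightarrow> q' x * h' x = p' x"
    using locally_fractionE[OF h' x0] by metis
  have "q x * q' x * (h x * h' x) = p x * p' x" if "x \<in> X" for x
    unfolding qp(4)[OF that, symmetric] qp'(4)[OF that, symmetric] by (simp add: mult_ac)
  with qp(1-3) qp'(1-3)
  show "\<exists>q p. regular_on C X q \<and> regular_on C X p \<and> q x0 \<noteq> 0 \<and> (\<forall>x\<in>X. q x * (h x * h' x) = p x)"
    by (intro exI[of _ "\<lambda>x. q x * q' x"] exI[of _ "\<lambda>x. p x * p' x"] conjI
      regular_on_mult ballI) auto
qed

lemma locally_fraction_sum:
  "(\<And>i. i \<in> I \<Longrightarrow> locally_fraction C X (h i)) \<Longrightarrow> locally_fraction C X (\<lambda>x. \<Sum>i\<in>I. h i x)"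
  by (induction I rule: infinite_finite_induct)
    (auto intro: locally_fraction_add locally_fraction_regular[OF regular_on_const])

lemma locally_fraction_cong:
  "(\<And>x. x \<in> X \<Longrightarrow> f x = g x) \<Longrightarrow> locally_fraction C X f \<longleftrightarrow> locally_fraction C X g"
  unfolding locally_fraction_def by simp

lemma openin_locally_fraction:
  assumes h: "locally_fraction C X h"
  shows "openin (zariski C X) {x \<in> X. h x \<noteq> 0}"
proof (subst openin_subopen, safe)
  fix x0 assume x0: "x0 \<in> X" "h x0 \<noteq> 0"
  obtain q p where qp: "regular_on C X q" "regular_on C X p" "q x0 \<noteq> 0" "\<And>x. x \<in> X \<Longrightarrow> q x * h x = p x"
    using h x0 unfolding locally_fraction_def by blast
  obtain f where f: "f \<in> regular_functions C" "\<And>x. x \<in> X \<Longrightarrow> q x * p x = f x"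
    using regular_on_mult[OF qp(1,2)] unfolding regular_on_def by blast
  have "openin (zariski C X) {x \<in> X. f x \<noteq> 0}"
    unfolding openin_zariski using f(1) by (intro exI[of _ "{f}"]) auto
  moreover have "x0 \<in> {x \<in> X. f x \<noteq> 0}"
    using x0 qp(3) qp(4)[of x0, symmetric] f(2)[of x0, symmetric] by simp
  moreover have "{x \<in> X. f x \<noteq> 0} \<subseteq> {x \<in> X. h x \<noteq> 0}"
  proof safe
    fix x assume "x \<in> X" "f x \<noteq> 0" "h x = 0"
    then show False using f(2)[of x] qp(4)[of x] by simp
  qed
  ultimately show "\<exists>U. openin (zariski C X) U \<and> x0 \<in> U \<and> U \<subseteq> {x \<in> X. h x \<noteq> 0}" by blast
qed

lemma continuous_map_zariski:
  assumes \<phi>: "\<And>x. x \<in> X \<Longrightarrow> \<phi> x \<in> Y"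
    and coord: "\<And>c. c \<in> C' \<Longrightarrow> locally_fraction C X (\<lambda>x. c (\<phi> x))"
  shows "continuous_map (zariski C X) (zariski C' Y) \<phi>"
  unfolding continuous_map_def
proof (intro conjI allI impI)
  show "\<phi> \<in> topspace (zariski C X) \<rightarrow> topspace (zariski C' Y)" using \<phi> by auto
  have frac: "locally_fraction C X (\<lambda>x. f (\<phi> x))" if "f \<in> regular_functions C'" for f
    using that
    by induction (auto intro: coord locally_fraction_add locally_fraction_mult
      locally_fraction_regular[OF regular_on_const])
  fix U assume "openin (zariski C' Y) U"
  then obtain F where F: "F \<subseteq> regular_functions C'" "U = {y \<in> Y. \<exists>f\<in>F. f y \<noteq> 0}"
    unfolding openin_zariski by blast
  have "{x \<in> topspace (zariski C X). \<phi> x \<in> U} = (\<Union>f\<in>F. {x \<in> X. f (\<phi> x) \<noteq> 0})"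
    unfolding F(2) using \<phi> by auto
  also have "openin (zariski C X) \<dots>"
    using F(1) openin_locally_fraction[OF frac] by (intro openin_Union) auto
  finally show "openin (zariski C X) {x \<in> topspace (zariski C X). \<phi> x \<in> U}" .
qed

text \<open>
  Near \<open>x0\<close>, a left inverse \<open>B\<close> of \<open>E x0\<close> turns the system into a square one that is still regular, and
  Cramer's rule applies.
\<close>

lemma locally_fraction_linear_solution:
  fixes E :: "'x \<Rightarrow> 'k::field mat"
  assumes E: "regular_mat C X r d E" and inj: "\<And>x. x \<in> X \<Longrightarrow> injective_mat (E x)"
    and v: "\<And>x. x \<in> X \<Longrightarrow> v x \<in> carrier_vec d" and sol: "\<And>x. x \<in> X \<Longrightarrow> E x *\<^sub>v v x = \<beta> x"
    and \<beta>: "\<And>i. i < r \<Longrightarrow> regular_on C X (\<lambda>x. \<beta> x $ i)" and j: "j < d"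
  shows "locally_fraction C X (\<lambda>x. v x $ j)"
  unfolding locally_fraction_def
proof
  fix x0 assume x0: "x0 \<in> X"
  have cE: "E x \<in> carrier_mat r d" if "x \<in> X" for x using E that unfolding regular_mat_def by blast
  obtain B where B: "B \<in> carrier_mat d r" "B * E x0 = 1\<^sub>m d"
    using inj[OF x0] cE[OF x0] unfolding injective_mat_def by auto
  have BE: "regular_mat C X d d (\<lambda>x. B * E x)"
    by (rule regular_mat_mult[OF regular_mat_const[OF B(1)] E])
  define q where "q x = det (B * E x)" for x
  define p where "p x = det (replace_col (B * E x) (B *\<^sub>v \<beta> x) j)" for x
  have cb: "\<beta> x \<in> carrier_vec r" if "x \<in> X" for x
    unfolding sol[OF that, symmetric] using cE[OF that] v[OF that] by auto
  have "regular_mat C X d d (\<lambda>x. replace_col (B * E x) (B *\<^sub>v \<beta> x) j)"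
    unfolding regular_mat_def
  proof (intro conjI allI impI ballI)
    show "replace_col (B * E x) (B *\<^sub>v \<beta> x) j \<in> carrier_mat d d" if "x \<in> X" for x
      using B cE[OF that] unfolding replace_col_def by auto
    fix i k assume ik: "i < d" "k < d"
    have "replace_col (B * E x) (B *\<^sub>v \<beta> x) j $$ (i, k) =
        (if k = j then \<Sum>l<r. B $$ (i, l) * \<beta> x $ l else (B * E x) $$ (i, k))" if "x \<in> X" for x
    proof (cases "k = j")
      case True
      have "(B *\<^sub>v \<beta> x) $ i = (\<Sum>l<r. B $$ (i, l) * \<beta> x $ l)"
        using ik(1) B(1) cb[OF that] by (simp add: scalar_prod_def atLeast0LessThan)
      then show ?thesis using True ik B cE[OF that] unfolding replace_col_def by simp
    next
      case False
      then show ?thesis using ik B cE[OF that] unfolding replace_col_def by simp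
    qed
    moreover have "regular_on C X (\<lambda>x. if k = j then \<Sum>l<r. B $$ (i, l) * \<beta> x $ l else (B * E x) $$ (i, k))"
      using ik BE \<beta> unfolding regular_mat_def
      by (cases "k = j") (auto simp del: index_mult_mat intro!: regular_on_sum regular_on_mult regular_on_const)
    ultimately show "regular_on C X (\<lambda>x. replace_col (B * E x) (B *\<^sub>v \<beta> x) j $$ (i, k))"
      by (simp cong: regular_on_cong del: index_mult_mat)
  qed
  then have "regular_on C X p" unfolding p_def by (rule regular_on_det)
  moreover have "regular_on C X q" unfolding q_def by (rule regular_on_det[OF BE])
  moreover have "q x0 \<noteq> 0" unfolding q_def B(2) by simp
  moreover have "q x * v x $ j = p x" if "x \<in> X" for x
  proof -
    have c: "B * E x \<in> carrier_mat d d" using B cE[OF that] by simp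
    have "(B * E x) *\<^sub>v v x = B *\<^sub>v \<beta> x"
      using assoc_mult_mat_vec[OF B(1) cE[OF that] v[OF that]] sol[OF that] by simp
    then show ?thesis
      using cramer_lemma_mat[OF c v[OF that] j] unfolding p_def q_def by (simp add: mult.commute)
  qed
  ultimately show "\<exists>q p. regular_on C X q \<and> regular_on C X p \<and> q x0 \<noteq> 0 \<and> (\<forall>x\<in>X. q x * v x $ j = p x)"
    by blast
qed

text \<open>
  \<open>E x\<close> is injective exactly if \<open>det (B * E x)\<close> is nonzero for some constant \<open>B\<close>: a left inverse gives the
  value \<open>1\<close>.
\<close>

lemma closedin_noninjective:
  fixes E :: "'x \<Rightarrow> 'k::field mat"
  assumes E: "regular_mat C X r d E"
  shows "closedin (zariski C X) {x \<in> X. \<not> injective_mat (E x)}"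
proof -
  define F where "F = {f \<in> regular_functions C. \<exists>B \<in> carrier_mat d r. \<forall>x\<in>X. f x = det (B * E x)}"
  have cE: "E x \<in> carrier_mat r d" if "x \<in> X" for x using E that unfolding regular_mat_def by blast
  have "(\<not> injective_mat (E x)) \<longleftrightarrow> (\<forall>f\<in>F. f x = 0)" if x: "x \<in> X" for x
  proof
    assume ni: "\<not> injective_mat (E x)"
    obtain v where v: "v \<in> carrier_vec d" "v \<noteq> 0\<^sub>v d" "E x *\<^sub>v v = 0\<^sub>v r"
      using ni injective_mat_iff_kernel[OF cE[OF x]] by blast
    have "det (B * E x) = 0" if B: "B \<in> carrier_mat d r" for B
    proof -
      have "(B * E x) *\<^sub>v v = 0\<^sub>v d"
        using assoc_mult_mat_vec[OF B cE[OF x] v(1)] v(3) B by simp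
      moreover have "B * E x \<in> carrier_mat d d" using B cE[OF x] by simp
      ultimately show ?thesis using det_0_iff_vec_prod_zero_field v(1,2) by blast
    qed
    then show "\<forall>f\<in>F. f x = 0" using x unfolding F_def by auto
  next
    assume 0: "\<forall>f\<in>F. f x = 0"
    show "\<not> injective_mat (E x)"
    proof
      assume "injective_mat (E x)"
      then obtain B where B: "B \<in> carrier_mat d r" "B * E x = 1\<^sub>m d"
        using cE[OF x] unfolding injective_mat_def by auto
      have "regular_on C X (\<lambda>x. det (B * E x))"
        by (rule regular_on_det[OF regular_mat_mult[OF regular_mat_const[OF B(1)] E]])
      then obtain f where f: "f \<in> regular_functions C" "\<forall>x\<in>X. det (B * E x) = f x"
        unfolding regular_on_def by blast
      then have "f \<in> F" unfolding F_def using B(1) by (intro CollectI conjI bexI[of _ B]) auto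
      then have "det (B * E x) = 0" using 0 f(2) x by simp
      then show False unfolding B(2) by simp
    qed
  qed
  then have "{x \<in> X. \<not> injective_mat (E x)} = {x \<in> X. \<forall>f\<in>F. f x = 0}" by blast
  moreover have "F \<subseteq> regular_functions C" unfolding F_def by blast
  ultimately show ?thesis unfolding closedin_zariski by blast
qed

section \<open>Homomorphisms as solutions of a linear system\<close>

text \<open>
  The inverse of \<open>unvec\<close>.
\<close>

definition vec_of_mat :: "'a mat \<Rightarrow> 'a vec" where
  "vec_of_mat A = vec (dim_col A * dim_row A) (\<lambda>k. A $$ (k mod dim_row A, k div dim_row A))"

lemma vec_of_mat_carrier: "A \<in> carrier_mat r c \<Longrightarrow> vec_of_mat A \<in> carrier_vec (c * r)"
  unfolding vec_of_mat_def by auto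

lemma vec_of_mat_index:
  "A \<in> carrier_mat r c \<Longrightarrow> k < c * r \<Longrightarrow> vec_of_mat A $ k = A $$ (k mod r, k div r)"
  unfolding vec_of_mat_def by auto

lemma unvec_vec_of_mat:
  assumes A: "A \<in> carrier_mat r c"
  shows "unvec r c (vec_of_mat A) = A"
proof (rule eq_matI)
  fix i j assume "i < dim_row A" "j < dim_col A"
  then have ij: "i < r" "j < c" using A by auto
  show "unvec r c (vec_of_mat A) $$ (i, j) = A $$ (i, j)"
    using ij block_index_less[OF ij(2,1)] by (simp add: unvec_def vec_of_mat_index[OF A])
qed (use A in \<open>auto simp: unvec_def\<close>)

lemma vec_of_mat_unvec:
  assumes v: "v \<in> carrier_vec (c * r)"
  shows "vec_of_mat (unvec r c v) = v"
proof (rule eq_vecI)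
  fix k assume "k < dim_vec v"
  then have k: "k < c * r" using v by simp
  show "vec_of_mat (unvec r c v) $ k = v $ k"
    unfolding vec_of_mat_index[OF unvec_carrier k] using div_mod_less[OF k] by (simp add: unvec_def)
qed (use v in \<open>auto simp: vec_of_mat_def unvec_def\<close>)

lemma vec_of_mat_inj:
  "A \<in> carrier_mat r c \<Longrightarrow> B \<in> carrier_mat r c \<Longrightarrow> vec_of_mat A = vec_of_mat B \<longleftrightarrow> A = B"
  by (metis unvec_vec_of_mat)

lemma vec_of_mat_zero: "vec_of_mat (0\<^sub>m r c) = 0\<^sub>v (c * r)"
  using div_mod_less by (intro eq_vecI) (auto simp: vec_of_mat_def)

lemma zero_vec_append: "0\<^sub>v a @\<^sub>v 0\<^sub>v b = (0\<^sub>v (a + b) :: 'a::zero vec)"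
  by (intro eq_vecI) auto

lemma vec_of_mat_add:
  fixes A :: "'a::comm_ring_1 mat"
  assumes "A \<in> carrier_mat r c" "B \<in> carrier_mat r c"
  shows "vec_of_mat A + vec_of_mat B = vec_of_mat (A + B)"
  using assms div_mod_less[of _ c r] by (intro eq_vecI) (auto simp: vec_of_mat_def)

lemma vec_of_mat_smult:
  fixes A :: "'a::comm_ring_1 mat"
  assumes "A \<in> carrier_mat r c"
  shows "a \<cdot>\<^sub>v vec_of_mat A = vec_of_mat (a \<cdot>\<^sub>m A)"
  using assms div_mod_less[of _ c r] by (intro eq_vecI) (auto simp: vec_of_mat_def)

lemma kron_one_mult_vec_of_mat:
  fixes A :: "'a::comm_ring_1 mat"
  assumes A: "A \<in> carrier_mat r n" and H: "H \<in> carrier_mat n a"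
  shows "kron (1\<^sub>m a) A *\<^sub>v vec_of_mat H = vec_of_mat (A * H)"
proof (rule eq_vecI)
  have AH: "A * H \<in> carrier_mat r a" using A H by simp
  note kA = kron_carrier[OF one_carrier_mat[of a] A]
  show "dim_vec (kron (1\<^sub>m a) A *\<^sub>v vec_of_mat H) = dim_vec (vec_of_mat (A * H))"
    using kA vec_of_mat_carrier[OF AH] by auto
  fix k assume "k < dim_vec (vec_of_mat (A * H))"
  then have k: "k < a * r" using vec_of_mat_carrier[OF AH] by simp
  note dm = div_mod_less[OF k]
  have "(kron (1\<^sub>m a) A *\<^sub>v vec_of_mat H) $ ((k div r) * r + k mod r) =
      (\<Sum>j<a. (1\<^sub>m a :: 'a mat) $$ (k div r, j) * (A * unvec n a (vec_of_mat H)) $$ (k mod r, j))"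
    using dm by (intro kron_mult_vec_index[OF one_carrier_mat A vec_of_mat_carrier[OF H]]) auto
  also have "\<dots> = (\<Sum>j<a. if j = k div r then (A * H) $$ (k mod r, j) else 0)"
    unfolding unvec_vec_of_mat[OF H] using dm by (intro sum.cong) auto
  also have "\<dots> = (A * H) $$ (k mod r, k div r)" using dm by simp
  finally show "(kron (1\<^sub>m a) A *\<^sub>v vec_of_mat H) $ k = vec_of_mat (A * H) $ k"
    using vec_of_mat_index[OF AH k] by (simp del: index_mult_mat)
qed

lemma kron_transpose_mult_vec_of_mat:
  fixes A :: "'a::comm_ring_1 mat"
  assumes A: "A \<in> carrier_mat r n" and H: "H \<in> carrier_mat s r"
  shows "kron A\<^sup>T (1\<^sub>m s) *\<^sub>v vec_of_mat H = vec_of_mat (H * A)"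
proof (rule eq_vecI)
  have HA: "H * A \<in> carrier_mat s n" and AT: "A\<^sup>T \<in> carrier_mat n r" using A H by auto
  note kA = kron_carrier[OF AT one_carrier_mat[of s]]
  show "dim_vec (kron A\<^sup>T (1\<^sub>m s) *\<^sub>v vec_of_mat H) = dim_vec (vec_of_mat (H * A))"
    using kA vec_of_mat_carrier[OF HA] by auto
  fix k assume "k < dim_vec (vec_of_mat (H * A))"
  then have k: "k < n * s" using vec_of_mat_carrier[OF HA] by simp
  note dm = div_mod_less[OF k]
  have "(kron A\<^sup>T (1\<^sub>m s) *\<^sub>v vec_of_mat H) $ ((k div s) * s + k mod s) =
      (\<Sum>j<r. A\<^sup>T $$ (k div s, j) * (1\<^sub>m s * unvec s r (vec_of_mat H)) $$ (k mod s, j))"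
    using dm by (intro kron_mult_vec_index[OF AT one_carrier_mat vec_of_mat_carrier[OF H]]) auto
  also have "\<dots> = (\<Sum>j<r. H $$ (k mod s, j) * A $$ (j, k div s))"
    unfolding unvec_vec_of_mat[OF H] left_mult_one_mat[OF H]
    using dm A by (intro sum.cong) (auto simp: mult.commute)
  also have "\<dots> = (H * A) $$ (k mod s, k div s)"
    using dm by (intro mult_mat_entry[OF H A, symmetric]) auto
  finally show "(kron A\<^sup>T (1\<^sub>m s) *\<^sub>v vec_of_mat H) $ k = vec_of_mat (H * A) $ k"
    using vec_of_mat_index[OF HA k] by (simp del: index_mult_mat)
qed

text \<open>
  The linear system for homomorphisms \<open>(h0, h1)\<close> from \<open>x\<close> to \<open>y\<close> in the unknown \<open>vec_of_mat h1 @\<^sub>v vec_of_mat h0\<close>: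
  the three blocks of rows are \<open>h1 K - K' h0\<close>, \<open>h1 L - L' h0\<close> and \<open>h1 M\<close>.
\<close>

definition hom_mat :: "nat \<Rightarrow> nat \<Rightarrow> nat \<Rightarrow> 'k::field lomadze \<Rightarrow> 'k lomadze \<Rightarrow> 'k mat" where
  "hom_mat n m p x y = (case x of (K, L, M) \<Rightarrow> case y of (K', L', M') \<Rightarrow>
    hconcat (kron K\<^sup>T (1\<^sub>m (n + p))) (kron (1\<^sub>m n) (- K')) @\<^sub>r
    (hconcat (kron L\<^sup>T (1\<^sub>m (n + p))) (kron (1\<^sub>m n) (- L')) @\<^sub>r
     hconcat (kron M\<^sup>T (1\<^sub>m (n + p))) (0\<^sub>m ((p + m) * (n + p)) (n * n))))"

definition framing_vec :: "nat \<Rightarrow> nat \<Rightarrow> 'k::field lomadze \<Rightarrow> 'k vec" where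
  "framing_vec n p y = (case y of (K', L', M') \<Rightarrow>
    0\<^sub>v (n * (n + p)) @\<^sub>v (0\<^sub>v (n * (n + p)) @\<^sub>v vec_of_mat M'))"

abbreviation hom_rows :: "nat \<Rightarrow> nat \<Rightarrow> nat \<Rightarrow> nat" where
  "hom_rows n m p \<equiv> n * (n + p) + (n * (n + p) + (p + m) * (n + p))"

abbreviation hom_cols :: "nat \<Rightarrow> nat \<Rightarrow> nat" where
  "hom_cols n p \<equiv> (n + p) * (n + p) + n * n"

text \<open>
  The scalar \<open>c\<close> on the framing makes the condition homogeneous in \<open>(h0, h1, c)\<close>: existence of a nonzero
  solution is then a rank condition, which is closed.
\<close>

definition framed_hom ::
    "nat \<Rightarrow> nat \<Rightarrow> 'k::field \<Rightarrow> 'k lomadze \<Rightarrow> 'k lomadze \<Rightarrow> 'k mat \<Rightarrow> 'k mat \<Rightarrow> bool" where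
  "framed_hom n p c x y h0 h1 \<longleftrightarrow> (case x of (K, L, M) \<Rightarrow> case y of (K', L', M') \<Rightarrow>
    h0 \<in> carrier_mat n n \<and> h1 \<in> carrier_mat (n + p) (n + p) \<and>
    h1 * K = K' * h0 \<and> h1 * L = L' * h0 \<and> h1 * M = c \<cdot>\<^sub>m M')"

lemma hom_mat_carrier:
  assumes "x \<in> lomadze_systems n m p" "y \<in> lomadze_systems n m p"
  shows "hom_mat n m p x y \<in> carrier_mat (hom_rows n m p) (hom_cols n p)"
proof -
  obtain K L M K' L' M' where xy: "x = (K, L, M)" "y = (K', L', M')" by (metis prod_cases3)
  have c: "K\<^sup>T \<in> carrier_mat n (n + p)" "L\<^sup>T \<in> carrier_mat n (n + p)" "M\<^sup>T \<in> carrier_mat (p + m) (n + p)"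
    "- K' \<in> carrier_mat (n + p) n" "- L' \<in> carrier_mat (n + p) n"
    using assms unfolding xy lomadze_systems_iff by auto
  show ?thesis
    unfolding hom_mat_def xy prod.case
    by (intro carrier_append_rows hconcat_carrier kron_carrier c one_carrier_mat zero_carrier_mat)
qed

lemma framing_vec_carrier:
  assumes "y \<in> lomadze_systems n m p"
  shows "framing_vec n p y \<in> carrier_vec (hom_rows n m p)"
proof -
  obtain K' L' M' where y: "y = (K', L', M')" by (cases y)
  have "M' \<in> carrier_mat (n + p) (p + m)" using assms unfolding y lomadze_systems_iff by auto
  then show ?thesis unfolding framing_vec_def y prod.case
    by (intro append_carrier_vec zero_carrier_vec vec_of_mat_carrier)
qed

lemma hom_mat_mult_eq_framing_iff:
  fixes x y :: "'k::field lomadze"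
  assumes x: "x \<in> lomadze_systems n m p" and y: "y \<in> lomadze_systems n m p"
    and h0: "h0 \<in> carrier_mat n n" and h1: "h1 \<in> carrier_mat (n + p) (n + p)"
  shows "hom_mat n m p x y *\<^sub>v (vec_of_mat h1 @\<^sub>v vec_of_mat h0) = c \<cdot>\<^sub>v framing_vec n p y \<longleftrightarrow>
    framed_hom n p c x y h0 h1"
proof -
  obtain K L M K' L' M' where xy: "x = (K, L, M)" "y = (K', L', M')" by (metis prod_cases3)
  note cx = lomadze_systemsD[OF x[unfolded xy(1)]] and cy = lomadze_systemsD[OF y[unfolded xy(2)]]
  let ?v1 = "vec_of_mat h1" and ?v0 = "vec_of_mat h0"
  note v1 = vec_of_mat_carrier[OF h1] and v0 = vec_of_mat_carrier[OF h0]
  have v: "?v1 @\<^sub>v ?v0 \<in> carrier_vec (hom_cols n p)" using v1 v0 by (intro append_carrier_vec)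
  have row: "hconcat (kron A\<^sup>T (1\<^sub>m (n + p))) (kron (1\<^sub>m n) (- A')) *\<^sub>v (?v1 @\<^sub>v ?v0) =
      vec_of_mat (h1 * A - A' * h0)"
    if A: "A \<in> carrier_mat (n + p) n" and A': "A' \<in> carrier_mat (n + p) n" for A A'
  proof -
    have AT: "A\<^sup>T \<in> carrier_mat n (n + p)" and mA': "- A' \<in> carrier_mat (n + p) n" using A A' by auto
    have "hconcat (kron A\<^sup>T (1\<^sub>m (n + p))) (kron (1\<^sub>m n) (- A')) *\<^sub>v (?v1 @\<^sub>v ?v0) =
        kron A\<^sup>T (1\<^sub>m (n + p)) *\<^sub>v ?v1 + kron (1\<^sub>m n) (- A') *\<^sub>v ?v0"
      by (rule hconcat_mult_vec[OF kron_carrier[OF AT one_carrier_mat] kron_carrier[OF one_carrier_mat mA'] v1 v0])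
    also have "\<dots> = vec_of_mat (h1 * A) + vec_of_mat (- A' * h0)"
      unfolding kron_transpose_mult_vec_of_mat[OF A h1] kron_one_mult_vec_of_mat[OF mA' h0] ..
    also have "\<dots> = vec_of_mat (h1 * A + - A' * h0)"
      using h0 h1 A mA' by (intro vec_of_mat_add) auto
    also have "h1 * A + - A' * h0 = h1 * A - A' * h0"
      using h0 h1 A A' by (intro eq_matI) auto
    finally show ?thesis .
  qed
  have MT: "M\<^sup>T \<in> carrier_mat (p + m) (n + p)" using cx by auto
  note kM = kron_carrier[OF MT one_carrier_mat[of "n + p"]]
  have rowM: "hconcat (kron M\<^sup>T (1\<^sub>m (n + p))) (0\<^sub>m ((p + m) * (n + p)) (n * n)) *\<^sub>v (?v1 @\<^sub>v ?v0) =
      vec_of_mat (h1 * M)"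
  proof -
    have "hconcat (kron M\<^sup>T (1\<^sub>m (n + p))) (0\<^sub>m ((p + m) * (n + p)) (n * n)) *\<^sub>v (?v1 @\<^sub>v ?v0) =
        kron M\<^sup>T (1\<^sub>m (n + p)) *\<^sub>v ?v1 + 0\<^sub>m ((p + m) * (n + p)) (n * n) *\<^sub>v ?v0"
      by (rule hconcat_mult_vec[OF kM zero_carrier_mat v1 v0])
    also have "0\<^sub>m ((p + m) * (n + p)) (n * n) *\<^sub>v ?v0 = 0\<^sub>v ((p + m) * (n + p))"
      using v0 by (intro eq_vecI) auto
    also have "kron M\<^sup>T (1\<^sub>m (n + p)) *\<^sub>v ?v1 = vec_of_mat (h1 * M)"
      by (rule kron_transpose_mult_vec_of_mat[OF cx(3) h1])
    also have "vec_of_mat (h1 * M) + 0\<^sub>v ((p + m) * (n + p)) = vec_of_mat (h1 * M)"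
      using h1 cx(3) by (intro right_zero_vec vec_of_mat_carrier) auto
    finally show ?thesis .
  qed
  have mK: "- K' \<in> carrier_mat (n + p) n" "- L' \<in> carrier_mat (n + p) n"
    "K\<^sup>T \<in> carrier_mat n (n + p)" "L\<^sup>T \<in> carrier_mat n (n + p)" using cx cy by auto
  note rowsc = hconcat_carrier[OF kron_carrier[OF mK(3) one_carrier_mat[of "n + p"]] kron_carrier[OF one_carrier_mat[of n] mK(1)]]
    hconcat_carrier[OF kron_carrier[OF mK(4) one_carrier_mat[of "n + p"]] kron_carrier[OF one_carrier_mat[of n] mK(2)]]
    hconcat_carrier[OF kM zero_carrier_mat[of "(p + m) * (n + p)" "n * n"]]
  have lhs: "hom_mat n m p x y *\<^sub>v (?v1 @\<^sub>v ?v0) =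
      vec_of_mat (h1 * K - K' * h0) @\<^sub>v (vec_of_mat (h1 * L - L' * h0) @\<^sub>v vec_of_mat (h1 * M))"
    unfolding hom_mat_def xy prod.case
      mat_mult_append[OF rowsc(1) carrier_append_rows[OF rowsc(2,3)] v]
      mat_mult_append[OF rowsc(2,3) v] row[OF cx(1) cy(1)] row[OF cx(2) cy(2)] rowM ..
  have D: "h1 * K - K' * h0 \<in> carrier_mat (n + p) n" "h1 * L - L' * h0 \<in> carrier_mat (n + p) n"
    "h1 * M \<in> carrier_mat (n + p) (p + m)" "c \<cdot>\<^sub>m M' \<in> carrier_mat (n + p) (p + m)"
    using h0 h1 cx cy by auto
  have rhs: "c \<cdot>\<^sub>v framing_vec n p y =
      vec_of_mat (0\<^sub>m (n + p) n) @\<^sub>v (vec_of_mat (0\<^sub>m (n + p) n) @\<^sub>v vec_of_mat (c \<cdot>\<^sub>m M'))"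
    unfolding framing_vec_def xy prod.case vec_of_mat_zero vec_of_mat_smult[OF cy(3), symmetric]
    by (intro eq_vecI) auto
  have diff0: "A - B = 0\<^sub>m (n + p) n \<longleftrightarrow> A = B"
    if "A \<in> carrier_mat (n + p) n" "B \<in> carrier_mat (n + p) n" for A B :: "'k mat"
    using that by (auto simp: mat_eq_iff)
  have KD: "h1 * K \<in> carrier_mat (n + p) n" "K' * h0 \<in> carrier_mat (n + p) n"
    "h1 * L \<in> carrier_mat (n + p) n" "L' * h0 \<in> carrier_mat (n + p) n" using h0 h1 cx cy by auto
  show ?thesis
    unfolding lhs rhs append_vec_eq[OF vec_of_mat_carrier[OF D(1)] vec_of_mat_carrier[OF zero_carrier_mat]]
      append_vec_eq[OF vec_of_mat_carrier[OF D(2)] vec_of_mat_carrier[OF zero_carrier_mat]]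
      vec_of_mat_inj[OF D(1) zero_carrier_mat] vec_of_mat_inj[OF D(2) zero_carrier_mat]
      vec_of_mat_inj[OF D(3,4)] diff0[OF KD(1,2)] diff0[OF KD(3,4)]
    unfolding framed_hom_def xy prod.case using h0 h1 by simp
qed

lemma hom_vec_cases:
  assumes "v \<in> carrier_vec (hom_cols n p)"
  obtains h0 h1 where "h0 \<in> carrier_mat n n" "h1 \<in> carrier_mat (n + p) (n + p)"
    "v = vec_of_mat h1 @\<^sub>v vec_of_mat h0"
proof -
  define v1 v0 where "v1 = vec_first v ((n + p) * (n + p))" and "v0 = vec_last v (n * n)"
  have v: "v = v1 @\<^sub>v v0" "v1 \<in> carrier_vec ((n + p) * (n + p))" "v0 \<in> carrier_vec (n * n)"
    using assms vec_first_last_append[of v "(n + p) * (n + p)" "n * n"] unfolding v1_def v0_def by auto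
  show ?thesis
    by (rule that[OF unvec_carrier unvec_carrier, of v1 v0])
      (simp add: v(1) vec_of_mat_unvec[OF v(2)] vec_of_mat_unvec[OF v(3)])
qed

lemma rigid_pairD:
  assumes "rigid_pair n m p x y" "y \<in> lomadze_systems n m p" "framed_hom n p 0 x y h0 h1"
  shows "h0 = 0\<^sub>m n n \<and> h1 = 0\<^sub>m (n + p) (n + p)"
proof -
  obtain K L M K' L' M' where xy: "x = (K, L, M)" "y = (K', L', M')" by (metis prod_cases3)
  have M': "M' \<in> carrier_mat (n + p) (p + m)" using assms(2) unfolding xy lomadze_systems_iff by auto
  have "0 \<cdot>\<^sub>m M' = 0\<^sub>m (n + p) (p + m)" using M' by (intro eq_matI) auto
  then show ?thesis using assms(1,3) unfolding rigid_pair_def framed_hom_def xy prod.case by auto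
qed

lemma rigid_pair_injective:
  assumes "rigid_pair n m p x y" "x \<in> lomadze_systems n m p" "y \<in> lomadze_systems n m p"
  shows "injective_mat (hom_mat n m p x y)"
  unfolding injective_mat_iff_kernel[OF hom_mat_carrier[OF assms(2,3)]]
proof (intro ballI impI)
  fix v assume v: "v \<in> carrier_vec (hom_cols n p)" "hom_mat n m p x y *\<^sub>v v = 0\<^sub>v (hom_rows n m p)"
  obtain h0 h1 where h: "h0 \<in> carrier_mat n n" "h1 \<in> carrier_mat (n + p) (n + p)"
    "v = vec_of_mat h1 @\<^sub>v vec_of_mat h0" using hom_vec_cases[OF v(1)] by metis
  have "0 \<cdot>\<^sub>v framing_vec n p y = 0\<^sub>v (hom_rows n m p)"
    using framing_vec_carrier[OF assms(3)] by (intro eq_vecI) auto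
  then have "framed_hom n p 0 x y h0 h1"
    using hom_mat_mult_eq_framing_iff[OF assms(2,3) h(1,2), of 0] v(2) h(3) by simp
  from rigid_pairD[OF assms(1,3) this] show "v = 0\<^sub>v (hom_cols n p)"
    unfolding h(3) by (simp add: vec_of_mat_zero zero_vec_append)
qed

definition framed_hom_mat :: "nat \<Rightarrow> nat \<Rightarrow> nat \<Rightarrow> 'k::field lomadze \<Rightarrow> 'k lomadze \<Rightarrow> 'k mat" where
  "framed_hom_mat n m p x y = hconcat (hom_mat n m p x y) (col_mat (framing_vec n p y))"

lemma framed_hom_mat_carrier:
  assumes "x \<in> lomadze_systems n m p" "y \<in> lomadze_systems n m p"
  shows "framed_hom_mat n m p x y \<in> carrier_mat (hom_rows n m p) (hom_cols n p + 1)"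
  unfolding framed_hom_mat_def
  by (intro hconcat_carrier hom_mat_carrier assms col_mat_carrier framing_vec_carrier)

lemma framed_hom_mat_mult:
  assumes "x \<in> lomadze_systems n m p" "y \<in> lomadze_systems n m p" "v \<in> carrier_vec (hom_cols n p)"
  shows "framed_hom_mat n m p x y *\<^sub>v (v @\<^sub>v vec 1 (\<lambda>_. - c)) = 0\<^sub>v (hom_rows n m p) \<longleftrightarrow>
    hom_mat n m p x y *\<^sub>v v = c \<cdot>\<^sub>v framing_vec n p y"
proof -
  note H = hom_mat_carrier[OF assms(1,2)] and b = framing_vec_carrier[OF assms(2)]
  have "framed_hom_mat n m p x y *\<^sub>v (v @\<^sub>v vec 1 (\<lambda>_. - c)) =
      hom_mat n m p x y *\<^sub>v v + col_mat (framing_vec n p y) *\<^sub>v vec 1 (\<lambda>_. - c)"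
    unfolding framed_hom_mat_def by (rule hconcat_mult_vec[OF H col_mat_carrier[OF b] assms(3)]) simp
  also have "col_mat (framing_vec n p y) *\<^sub>v vec 1 (\<lambda>_. - c) = - (c \<cdot>\<^sub>v framing_vec n p y)"
    by (intro eq_vecI) (auto simp: col_mat_def scalar_prod_def mult.commute)
  finally have e: "framed_hom_mat n m p x y *\<^sub>v (v @\<^sub>v vec 1 (\<lambda>_. - c)) =
      hom_mat n m p x y *\<^sub>v v + - (c \<cdot>\<^sub>v framing_vec n p y)" .
  have "u + - w = 0\<^sub>v k \<longleftrightarrow> u = w" if "u \<in> carrier_vec k" "w \<in> carrier_vec k" for u w :: "'a vec" and k
    using that by (auto simp: vec_eq_iff)
  moreover have "hom_mat n m p x y *\<^sub>v v \<in> carrier_vec (hom_rows n m p)"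
    using H assms(3) by (rule mult_mat_vec_carrier)
  ultimately show ?thesis unfolding e using b by simp
qed

text \<open>
  By rigidity the scalar of a nonzero solution is not zero, so it can be normalized to \<open>1\<close>.
\<close>

lemma noninjective_framed_hom_mat_iff:
  assumes x: "x \<in> lomadze_systems n m p" and y: "y \<in> lomadze_systems n m p"
    and rigid: "rigid_pair n m p x y"
  shows "\<not> injective_mat (framed_hom_mat n m p x y) \<longleftrightarrow> (\<exists>h0 h1. framed_hom n p 1 x y h0 h1)"
proof
  note H = framed_hom_mat_carrier[OF x y]
  assume "\<not> injective_mat (framed_hom_mat n m p x y)"
  then obtain v where v: "v \<in> carrier_vec (hom_cols n p + 1)" "v \<noteq> 0\<^sub>v (hom_cols n p + 1)"
    "framed_hom_mat n m p x y *\<^sub>v v = 0\<^sub>v (hom_rows n m p)"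
    unfolding injective_mat_iff_kernel[OF H] by blast
  \<comment> \<open>The last coordinate is minus the scalar of the homomorphism.\<close>
  define w u where "w = vec_first v (hom_cols n p)" and "u = vec_last v 1"
  have wu: "v = w @\<^sub>v u" "w \<in> carrier_vec (hom_cols n p)" "u \<in> carrier_vec 1"
    using v(1) vec_first_last_append[of v "hom_cols n p" 1] unfolding w_def u_def by auto
  define c where "c = - u $ 0"
  have u: "u = vec 1 (\<lambda>_. - c)" using wu(3) unfolding c_def by (intro eq_vecI) auto
  obtain h0 h1 where h: "h0 \<in> carrier_mat n n" "h1 \<in> carrier_mat (n + p) (n + p)"
    "w = vec_of_mat h1 @\<^sub>v vec_of_mat h0" using hom_vec_cases[OF wu(2)] by metis
  have "hom_mat n m p x y *\<^sub>v w = c \<cdot>\<^sub>v framing_vec n p y"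
    using v(3) unfolding wu(1) u framed_hom_mat_mult[OF x y wu(2)] .
  then have hom: "framed_hom n p c x y h0 h1"
    unfolding h(3) hom_mat_mult_eq_framing_iff[OF x y h(1,2)] .
  have "c \<noteq> 0"
  proof
    assume c0: "c = 0"
    then have "w = 0\<^sub>v (hom_cols n p)"
      using rigid_pairD[OF rigid y hom[unfolded c0]] unfolding h(3)
      by (simp add: vec_of_mat_zero zero_vec_append)
    moreover have "u = 0\<^sub>v 1" unfolding u c0 by (intro eq_vecI) auto
    ultimately show False using v(2) unfolding wu(1) by (simp add: zero_vec_append)
  qed
  obtain K L M K' L' M' where xy: "x = (K, L, M)" "y = (K', L', M')" by (metis prod_cases3)
  note cx = lomadze_systemsD[OF x[unfolded xy(1)]] and cy = lomadze_systemsD[OF y[unfolded xy(2)]]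
  have "framed_hom n p 1 x y (inverse c \<cdot>\<^sub>m h0) (inverse c \<cdot>\<^sub>m h1)"
  proof -
    have e: "h1 * K = K' * h0" "h1 * L = L' * h0" "h1 * M = c \<cdot>\<^sub>m M'"
      using hom unfolding framed_hom_def xy prod.case by auto
    have "(inverse c \<cdot>\<^sub>m h1) * K = K' * (inverse c \<cdot>\<^sub>m h0)"
      unfolding mult_smult_assoc_mat[OF h(2) cx(1)] mult_smult_distrib[OF cy(1) h(1)] e(1) ..
    moreover have "(inverse c \<cdot>\<^sub>m h1) * L = L' * (inverse c \<cdot>\<^sub>m h0)"
      unfolding mult_smult_assoc_mat[OF h(2) cx(2)] mult_smult_distrib[OF cy(2) h(1)] e(2) ..
    moreover have "(inverse c \<cdot>\<^sub>m h1) * M = 1 \<cdot>\<^sub>m M'"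
      unfolding mult_smult_assoc_mat[OF h(2) cx(3)] e(3) using \<open>c \<noteq> 0\<close> by (intro eq_matI) auto
    ultimately show ?thesis unfolding framed_hom_def xy prod.case using h by simp
  qed
  then show "\<exists>h0 h1. framed_hom n p 1 x y h0 h1" by blast
next
  note H = framed_hom_mat_carrier[OF x y]
  assume "\<exists>h0 h1. framed_hom n p 1 x y h0 h1"
  then obtain h0 h1 where hom: "framed_hom n p 1 x y h0 h1" by blast
  then have h: "h0 \<in> carrier_mat n n" "h1 \<in> carrier_mat (n + p) (n + p)"
    unfolding framed_hom_def by (auto split: prod.splits)
  define w where "w = vec_of_mat h1 @\<^sub>v vec_of_mat h0"
  have w: "w \<in> carrier_vec (hom_cols n p)"
    unfolding w_def using vec_of_mat_carrier[OF h(1)] vec_of_mat_carrier[OF h(2)] by (intro append_carrier_vec)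
  have "hom_mat n m p x y *\<^sub>v w = 1 \<cdot>\<^sub>v framing_vec n p y"
    unfolding w_def hom_mat_mult_eq_framing_iff[OF x y h] by (rule hom)
  then have 0: "framed_hom_mat n m p x y *\<^sub>v (w @\<^sub>v vec 1 (\<lambda>_. - 1)) = 0\<^sub>v (hom_rows n m p)"
    by (rule iffD2[OF framed_hom_mat_mult[OF x y w]])
  have wc: "w @\<^sub>v vec 1 (\<lambda>_. - 1) \<in> carrier_vec (hom_cols n p + 1)" using w by (intro append_carrier_vec) auto
  show "\<not> injective_mat (framed_hom_mat n m p x y)"
  proof
    assume "injective_mat (framed_hom_mat n m p x y)"
    from injective_matD[OF this H wc 0] have "w @\<^sub>v vec 1 (\<lambda>_. - 1) = 0\<^sub>v (hom_cols n p + 1)" .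
    then have "(w @\<^sub>v vec 1 (\<lambda>_. - 1)) $ hom_cols n p = 0" by simp
    then show False using w by simp
  qed
qed

section \<open>Orbits\<close>

lemma act_eq_iff_framed_hom:
  fixes x y :: "'k::field lomadze"
  assumes x: "x \<in> lomadze_systems n m p" and y: "y \<in> lomadze_systems n m p"
    and g: "g0 \<in> carrier (GL n)" "g1 \<in> carrier (GL (n + p))"
  shows "lomadze_act n p (g0, g1) x = y \<longleftrightarrow> framed_hom n p 1 x y g0 g1"
proof -
  obtain K L M K' L' M' where xy: "x = (K, L, M)" "y = (K', L', M')" by (metis prod_cases3)
  note cx = lomadze_systemsD[OF x[unfolded xy(1)]] and cy = lomadze_systemsD[OF y[unfolded xy(2)]]
  have cg: "g0 \<in> carrier_mat n n" "g1 \<in> carrier_mat (n + p) (n + p)" using g by (auto simp: carrier_GL)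
  note i = GL_inv[OF g(1)]
  have "g1 * A * inv\<^bsub>GL n\<^esub> g0 = A' \<longleftrightarrow> g1 * A = A' * g0"
    if A: "A \<in> carrier_mat (n + p) n" and A': "A' \<in> carrier_mat (n + p) n" for A A'
  proof
    have gA: "g1 * A \<in> carrier_mat (n + p) n" using cg A by simp
    assume "g1 * A * inv\<^bsub>GL n\<^esub> g0 = A'"
    then have "A' * g0 = g1 * A * inv\<^bsub>GL n\<^esub> g0 * g0" by simp
    also have "\<dots> = g1 * A * (inv\<^bsub>GL n\<^esub> g0 * g0)" by (rule assoc_mult_mat[OF gA i(1) cg(1)])
    also have "\<dots> = g1 * A" unfolding i(2) by (rule right_mult_one_mat[OF gA])
    finally show "g1 * A = A' * g0" by (rule sym)
  next
    assume "g1 * A = A' * g0"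
    then have "g1 * A * inv\<^bsub>GL n\<^esub> g0 = A' * g0 * inv\<^bsub>GL n\<^esub> g0" by simp
    also have "\<dots> = A' * (g0 * inv\<^bsub>GL n\<^esub> g0)" by (rule assoc_mult_mat[OF A' cg(1) i(1)])
    also have "\<dots> = A'" unfolding i(3) by (rule right_mult_one_mat[OF A'])
    finally show "g1 * A * inv\<^bsub>GL n\<^esub> g0 = A'" .
  qed
  moreover have "1 \<cdot>\<^sub>m M' = M'" by (intro eq_matI) auto
  ultimately show ?thesis
    using cx cy cg unfolding framed_hom_def xy prod.case by simp
qed

text \<open>
  The difference of an endomorphism with scalar \<open>1\<close> and the identity kills the framing; rigidity then
  shows that the composition is the identity.
\<close>

lemma framed_hom_comp:
  assumes "framed_hom n p 1 x y h0 h1" "framed_hom n p 1 y x k0 k1"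
    and x: "x \<in> lomadze_systems n m p" and y: "y \<in> lomadze_systems n m p"
  shows "framed_hom n p 0 x x (k0 * h0 - 1\<^sub>m n) (k1 * h1 - 1\<^sub>m (n + p))"
proof -
  obtain K L M K' L' M' where xy: "x = (K, L, M)" "y = (K', L', M')" by (metis prod_cases3)
  note cx = lomadze_systemsD[OF x[unfolded xy(1)]] and cy = lomadze_systemsD[OF y[unfolded xy(2)]]
  have h: "h0 \<in> carrier_mat n n" "h1 \<in> carrier_mat (n + p) (n + p)"
    "h1 * K = K' * h0" "h1 * L = L' * h0" "h1 * M = 1 \<cdot>\<^sub>m M'"
    and k: "k0 \<in> carrier_mat n n" "k1 \<in> carrier_mat (n + p) (n + p)"
    "k1 * K' = K * k0" "k1 * L' = L * k0" "k1 * M' = 1 \<cdot>\<^sub>m M"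
    using assms(1,2) unfolding framed_hom_def xy prod.case by auto
  have one: "1 \<cdot>\<^sub>m A = A" for A :: "'a mat" by (intro eq_matI) auto
  have kh: "k1 * h1 \<in> carrier_mat (n + p) (n + p)" "k0 * h0 \<in> carrier_mat n n" using h k by auto
  have e: "(k1 * h1 - 1\<^sub>m (n + p)) * A = A * (k0 * h0 - 1\<^sub>m n)"
    if A: "A \<in> carrier_mat (n + p) n" and A': "A' \<in> carrier_mat (n + p) n"
      and 1: "h1 * A = A' * h0" and 2: "k1 * A' = A * k0" for A A'
  proof -
    have "(k1 * h1 - 1\<^sub>m (n + p)) * A = k1 * h1 * A - A"
      using kh A by (simp add: minus_mult_distrib_mat[of _ "n + p" "n + p"])
    also have "k1 * h1 * A = k1 * (A' * h0)"
      unfolding assoc_mult_mat[OF k(2) h(2) A] 1 ..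
    also have "\<dots> = A * k0 * h0" unfolding assoc_mult_mat[OF k(2) A' h(1), symmetric] 2 ..
    also have "\<dots> = A * (k0 * h0)" by (rule assoc_mult_mat[OF A k(1) h(1)])
    also have "A * (k0 * h0) - A = A * (k0 * h0 - 1\<^sub>m n)"
      using kh A by (simp add: mult_minus_distrib_mat[of _ "n + p" n])
    finally show ?thesis .
  qed
  have "(k1 * h1 - 1\<^sub>m (n + p)) * M = k1 * h1 * M - M"
    using kh cx by (simp add: minus_mult_distrib_mat[of _ "n + p" "n + p"])
  also have "k1 * h1 * M = M"
    unfolding assoc_mult_mat[OF k(2) h(2) cx(3)] h(5) one k(5) ..
  also have "M - M = 0 \<cdot>\<^sub>m M" by (intro eq_matI) auto
  finally show ?thesis
    unfolding framed_hom_def xy prod.case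
    using kh e[OF cx(1) cy(1) h(3) k(3)] e[OF cx(2) cy(2) h(4) k(4)] by auto
qed

text \<open>
  Homomorphisms in both directions are mutually inverse by rigidity, so they define a group element.
\<close>

lemma orbit_iff_noninjective:
  fixes x y :: "'k::field lomadze"
  assumes x: "x \<in> lomadze_systems n m p" and y: "y \<in> lomadze_systems n m p"
    and rxx: "rigid_pair n m p x x" and rxy: "rigid_pair n m p x y" and ryx: "rigid_pair n m p y x"
  shows "y \<in> lomadze_orbit n p x \<longleftrightarrow> \<not> injective_mat (framed_hom_mat n m p x y) \<and>
    \<not> injective_mat (framed_hom_mat n m p y x)"
  unfolding noninjective_framed_hom_mat_iff[OF x y rxy] noninjective_framed_hom_mat_iff[OF y x ryx]
proof
  assume "y \<in> lomadze_orbit n p x"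
  then obtain g where "g \<in> carrier (lomadze_group n p)" "y = lomadze_act n p g x"
    unfolding orbit_def by blast
  then obtain g0 g1 where g: "g0 \<in> carrier (GL n)" "g1 \<in> carrier (GL (n + p))"
    and act: "lomadze_act n p (g0, g1) x = y"
    by (cases g) (auto simp: carrier_lomadze_group)
  have hom: "framed_hom n p 1 x y g0 g1" using act act_eq_iff_framed_hom[OF x y g] by simp
  obtain K L M K' L' M' where xy: "x = (K, L, M)" "y = (K', L', M')" by (metis prod_cases3)
  note cx = lomadze_systemsD[OF x[unfolded xy(1)]] and cy = lomadze_systemsD[OF y[unfolded xy(2)]]
  have cg: "g0 \<in> carrier_mat n n" "g1 \<in> carrier_mat (n + p) (n + p)" using g by (auto simp: carrier_GL)
  have e: "g1 * K = K' * g0" "g1 * L = L' * g0" "g1 * M = 1 \<cdot>\<^sub>m M'"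
    using hom unfolding framed_hom_def xy prod.case by auto
  define i0 i1 where "i0 = inv\<^bsub>GL n\<^esub> g0" and "i1 = inv\<^bsub>GL (n + p)\<^esub> g1"
  have i0: "i0 \<in> carrier_mat n n" "g0 * i0 = 1\<^sub>m n" and i1: "i1 \<in> carrier_mat (n + p) (n + p)" "i1 * g1 = 1\<^sub>m (n + p)"
    using GL_inv[OF g(1)] GL_inv[OF g(2)] unfolding i0_def i1_def by auto
  have inverse_hom: "i1 * A' = A * i0"
    if A: "A \<in> carrier_mat (n + p) n" and A': "A' \<in> carrier_mat (n + p) n" and e: "g1 * A = A' * g0" for A A'
  proof -
    have "i1 * A' = i1 * (A' * (g0 * i0))" unfolding i0(2) right_mult_one_mat[OF A'] ..
    also have "A' * (g0 * i0) = (g1 * A) * i0"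
      unfolding e by (rule assoc_mult_mat[OF A' cg(1) i0(1), symmetric])
    also have "\<dots> = g1 * (A * i0)" by (rule assoc_mult_mat[OF cg(2) A i0(1)])
    also have "i1 * \<dots> = (i1 * g1) * (A * i0)"
      using i0 i1 cg A by (intro assoc_mult_mat[symmetric]) auto
    also have "\<dots> = A * i0" unfolding i1(2) using A i0 by (intro left_mult_one_mat) auto
    finally show ?thesis .
  qed
  have one: "1 \<cdot>\<^sub>m A = A" for A :: "'k mat" by (intro eq_matI) auto
  have "i1 * M' = 1 \<cdot>\<^sub>m M"
  proof -
    have "i1 * M' = i1 * (g1 * M)" using e(3) unfolding one by simp
    also have "\<dots> = (i1 * g1) * M" by (rule assoc_mult_mat[OF i1(1) cg(2) cx(3), symmetric])
    also have "\<dots> = M" unfolding i1(2) by (rule left_mult_one_mat[OF cx(3)])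
    finally show ?thesis unfolding one .
  qed
  then have "framed_hom n p 1 y x i0 i1"
    unfolding framed_hom_def xy prod.case
    using inverse_hom[OF cx(1) cy(1) e(1)] inverse_hom[OF cx(2) cy(2) e(2)] i0(1) i1(1) by simp
  with hom show "(\<exists>h0 h1. framed_hom n p 1 x y h0 h1) \<and> (\<exists>h0 h1. framed_hom n p 1 y x h0 h1)" by blast
next
  assume "(\<exists>h0 h1. framed_hom n p 1 x y h0 h1) \<and> (\<exists>h0 h1. framed_hom n p 1 y x h0 h1)"
  then obtain h0 h1 k0 k1 where hk: "framed_hom n p 1 x y h0 h1" "framed_hom n p 1 y x k0 k1" by blast
  have c: "h0 \<in> carrier_mat n n" "h1 \<in> carrier_mat (n + p) (n + p)"
    "k0 \<in> carrier_mat n n" "k1 \<in> carrier_mat (n + p) (n + p)"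
    using hk unfolding framed_hom_def by (auto split: prod.splits)
  have "k0 * h0 - 1\<^sub>m n = 0\<^sub>m n n \<and> k1 * h1 - 1\<^sub>m (n + p) = 0\<^sub>m (n + p) (n + p)"
    by (rule rigid_pairD[OF rxx x framed_hom_comp[OF hk x y]])
  moreover have diff0: "A - B = 0\<^sub>m r r \<Longrightarrow> A = B"
    if "A \<in> carrier_mat r r" "B \<in> carrier_mat r r" for A B :: "'k mat" and r
    using that by (auto simp: mat_eq_iff)
  ultimately have "k0 * h0 = 1\<^sub>m n" "k1 * h1 = 1\<^sub>m (n + p)"
    using diff0[of "k0 * h0" n "1\<^sub>m n"] diff0[of "k1 * h1" "n + p" "1\<^sub>m (n + p)"] c by auto
  then have "det k0 * det h0 = 1" "det k1 * det h1 = 1"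
    using det_mult[OF c(3,1)] det_mult[OF c(4,2)] by simp_all
  then have "det h0 \<noteq> 0" "det h1 \<noteq> 0" by auto
  then have g: "h0 \<in> carrier (GL n)" "h1 \<in> carrier (GL (n + p))" using c by (auto simp: carrier_GL)
  have "lomadze_act n p (h0, h1) x = y" using act_eq_iff_framed_hom[OF x y g] hk(1) by simp
  then show "y \<in> lomadze_orbit n p x"
    unfolding orbit_def using g
    by (intro CollectI exI[of _ "(h0, h1)"] conjI) (simp_all add: carrier_lomadze_group del: lomadze_act.simps)
qed

section \<open>Closed orbits\<close>

lemma regular_on_subset: "regular_on C X f \<Longrightarrow> Y \<subseteq> X \<Longrightarrow> regular_on C Y f"
  unfolding regular_on_def by blast

lemma regular_mat_subset: "regular_mat C X r c A \<Longrightarrow> Y \<subseteq> X \<Longrightarrow> regular_mat C Y r c A"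
  unfolding regular_mat_def using regular_on_subset by blast

lemma regular_matI:
  assumes "\<And>x. x \<in> X \<Longrightarrow> A x \<in> carrier_mat r c"
    and "\<And>i j. i < r \<Longrightarrow> j < c \<Longrightarrow> regular_on C X (a i j)"
    and "\<And>i j x. i < r \<Longrightarrow> j < c \<Longrightarrow> x \<in> X \<Longrightarrow> A x $$ (i, j) = a i j x"
  shows "regular_mat C X r c A"
  unfolding regular_mat_def
proof (intro conjI ballI allI impI)
  show "A x \<in> carrier_mat r c" if "x \<in> X" for x by (rule assms(1)[OF that])
  show "regular_on C X (\<lambda>x. A x $$ (i, j))" if "i < r" "j < c" for i j
    using assms(2,3)[OF that] by (simp cong: regular_on_cong)
qed

lemma regular_mat_carrier: "regular_mat C X r c A \<Longrightarrow> x \<in> X \<Longrightarrow> A x \<in> carrier_mat r c"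
  unfolding regular_mat_def by blast

lemma regular_mat_entry:
  "regular_mat C X r c A \<Longrightarrow> i < r \<Longrightarrow> j < c \<Longrightarrow> regular_on C X (\<lambda>x. A x $$ (i, j))"
  unfolding regular_mat_def by blast

lemma regular_mat_transpose:
  assumes A: "regular_mat C X r c A"
  shows "regular_mat C X c r (\<lambda>x. (A x)\<^sup>T)"
proof (rule regular_matI)
  show "(A x)\<^sup>T \<in> carrier_mat c r" if "x \<in> X" for x using regular_mat_carrier[OF A that] by simp
  show "regular_on C X (\<lambda>x. A x $$ (j, i))" if "i < c" "j < r" for i j
    by (rule regular_mat_entry[OF A that(2,1)])
  show "(A x)\<^sup>T $$ (i, j) = A x $$ (j, i)" if "i < c" "j < r" "x \<in> X" for i j x
    using regular_mat_carrier[OF A that(3)] that by simp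
qed

lemma regular_mat_uminus:
  assumes A: "regular_mat C X r c A"
  shows "regular_mat C X r c (\<lambda>x. - A x)"
proof (rule regular_matI)
  show "- A x \<in> carrier_mat r c" if "x \<in> X" for x using regular_mat_carrier[OF A that] by simp
  show "regular_on C X (\<lambda>x. - (A x $$ (i, j)))" if "i < r" "j < c" for i j
    by (rule regular_on_uminus[OF regular_mat_entry[OF A that]])
  show "(- A x) $$ (i, j) = - (A x $$ (i, j))" if "i < r" "j < c" "x \<in> X" for i j x
    using regular_mat_carrier[OF A that(3)] that by simp
qed

lemma regular_mat_kron_left:
  assumes A: "regular_mat C X r c A" and B: "B \<in> carrier_mat r' c'"
  shows "regular_mat C X (r * r') (c * c') (\<lambda>x. kron (A x) B)"
proof (rule regular_matI)
  show "kron (A x) B \<in> carrier_mat (r * r') (c * c')" if "x \<in> X" for x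
    by (rule kron_carrier[OF regular_mat_carrier[OF A that] B])
  show "regular_on C X (\<lambda>x. A x $$ (i div r', j div c') * B $$ (i mod r', j mod c'))"
    if "i < r * r'" "j < c * c'" for i j
    using div_mod_less[OF that(1)] div_mod_less[OF that(2)]
    by (intro regular_on_mult regular_on_const regular_mat_entry[OF A]) auto
  show "kron (A x) B $$ (i, j) = A x $$ (i div r', j div c') * B $$ (i mod r', j mod c')"
    if "i < r * r'" "j < c * c'" "x \<in> X" for i j x
    by (rule kron_index[OF regular_mat_carrier[OF A that(3)] B that(1,2)])
qed

lemma regular_mat_append_rows:
  assumes A: "regular_mat C X r c A" and B: "regular_mat C X r' c B"
  shows "regular_mat C X (r + r') c (\<lambda>x. A x @\<^sub>r B x)"
proof (rule regular_matI)
  show "A x @\<^sub>r B x \<in> carrier_mat (r + r') c" if "x \<in> X" for x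
    by (rule carrier_append_rows[OF regular_mat_carrier[OF A that] regular_mat_carrier[OF B that]])
  show "regular_on C X (\<lambda>x. if i < r then A x $$ (i, j) else B x $$ (i - r, j))"
    if "i < r + r'" "j < c" for i j
  proof (cases "i < r")
    case True
    then show ?thesis using regular_mat_entry[OF A True that(2)] by simp
  next
    case False
    then show ?thesis using regular_mat_entry[OF B _ that(2), of "i - r"] that(1) by simp
  qed
  show "(A x @\<^sub>r B x) $$ (i, j) = (if i < r then A x $$ (i, j) else B x $$ (i - r, j))"
    if "i < r + r'" "j < c" "x \<in> X" for i j x
    using that regular_mat_carrier[OF A that(3)] regular_mat_carrier[OF B that(3)]
    unfolding append_rows_def by (subst index_mat_four_block) auto
qed

lemma append_zero_vec_index:
  fixes w :: "'a::zero vec"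
  assumes "w \<in> carrier_vec e" "i < d + (d' + e)"
  shows "(0\<^sub>v d @\<^sub>v (0\<^sub>v d' @\<^sub>v w)) $ i = (if i < d + d' then 0 else w $ (i - (d + d')))"
  using assms by auto

lemma regular_hom_system:
  assumes K: "regular_mat C X (n + p) n K" and L: "regular_mat C X (n + p) n L"
    and M: "regular_mat C X (n + p) (p + m) M"
    and K': "regular_mat C X (n + p) n K'" and L': "regular_mat C X (n + p) n L'"
    and M': "regular_mat C X (n + p) (p + m) M'"
  shows regular_hom_mat: "regular_mat C X (hom_rows n m p) (hom_cols n p)
      (\<lambda>z. hom_mat n m p (K z, L z, M z) (K' z, L' z, M' z))"
    and regular_framing_vec: "\<And>i. i < hom_rows n m p \<Longrightarrow>
      regular_on C X (\<lambda>z. framing_vec n p (K' z, L' z, M' z) $ i)"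
    and regular_framed_hom_mat: "regular_mat C X (hom_rows n m p) (hom_cols n p + 1)
      (\<lambda>z. framed_hom_mat n m p (K z, L z, M z) (K' z, L' z, M' z))"
proof -
  show 1: "regular_mat C X (hom_rows n m p) (hom_cols n p)
      (\<lambda>z. hom_mat n m p (K z, L z, M z) (K' z, L' z, M' z))"
    unfolding hom_mat_def prod.case
    by (intro regular_mat_append_rows regular_mat_hconcat regular_mat_kron_left regular_mat_kron
      regular_mat_uminus regular_mat_transpose regular_mat_const one_carrier_mat zero_carrier_mat
      K L M K' L')
  let ?d = "n * (n + p)"
  show 2: "regular_on C X (\<lambda>z. framing_vec n p (K' z, L' z, M' z) $ i)" if i: "i < hom_rows n m p" for i
  proof -
    let ?k = "i - (?d + ?d)"
    have "regular_on C X (\<lambda>z. if i < ?d + ?d then 0 else M' z $$ (?k mod (n + p), ?k div (n + p)))"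
    proof (cases "i < ?d + ?d")
      case False
      then have k: "?k < (p + m) * (n + p)" using i by simp
      then show ?thesis
        using False div_mod_less[OF k] regular_mat_entry[OF M', of "?k mod (n + p)" "?k div (n + p)"]
        by simp
    qed (simp add: regular_on_const)
    moreover have "framing_vec n p (K' z, L' z, M' z) $ i =
        (if i < ?d + ?d then 0 else M' z $$ (?k mod (n + p), ?k div (n + p)))" if "z \<in> X" for z
    proof -
      note c = regular_mat_carrier[OF M' that]
      show ?thesis
        using i vec_of_mat_index[OF c, of ?k]
        unfolding framing_vec_def prod.case append_zero_vec_index[OF vec_of_mat_carrier[OF c] i]
        by (cases "i < ?d + ?d") (simp_all del: add_mult_distrib add_mult_distrib2)
    qed
    ultimately show ?thesis by (simp cong: regular_on_cong)
  qed
  have "regular_mat C X (hom_rows n m p) 1 (\<lambda>z. col_mat (framing_vec n p (K' z, L' z, M' z)))"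
  proof (rule regular_matI[OF _ 2])
    fix z assume z: "z \<in> X"
    have c: "framing_vec n p (K' z, L' z, M' z) \<in> carrier_vec (hom_rows n m p)"
      using z K' L' M' by (intro framing_vec_carrier) (auto simp: lomadze_systems_iff regular_mat_carrier)
    then show "col_mat (framing_vec n p (K' z, L' z, M' z)) \<in> carrier_mat (hom_rows n m p) 1"
      by (rule col_mat_carrier)
    fix i j assume "i < hom_rows n m p" "j < (1 :: nat)"
    then show "col_mat (framing_vec n p (K' z, L' z, M' z)) $$ (i, j) = framing_vec n p (K' z, L' z, M' z) $ i"
      using c unfolding col_mat_def by auto
  qed
  then show "regular_mat C X (hom_rows n m p) (hom_cols n p + 1)
      (\<lambda>z. framed_hom_mat n m p (K z, L z, M z) (K' z, L' z, M' z))"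
    unfolding framed_hom_mat_def by (rule regular_mat_hconcat[OF 1])
qed

lemma regular_mat_system_const:
  assumes "x \<in> lomadze_systems n m p"
  shows "regular_mat C Y (n + p) n (\<lambda>_. fst x)" "regular_mat C Y (n + p) n (\<lambda>_. fst (snd x))"
    "regular_mat C Y (n + p) (p + m) (\<lambda>_. snd (snd x))"
  using assms by (auto simp: lomadze_systems_def intro: regular_mat_const)

lemma closedin_orbit:
  fixes x :: "'k::field lomadze"
  assumes x: "x \<in> D" and D: "D \<subseteq> lomadze_systems n m p"
    and orbD: "lomadze_orbit n p x \<subseteq> D"
    and rigid: "\<And>y z. y \<in> D \<Longrightarrow> z \<in> D \<Longrightarrow> rigid_pair n m p y z"
  shows "closedin (zariski (lomadze_coords n m p) D) (lomadze_orbit n p x)"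
proof -
  let ?C = "lomadze_coords n m p :: ('k lomadze \<Rightarrow> 'k) set"
  have xs: "x \<in> lomadze_systems n m p" using x D by blast
  note var = regular_mat_lomadze[THEN regular_mat_subset[OF _ D]]
  note con = regular_mat_system_const[OF xs, of ?C D]
  have "closedin (zariski ?C D) {y \<in> D. \<not> injective_mat (framed_hom_mat n m p x y)}"
    using closedin_noninjective[OF regular_framed_hom_mat[OF con var]] by simp
  moreover have "closedin (zariski ?C D) {y \<in> D. \<not> injective_mat (framed_hom_mat n m p y x)}"
    using closedin_noninjective[OF regular_framed_hom_mat[OF var con]] by simp
  moreover have "lomadze_orbit n p x = {y \<in> D. \<not> injective_mat (framed_hom_mat n m p x y)} \<inter>
      {y \<in> D. \<not> injective_mat (framed_hom_mat n m p y x)}"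
    using orbD orbit_iff_noninjective[OF xs _ rigid[OF x x] rigid[OF x] rigid[OF _ x]] D by blast
  ultimately show ?thesis by (simp add: closedin_Int)
qed

section \<open>The orbit map\<close>

abbreviation group_coords :: "nat \<Rightarrow> nat \<Rightarrow> ('k mat \<times> 'k mat \<Rightarrow> 'k) set" where
  "group_coords n p \<equiv> {\<lambda>(g0, g1). g0 $$ (i, j) | i j. i < n \<and> j < n} \<union>
    {\<lambda>(g0, g1). g1 $$ (i, j) | i j. i < n + p \<and> j < n + p}"

lemma regular_mat_group:
  fixes X :: "('k::field mat \<times> 'k mat) set"
  assumes "X \<subseteq> carrier (lomadze_group n p)"
  shows "regular_mat (group_coords n p) X n n fst" "regular_mat (group_coords n p) X (n + p) (n + p) snd"
proof -
  have c: "fst g \<in> carrier_mat n n \<and> snd g \<in> carrier_mat (n + p) (n + p)" if "g \<in> X" for g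
    using that assms by (cases g) (auto simp: carrier_lomadze_group carrier_GL dest!: subsetD)
  show "regular_mat (group_coords n p) X n n fst"
    by (rule regular_matI[where a = "\<lambda>i j. \<lambda>(g0, g1). g0 $$ (i, j)"])
      (use c in \<open>auto intro!: regular_on_coord\<close>)
  show "regular_mat (group_coords n p) X (n + p) (n + p) snd"
    by (rule regular_matI[where a = "\<lambda>i j. \<lambda>(g0, g1). g1 $$ (i, j)"])
      (use c in \<open>auto intro!: regular_on_coord\<close>)
qed

lemma locally_fraction_inverse_entry:
  fixes n p :: nat
  defines "G \<equiv> carrier (lomadze_group n p :: ('k::field mat \<times> 'k mat) monoid)"
  assumes l: "l < n" and j: "j < n"
  shows "locally_fraction (group_coords n p) G (\<lambda>g. (inv\<^bsub>GL n\<^esub> (fst g)) $$ (l, j))"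
proof -
  have g: "fst g \<in> carrier (GL n)" if "g \<in> G" for g
    using that unfolding G_def by (cases g) (auto simp: carrier_lomadze_group)
  have c: "fst g \<in> carrier_mat n n" if "g \<in> G" for g using g[OF that] by (simp add: carrier_GL)
  have "locally_fraction (group_coords n p) G (\<lambda>g. col ((inv\<^bsub>GL n\<^esub> (fst g))) j $ l)"
  proof (rule locally_fraction_linear_solution)
    show "regular_mat (group_coords n p) G n n fst"
      by (rule regular_mat_group) (simp add: G_def)
    show "injective_mat (fst g)" if "g \<in> G" for g
      unfolding injective_mat_def using GL_inv(1,2)[OF g[OF that]] c[OF that]
      by (intro bexI[of _ "(inv\<^bsub>GL n\<^esub> (fst g))"]) auto
    show "col ((inv\<^bsub>GL n\<^esub> (fst g))) j \<in> carrier_vec n" if "g \<in> G" for g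
      using GL_inv(1)[OF g[OF that]] by (intro carrier_vecI) simp
    show "fst g *\<^sub>v col ((inv\<^bsub>GL n\<^esub> (fst g))) j = unit_vec n j" if "g \<in> G" for g
      using col_mult2[OF c[OF that] GL_inv(1)[OF g[OF that]] j] GL_inv(3)[OF g[OF that]] j by simp
    show "regular_on (group_coords n p) G (\<lambda>_. unit_vec n j $ i)" if "i < n" for i
      by (rule regular_on_const)
  qed (rule l)
  moreover have "col ((inv\<^bsub>GL n\<^esub> (fst g))) j $ l = (inv\<^bsub>GL n\<^esub> (fst g)) $$ (l, j)" if "g \<in> G" for g
    using GL_inv(1)[OF g[OF that]] l j by simp
  ultimately show ?thesis by (simp cong: locally_fraction_cong)
qed

lemma continuous_orbit_map:
  fixes x :: "'k::field lomadze"
  assumes x: "x \<in> lomadze_systems n m p"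
  shows "continuous_map (lomadze_group_top n p) (zariski (lomadze_coords n m p) (lomadze_orbit n p x))
    (\<lambda>g. lomadze_act n p g x)"
  unfolding lomadze_group_top_def
proof (rule continuous_map_zariski)
  let ?G = "carrier (lomadze_group n p :: ('k mat \<times> 'k mat) monoid)"
  show "lomadze_act n p g x \<in> lomadze_orbit n p x" if "g \<in> ?G" for g
    using that unfolding orbit_def by blast
  obtain K L M where xx: "x = (K, L, M)" by (cases x)
  note c = lomadze_systemsD[OF x[unfolded xx]]
  have act: "lomadze_act n p g x = (snd g * K * (inv\<^bsub>GL n\<^esub> (fst g)), snd g * L * (inv\<^bsub>GL n\<^esub> (fst g)), snd g * M)" for g
    by (cases g) (simp add: xx)
  note reg = regular_mat_group(2)[OF order.refl]
  have conj: "locally_fraction (group_coords n p) ?G (\<lambda>g. (snd g * A * (inv\<^bsub>GL n\<^esub> (fst g))) $$ (i, j))"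
    if A: "A \<in> carrier_mat (n + p) n" and ij: "i < n + p" "j < n" for A i j
  proof -
    have gA: "regular_mat (group_coords n p) ?G (n + p) n (\<lambda>g. snd g * A)"
      by (rule regular_mat_mult[OF reg regular_mat_const[OF A]])
    have "locally_fraction (group_coords n p) ?G
        (\<lambda>g. \<Sum>l<n. (snd g * A) $$ (i, l) * (inv\<^bsub>GL n\<^esub> (fst g)) $$ (l, j))"
      using ij by (intro locally_fraction_sum locally_fraction_mult locally_fraction_inverse_entry
        locally_fraction_regular regular_mat_entry[OF gA]) auto
    moreover have "(snd g * A * (inv\<^bsub>GL n\<^esub> (fst g))) $$ (i, j) =
        (\<Sum>l<n. (snd g * A) $$ (i, l) * (inv\<^bsub>GL n\<^esub> (fst g)) $$ (l, j))" if "g \<in> ?G" for g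
    proof (rule mult_mat_entry[OF regular_mat_carrier[OF gA that] _ ij])
      have "fst g \<in> carrier (GL n)" using that by (cases g) (auto simp: carrier_lomadze_group)
      then show "(inv\<^bsub>GL n\<^esub> (fst g)) \<in> carrier_mat n n" by (rule GL_inv(1))
    qed
    ultimately show ?thesis by (simp cong: locally_fraction_cong del: index_mult_mat)
  qed
  have gM: "regular_mat (group_coords n p) ?G (n + p) (p + m) (\<lambda>g. snd g * M)"
    by (rule regular_mat_mult[OF reg regular_mat_const[OF c(3)]])
  fix h :: "'k lomadze \<Rightarrow> 'k" assume "h \<in> lomadze_coords n m p"
  then consider
      (1) i j where "h = (\<lambda>(K, L, M). K $$ (i, j))" "i < n + p" "j < n"
    | (2) i j where "h = (\<lambda>(K, L, M). L $$ (i, j))" "i < n + p" "j < n"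
    | (3) i j where "h = (\<lambda>(K, L, M). M $$ (i, j))" "i < n + p" "j < p + m"
    unfolding lomadze_coords_def by blast
  then show "locally_fraction (group_coords n p) ?G (\<lambda>g. h (lomadze_act n p g x))"
  proof cases
    case 1
    then show ?thesis unfolding act prod.case using conj[OF c(1)] by simp
  next
    case 2
    then show ?thesis unfolding act prod.case using conj[OF c(2)] by simp
  next
    case 3
    then show ?thesis unfolding act prod.case
      using locally_fraction_regular[OF regular_mat_entry[OF gM]] by simp
  qed
qed

text \<open>
  The group element that transports \<open>x\<close> to \<open>y\<close> is the solution of an injective linear system whose
  coefficients and right-hand side are regular in \<open>y\<close>.
\<close>

lemma continuous_orbit_map_inverse:
  fixes x :: "'k::field lomadze"
  assumes x: "x \<in> lomadze_systems n m p" and O: "O' \<subseteq> lomadze_systems n m p"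
    and \<psi>: "\<And>y. y \<in> O' \<Longrightarrow> \<psi> y \<in> carrier (lomadze_group n p) \<and> lomadze_act n p (\<psi> y) x = y"
    and rigid: "\<And>y. y \<in> O' \<Longrightarrow> rigid_pair n m p x y"
  shows "continuous_map (zariski (lomadze_coords n m p) O') (lomadze_group_top n p) \<psi>"
  unfolding lomadze_group_top_def
proof (rule continuous_map_zariski)
  let ?C = "lomadze_coords n m p :: ('k lomadze \<Rightarrow> 'k) set"
  show "\<psi> y \<in> carrier (lomadze_group n p)" if "y \<in> O'" for y using \<psi>[OF that] by blast
  define v where "v y = vec_of_mat (snd (\<psi> y)) @\<^sub>v vec_of_mat (fst (\<psi> y))" for y
  have c: "fst (\<psi> y) \<in> carrier_mat n n" "snd (\<psi> y) \<in> carrier_mat (n + p) (n + p)" if "y \<in> O'" for y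
    using \<psi>[OF that] by (cases "\<psi> y"; auto simp: carrier_lomadze_group carrier_GL)+
  have vc: "v y \<in> carrier_vec (hom_cols n p)" if "y \<in> O'" for y
    unfolding v_def using vec_of_mat_carrier[OF c(1)[OF that]] vec_of_mat_carrier[OF c(2)[OF that]]
    by (intro append_carrier_vec)
  note var = regular_mat_lomadze[THEN regular_mat_subset[OF _ O]]
  note con = regular_mat_system_const[OF x, of ?C O']
  have frac: "locally_fraction ?C O' (\<lambda>y. v y $ k)" if "k < hom_cols n p" for k
  proof (rule locally_fraction_linear_solution[OF _ _ vc _ _ that])
    show "regular_mat ?C O' (hom_rows n m p) (hom_cols n p) (hom_mat n m p x)"
      using regular_hom_mat[OF con var] by simp
    show "injective_mat (hom_mat n m p x y)" if "y \<in> O'" for y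
      using rigid_pair_injective[OF rigid[OF that] x] that O by blast
    show "hom_mat n m p x y *\<^sub>v v y = framing_vec n p y" if "y \<in> O'" for y
    proof -
      have y: "y \<in> lomadze_systems n m p" using that O by blast
      have g: "fst (\<psi> y) \<in> carrier (GL n)" "snd (\<psi> y) \<in> carrier (GL (n + p))"
        using \<psi>[OF that] by (cases "\<psi> y"; auto simp: carrier_lomadze_group)+
      have "framed_hom n p 1 x y (fst (\<psi> y)) (snd (\<psi> y))"
        using \<psi>[OF that] act_eq_iff_framed_hom[OF x y g] by simp
      then have "hom_mat n m p x y *\<^sub>v v y = 1 \<cdot>\<^sub>v framing_vec n p y"
        unfolding v_def hom_mat_mult_eq_framing_iff[OF x y c[OF that]] .
      then show ?thesis by simp
    qed
    show "regular_on ?C O' (\<lambda>y. framing_vec n p y $ i)" if "i < hom_rows n m p" for i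
      using regular_framing_vec[OF con var that] by simp
  qed
  fix h :: "'k mat \<times> 'k mat \<Rightarrow> 'k" assume "h \<in> group_coords n p"
  then consider
      (1) i j where "h = (\<lambda>(g0, g1). g0 $$ (i, j))" "i < n" "j < n"
    | (2) i j where "h = (\<lambda>(g0, g1). g1 $$ (i, j))" "i < n + p" "j < n + p"
    by blast
  then show "locally_fraction ?C O' (\<lambda>y. h (\<psi> y))"
  proof cases
    case 1
    have k: "j * n + i < n * n" by (rule block_index_less[OF 1(3,2)])
    have "h (\<psi> y) = v y $ ((n + p) * (n + p) + (j * n + i))" if "y \<in> O'" for y
      using 1 k vec_of_mat_carrier[OF c(1)[OF that]] vec_of_mat_carrier[OF c(2)[OF that]]
        vec_of_mat_index[OF c(1)[OF that] k]
      unfolding v_def by (simp add: case_prod_beta')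
    then show ?thesis using frac[of "(n + p) * (n + p) + (j * n + i)"] k
      by (simp cong: locally_fraction_cong)
  next
    case 2
    have k: "j * (n + p) + i < (n + p) * (n + p)" by (rule block_index_less[OF 2(3,2)])
    have "(j * q + i) div q = j \<and> (j * q + i) mod q = i" if "i < q" for q :: nat using that by simp
    note dm = this[OF 2(2)]
    have "h (\<psi> y) = v y $ (j * (n + p) + i)" if "y \<in> O'" for y
      using 2 k vec_of_mat_carrier[OF c(1)[OF that]] vec_of_mat_carrier[OF c(2)[OF that]]
        vec_of_mat_index[OF c(2)[OF that] k, unfolded dm[THEN conjunct1] dm[THEN conjunct2]]
      unfolding v_def by (simp add: case_prod_beta')
    then show ?thesis using frac[of "j * (n + p) + i"] k
      by (simp cong: locally_fraction_cong)
  qed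
qed

text \<open>
  The difference of two group elements with the same effect on \<open>x\<close> is a homomorphism that kills the framing.
\<close>

lemma orbit_map_injective:
  fixes x :: "'k::field lomadze"
  assumes x: "x \<in> lomadze_systems n m p"
    and rigid: "\<And>y. y \<in> lomadze_orbit n p x \<Longrightarrow> rigid_pair n m p x y"
  shows "inj_on (\<lambda>g. lomadze_act n p g x) (carrier (lomadze_group n p))"
proof (rule inj_onI)
  fix g h :: "'k mat \<times> 'k mat"
  assume g: "g \<in> carrier (lomadze_group n p)" and h: "h \<in> carrier (lomadze_group n p)"
    and eq: "lomadze_act n p g x = lomadze_act n p h x"
  define y where "y = lomadze_act n p g x"
  have y: "y \<in> lomadze_systems n m p" unfolding y_def by (rule lomadze_act_closed[OF g x])
  have yo: "y \<in> lomadze_orbit n p x" unfolding y_def orbit_def using g by blast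
  obtain g0 g1 h0 h1 where gh: "g = (g0, g1)" "h = (h0, h1)" by (metis surj_pair)
  have G: "g0 \<in> carrier (GL n)" "g1 \<in> carrier (GL (n + p))" "h0 \<in> carrier (GL n)" "h1 \<in> carrier (GL (n + p))"
    using g h unfolding gh carrier_lomadze_group by auto
  have hom: "framed_hom n p 1 x y g0 g1" "framed_hom n p 1 x y h0 h1"
    using act_eq_iff_framed_hom[OF x y G(1,2)] act_eq_iff_framed_hom[OF x y G(3,4)] eq
    unfolding y_def gh by auto
  obtain K L M K' L' M' where xy: "x = (K, L, M)" "y = (K', L', M')" by (metis prod_cases3)
  note cx = lomadze_systemsD[OF x[unfolded xy(1)]] and cy = lomadze_systemsD[OF y[unfolded xy(2)]]
  have c: "g0 \<in> carrier_mat n n" "g1 \<in> carrier_mat (n + p) (n + p)"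
    "h0 \<in> carrier_mat n n" "h1 \<in> carrier_mat (n + p) (n + p)"
    using G by (auto simp: carrier_GL)
  have e: "g1 * K = K' * g0" "g1 * L = L' * g0" "g1 * M = 1 \<cdot>\<^sub>m M'"
    "h1 * K = K' * h0" "h1 * L = L' * h0" "h1 * M = 1 \<cdot>\<^sub>m M'"
    using hom unfolding framed_hom_def xy prod.case by auto
  have "(g1 - h1) * K = K' * (g0 - h0)"
    unfolding minus_mult_distrib_mat[OF c(2,4) cx(1)] mult_minus_distrib_mat[OF cy(1) c(1,3)] e ..
  moreover have "(g1 - h1) * L = L' * (g0 - h0)"
    unfolding minus_mult_distrib_mat[OF c(2,4) cx(2)] mult_minus_distrib_mat[OF cy(2) c(1,3)] e ..
  moreover have "(g1 - h1) * M = 0 \<cdot>\<^sub>m M'"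
    unfolding minus_mult_distrib_mat[OF c(2,4) cx(3)] e by (intro eq_matI) auto
  ultimately have "framed_hom n p 0 x y (g0 - h0) (g1 - h1)"
    unfolding framed_hom_def xy prod.case using c by auto
  from rigid_pairD[OF rigid[OF yo] y this]
  have z: "g0 - h0 = 0\<^sub>m n n" "g1 - h1 = 0\<^sub>m (n + p) (n + p)" by auto
  have diff0: "A - B = 0\<^sub>m r r \<Longrightarrow> A = B"
    if "A \<in> carrier_mat r r" "B \<in> carrier_mat r r" for A B :: "'k mat" and r
    using that by (auto simp: mat_eq_iff)
  show "g = h" unfolding gh using diff0[OF c(1,3) z(1)] diff0[OF c(2,4) z(2)] by simp
qed

text \<open>
  The orbit map is a homeomorphism onto the orbit. Since it is injective, the kernel of the action
  is trivial, and the projection of the group to its quotient is a homeomorphism as well.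
\<close>

lemma krull_dim_orbit:
  fixes x :: "'k::field lomadze"
  assumes x: "x \<in> lomadze_systems n m p"
    and rigid: "\<And>y. y \<in> lomadze_orbit n p x \<Longrightarrow> rigid_pair n m p x y"
  shows "krull_dim (subtopology (lomadze_top n m p) (lomadze_orbit n p x)) =
    krull_dim (lomadze_quotient_top n m p :: ('k mat \<times> 'k mat) set topology)"
proof -
  let ?\<phi> = "\<lambda>g. lomadze_act n p g x" and ?G = "carrier (lomadze_group n p :: ('k mat \<times> 'k mat) monoid)"
  let ?O = "lomadze_orbit n p x" and ?T = "lomadze_group_top n p :: ('k mat \<times> 'k mat) topology"
  have sub: "?O \<subseteq> lomadze_systems n m p" unfolding orbit_def using lomadze_act_closed[OF _ x] by blast
  have top: "topspace ?T = ?G" unfolding lomadze_group_top_def by simp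
  have inj: "inj_on ?\<phi> ?G" by (rule orbit_map_injective[OF x rigid])
  have img: "?O = ?\<phi> ` ?G" unfolding orbit_def by blast
  define \<psi> where "\<psi> = inv_into ?G ?\<phi>"
  have \<psi>: "\<psi> y \<in> ?G \<and> ?\<phi> (\<psi> y) = y" if "y \<in> ?O" for y
    using that unfolding img \<psi>_def by (auto intro: inv_into_into f_inv_into_f)
  have "homeomorphic_maps ?T (zariski (lomadze_coords n m p) ?O) ?\<phi> \<psi>"
    unfolding homeomorphic_maps_def
  proof (intro conjI ballI)
    show "continuous_map ?T (zariski (lomadze_coords n m p) ?O) ?\<phi>" by (rule continuous_orbit_map[OF x])
    show "continuous_map (zariski (lomadze_coords n m p) ?O) ?T \<psi>"
      by (rule continuous_orbit_map_inverse[OF x sub \<psi> rigid])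
    show "\<psi> (?\<phi> g) = g" if "g \<in> topspace ?T" for g
      using inv_into_f_f[OF inj, of g] that unfolding top \<psi>_def by blast
    show "?\<phi> (\<psi> y) = y" if "y \<in> topspace (zariski (lomadze_coords n m p) ?O)" for y
      using that \<psi> by simp
  qed
  then have 1: "krull_dim ?T = krull_dim (zariski (lomadze_coords n m p) ?O)"
    by (intro krull_dim_homeomorphic homeomorphic_maps_imp_map)
  interpret group "lomadze_group n p :: ('k mat \<times> 'k mat) monoid"
    unfolding lomadze_group_def by (rule DirProd_group[OF group_GL group_GL])
  let ?e = "\<one>\<^bsub>lomadze_group n p\<^esub> :: 'k mat \<times> 'k mat"
  have e: "?e = (1\<^sub>m n, 1\<^sub>m (n + p))"
    by (simp add: lomadze_group_def GL_def units_of_one ring_mat_simps)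
  have act_e: "lomadze_act n p ?e y = y" if y: "y \<in> lomadze_systems n m p" for y :: "'k lomadze"
  proof -
    obtain K L M where yy: "y = (K, L, M)" by (cases y)
    note c = lomadze_systemsD[OF y[unfolded yy]]
    have g: "1\<^sub>m n \<in> carrier (GL n :: 'k mat monoid)" "1\<^sub>m (n + p) \<in> carrier (GL (n + p) :: 'k mat monoid)"
      by (auto simp: carrier_GL)
    have "1 \<cdot>\<^sub>m M = M" by (intro eq_matI) auto
    then have "framed_hom n p 1 y y (1\<^sub>m n) (1\<^sub>m (n + p))"
      unfolding framed_hom_def yy prod.case using c by simp
    then show ?thesis unfolding e act_eq_iff_framed_hom[OF y y g] .
  qed
  have ker: "lomadze_kernel n m p = {?e}"
  proof
    show "{?e} \<subseteq> lomadze_kernel n m p" unfolding lomadze_kernel_def using act_e by auto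
    show "lomadze_kernel n m p \<subseteq> {?e}"
    proof
      fix g assume "g \<in> (lomadze_kernel n m p :: ('k mat \<times> 'k mat) set)"
      then have g: "g \<in> ?G" "?\<phi> g = x" unfolding lomadze_kernel_def using x by auto
      then have "?\<phi> g = ?\<phi> ?e" using act_e[OF x] by simp
      then have "g = ?e" using inj_onD[OF inj _ g(1) one_closed] by blast
      then show "g \<in> {?e}" by simp
    qed
  qed
  let ?q = "\<lambda>g. lomadze_kernel n m p #>\<^bsub>lomadze_group n p\<^esub> g :: ('k mat \<times> 'k mat) set"
  have q: "?q g = {g}" if "g \<in> ?G" for g
    unfolding ker r_coset_def using that by simp
  have "homeomorphic_map ?T (lomadze_quotient_top n m p) ?q"
    unfolding homeomorphic_map_def lomadze_quotient_top_def
  proof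
    show "quotient_map ?T (quotient_topology ?T ?q) ?q" by (rule quotient_map_quotient_topology)
    show "inj_on ?q (topspace ?T)" unfolding top using q by (intro inj_onI) auto
  qed
  then have "krull_dim ?T = krull_dim (lomadze_quotient_top n m p :: ('k mat \<times> 'k mat) set topology)"
    by (rule krull_dim_homeomorphic)
  with 1 show ?thesis unfolding lomadze_top_def subtopology_zariski[OF sub] by simp
qed

text \<open>
  A single semi-invariant witnesses stability as soon as the systems on which it does not vanish are
  pairwise rigid.
\<close>

lemma rigid_semistable_imp_stable:
  fixes f :: "'k::field lomadze \<Rightarrow> 'k"
  assumes f: "semi_invariant n m p \<chi> N f" and "N \<ge> 1"
    and S: "S \<in> lomadze_systems n m p" "f S \<noteq> 0"
    and rigid: "\<And>x y. x \<in> lomadze_systems n m p \<Longrightarrow> y \<in> lomadze_systems n m p \<Longrightarrow>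
      f x \<noteq> 0 \<Longrightarrow> f y \<noteq> 0 \<Longrightarrow> rigid_pair n m p x y"
  shows "chi_stable n m p \<chi> S"
  unfolding chi_stable_def
proof (intro exI[of _ N] exI[of _ f] conjI ballI impI)
  let ?D = "{y \<in> lomadze_systems n m p. f y \<noteq> 0}"
  have D: "?D \<subseteq> lomadze_systems n m p" by blast
  have orb: "lomadze_orbit n p x \<subseteq> ?D" if x: "x \<in> lomadze_systems n m p" "f x \<noteq> 0" for x
  proof
    fix y assume "y \<in> lomadze_orbit n p x"
    then obtain g where "g \<in> carrier (lomadze_group n p)" "y = lomadze_act n p g x"
      unfolding orbit_def by blast
    then obtain g0 g1 where g: "(g0, g1) \<in> carrier (lomadze_group n p)"
      and y: "y = lomadze_act n p (g0, g1) x" by (cases g) auto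
    have "f y \<noteq> 0"
      using semi_invariant_act_zero[OF f x(1), of g0 g1] g x(2) unfolding y carrier_lomadze_group by blast
    then show "y \<in> ?D" using lomadze_act_closed[OF g x(1)] y by simp
  qed
  show "closedin (subtopology (lomadze_top n m p) ?D) (lomadze_orbit n p x)"
    if "x \<in> lomadze_systems n m p" "f x \<noteq> 0" for x
    unfolding lomadze_top_def subtopology_zariski[OF D]
    using that by (intro closedin_orbit D orb rigid) auto
  show "krull_dim (subtopology (lomadze_top n m p) (lomadze_orbit n p S)) =
      krull_dim (lomadze_quotient_top n m p :: ('k mat \<times> 'k mat) set topology)"
    using orb[OF S] by (intro krull_dim_orbit[OF S(1)] rigid S) auto
qed (use assms in auto)

section \<open>Stability in the two chambers\<close>

theorem corollary2p12:
  fixes n m p :: nat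
    and S :: "'k::{alg_closed_field, field_char_0} mat \<times> 'k mat \<times> 'k mat"
  assumes "n > 0" and "S \<in> lomadze_systems n m p"
  shows "(\<forall>\<chi>0 \<chi>1 :: int. \<chi>0 \<le> 0 \<and> \<chi>1 \<ge> 0 \<and>
            int n * \<chi>0 + (int n - 1) * \<chi>1 < 0 \<and> \<chi>0 + \<chi>1 > 0 \<longrightarrow>
            (controllable n p S \<longleftrightarrow> chi_semistable n m p (\<chi>0, \<chi>1) S) \<and>
            (chi_semistable n m p (\<chi>0, \<chi>1) S \<longleftrightarrow> chi_stable n m p (\<chi>0, \<chi>1) S)) \<and>
         (\<forall>\<chi>0 \<chi>1 :: int. \<chi>0 \<le> 0 \<and> \<chi>1 \<ge> 0 \<and>
            int n * \<chi>0 + (int n + 1) * \<chi>1 > 0 \<and> \<chi>0 + \<chi>1 < 0 \<longrightarrow>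
            (observable n p S \<longleftrightarrow> chi_semistable n m p (\<chi>0, \<chi>1) S) \<and>
            (chi_semistable n m p (\<chi>0, \<chi>1) S \<longleftrightarrow> chi_stable n m p (\<chi>0, \<chi>1) S))"
proof (intro conjI[of "\<forall>\<chi>0 \<chi>1. _ \<chi>0 \<chi>1"] allI impI; elim conjE)
  fix \<chi>0 \<chi>1 :: int
  assume sgn: "\<chi>0 \<le> 0" "\<chi>1 \<ge> 0" and slope: "int n * \<chi>0 + (int n - 1) * \<chi>1 < 0" and pos: "\<chi>0 + \<chi>1 > 0"
  define a b where "a = nat (- \<chi>0)" and "b = nat \<chi>1"
  have \<chi>: "\<chi>0 = - int a" "\<chi>1 = int b" using sgn unfolding a_def b_def by auto
  have ab: "a < b" using pos unfolding \<chi> by simp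
  have "int (b * n) < int (a * n + b)" using slope unfolding \<chi> by (simp add: algebra_simps)
  then have sl: "b * n < a * n + b" by (simp only: of_nat_less_iff)
  have 1: "controllable n p x"
    if "semi_invariant n m p (- int a, int b) N f" "N \<ge> 1" "x \<in> lomadze_systems n m p" "f x \<noteq> 0"
    for N f and x :: "'k lomadze"
    by (rule semistable_imp_controllable[OF that ab sl])
  have 2: "chi_stable n m p (\<chi>0, \<chi>1) S" if ctrl: "controllable n p S"
  proof -
    obtain f where f: "weight_fun n m p a b f" "f S \<noteq> 0"
      using controllable_semi_invariant[OF assms ctrl ab sl] by blast
    obtain f' where f': "semi_invariant n m p (- int a, int b) 1 f'"
      "\<And>x. x \<in> lomadze_systems n m p \<Longrightarrow> f' x = f x"
      using weight_fun_semi_invariant[OF f(1)] by metis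
    show ?thesis unfolding \<chi>
      by (rule rigid_semistable_imp_stable[OF f'(1) order.refl assms(2)])
        (use f'(2)[OF assms(2)] f(2) 1[OF f'(1)] in \<open>auto intro: controllable_rigid_pair\<close>)
  qed
  have 3: "controllable n p S" if "chi_semistable n m p (\<chi>0, \<chi>1) S"
    using that 1 assms(2) unfolding chi_semistable_def \<chi> by blast
  have 4: "chi_semistable n m p (\<chi>0, \<chi>1) S" if "chi_stable n m p (\<chi>0, \<chi>1) S"
    using that unfolding chi_semistable_def chi_stable_def by blast
  show "(controllable n p S \<longleftrightarrow> chi_semistable n m p (\<chi>0, \<chi>1) S) \<and>
      (chi_semistable n m p (\<chi>0, \<chi>1) S \<longleftrightarrow> chi_stable n m p (\<chi>0, \<chi>1) S)"
    using 2 3 4 by blast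
next
  fix \<chi>0 \<chi>1 :: int
  assume sgn: "\<chi>0 \<le> 0" "\<chi>1 \<ge> 0" and slope: "int n * \<chi>0 + (int n + 1) * \<chi>1 > 0" and neg: "\<chi>0 + \<chi>1 < 0"
  define a b where "a = nat (- \<chi>0)" and "b = nat \<chi>1"
  have \<chi>: "\<chi>0 = - int a" "\<chi>1 = int b" using sgn unfolding a_def b_def by auto
  have ab: "b < a" using neg unfolding \<chi> by simp
  have "int (a * n) < int (b * n + b)" using slope unfolding \<chi> by (simp add: algebra_simps)
  then have sl: "a * n < b * n + b" by (simp only: of_nat_less_iff)
  have 1: "observable n p x"
    if "semi_invariant n m p (- int a, int b) N f" "N \<ge> 1" "x \<in> lomadze_systems n m p" "f x \<noteq> 0"
    for N f and x :: "'k lomadze"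
    by (rule semistable_imp_observable[OF that ab sl])
  have 2: "chi_stable n m p (\<chi>0, \<chi>1) S" if obs: "observable n p S"
  proof -
    obtain f where f: "weight_fun n m p a b f" "f S \<noteq> 0"
      using observable_semi_invariant[OF assms(2) obs ab sl] by blast
    obtain f' where f': "semi_invariant n m p (- int a, int b) 1 f'"
      "\<And>x. x \<in> lomadze_systems n m p \<Longrightarrow> f' x = f x"
      using weight_fun_semi_invariant[OF f(1)] by metis
    show ?thesis unfolding \<chi>
      by (rule rigid_semistable_imp_stable[OF f'(1) order.refl assms(2)])
        (use f'(2)[OF assms(2)] f(2) 1[OF f'(1)] in \<open>auto intro: observable_rigid_pair\<close>)
  qed
  have 3: "observable n p S" if "chi_semistable n m p (\<chi>0, \<chi>1) S"
    using that 1 assms(2) unfolding chi_semistable_def \<chi> by blast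
  have 4: "chi_semistable n m p (\<chi>0, \<chi>1) S" if "chi_stable n m p (\<chi>0, \<chi>1) S"
    using that unfolding chi_semistable_def chi_stable_def by blast
  show "(observable n p S \<longleftrightarrow> chi_semistable n m p (\<chi>0, \<chi>1) S) \<and>
      (chi_semistable n m p (\<chi>0, \<chi>1) S \<longleftrightarrow> chi_stable n m p (\<chi>0, \<chi>1) S)"
    using 2 3 4 by blast
qed

end
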